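(* Let $\alpha>-1$ and let $u:\mathbb{R}^2\to\mathbb{R}$ be a convex generalized (Alexandrov) solution of $$\det\nabla^2 u(x_1,x_2)=|x_1|^{\alpha}\quad\text{in }\mathbb{R}^2.$$ Then there exist constants $a>0$ and $b\in\mathbb{R}$ and a linear function $\ell(x_1,x_2)$ such that for all $(x_1,x_2)\in\mathbb{R}^2$ $$u(x_1,x_2)=\frac{a}{(\alpha+2)(\alpha+1)}|x_1|^{2+\alpha}+\frac{ab^2}{2}x_1^2+b\,x_1x_2+\frac{1}{2a}x_2^2+\ell(x_1,x_2).$$
   Context: Generalized (Alexandrov) solution: for an open set $\Omega\subset\mathbb{R}^2$, a convex function $u$ on $\Omega$ is a generalized solution of $\det\nabla^2u=|x_1|^\alpha$ in $\Omega$ if its Monge-Ampère measure equals $|x_1|^\alpha\,dx_1dx_2$, i.e. for every Borel set $E\subset\Omega$ the Lebesgue measure of $\partial u(E)=\bigcup_{x\in E}\partial u(x)$ (with $\partial u(x)$ the subdifferential of $u$ at $x$) equals $\int_E|x_1|^\alpha\,dx_1dx_2$. "Linear function" means a polynomial of degree at most one, $\ell(x_1,x_2)=c_0+c_1x_1+c_2x_2$ with real constants $c_0,c_1,c_2$. *)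

theory Defs
  imports "HOL-Analysis.Analysis"
begin

definition subdifferential :: "'a::real_inner set \<Rightarrow> ('a \<Rightarrow> real) \<Rightarrow> 'a \<Rightarrow> 'a set" where
  "subdifferential \<Omega> u x = {p. \<forall>y\<in>\<Omega>. u x + p \<bullet> (y - x) \<le> u y}"

(* The measure is taken with respect to the completion "lebesgue": for Borel E the set
   below is the image of E under a set-valued map, which is Lebesgue measurable when u is
   convex, but is not evidently Borel. *)
definition monge_ampere_measure :: "'a::euclidean_space set \<Rightarrow> ('a \<Rightarrow> real) \<Rightarrow> 'a set \<Rightarrow> ennreal" where
  "monge_ampere_measure \<Omega> u E = emeasure lebesgue (\<Union>x\<in>E. subdifferential \<Omega> u x)"

(* Intended for open \<Omega>, convex u and non-negative f.  Both sides of the equation may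
   be infinite. *)
definition generalized_MA_solution ::
  "'a::euclidean_space set \<Rightarrow> ('a \<Rightarrow> real) \<Rightarrow> ('a \<Rightarrow> real) \<Rightarrow> bool" where
  "generalized_MA_solution \<Omega> f u \<longleftrightarrow>
     (\<forall>E\<in>sets borel. E \<subseteq> \<Omega> \<longrightarrow>
        monge_ampere_measure \<Omega> u E = (\<integral>\<^sup>+x\<in>E. ennreal (f x) \<partial>lborel))"

(* A polynomial of degree at most one, so not "linear" in the sense of the library. *)
definition linear_function :: "(real^2 \<Rightarrow> real) \<Rightarrow> bool" where
  "linear_function l \<longleftrightarrow> (\<exists>c0 c1 c2. \<forall>x. l x = c0 + c1 * x $ 1 + c2 * x $ 2)"

end

(* The partial Legendre transform w(x,y) = sup_t (y t - u(x,t)) linearizes the equation to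
   w_xx + |x|^alpha w_yy = 0.  No regularity of u is needed for this: the Monge-Ampere measure of the set
   of points over [a,b] with slope in t between c and d is, on one side, the weighted area between the
   graphs of w_y(.,c) and w_y(.,d), and on the other side the area between the graphs of -w_x(a,.) and
   -w_x(b,.).  That w is finite follows from comparing mass and gradient image on long thin boxes.

   The gauge rho = 4/(2+alpha)^2 |x|^(2+alpha) + (y-y0)^2 turns the operator into a radial one, so that
   solutions satisfy a mean value property over gauge balls centred on the axis x = 0, and Nelson's
   argument applies to the nonnegative solutions w(x,y+2h) - 2 w(x,y+h) + w(x,y) (averaged in y): all
   their moments over gauge balls agree with those of a constant, and Stone-Weierstrass makes them
   constant.  Hence w is quadratic in y, the equation determines its dependence on x, and u is recovered
   by conjugation. *)

theory Submission
  imports Defs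
begin

subsection \<open>Truncated powers\<close>

text \<open>The weight destroys translation invariance in x, so the mean value property holds only
  about points of the axis and, being radial in the gauge, sees only the part of a solution that is
  even in x. The odd part needs moments with an extra factor x; for a nonnegative solution these
  vanish, since they scale with a higher power of the radius than positivity allows. Balls are
  replaced by weights \<open>tpow m (T - \<rho> y0 p)\<close>: they have compact support and, for
  \<open>m\<close> not too small, enough derivatives to integrate by parts without boundary terms.
  Differentiating in \<open>T\<close> lowers \<open>m\<close>; differentiating in \<open>y0\<close>
  yields the factor y - y0. The coordinate s = \<sigma> x turns |x|^\<alpha> dx into ds. The only
  coefficient left that may be singular is the derivative of x in s, and it cancels in Green's
  identity. The Liouville argument needs classical derivatives, while \<open>w\<close> is known only
  to be continuous, convex in y and concave in x. Two averages in y supply two y derivatives;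
  convexity in y supplies the sign of second differences.\<close>

definition tpow :: "nat \<Rightarrow> real \<Rightarrow> real" where
  "tpow m z = (max 0 z) ^ m"

lemma tpow_nonneg [simp]: "0 \<le> tpow m z"
  by (simp add: tpow_def)

lemma tpow_mono: "y \<le> z \<Longrightarrow> tpow m y \<le> tpow m z"
  unfolding tpow_def by (intro power_mono) auto

lemma tpow_eq_0: "z \<le> 0 \<Longrightarrow> m \<noteq> 0 \<Longrightarrow> tpow m z = 0"
  by (simp add: tpow_def)

lemma tpow_Suc: "m \<noteq> 0 \<Longrightarrow> tpow (Suc m) z = z * tpow m z"
  by (cases "z \<le> 0") (auto simp: tpow_def max_def)

lemma continuous_on_tpow [continuous_intros]:
  "continuous_on S f \<Longrightarrow> continuous_on S (\<lambda>x. tpow m (f x))"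
  unfolding tpow_def by (intro continuous_intros)

text \<open>Order 1 has a kink at 0, so the formula starts at order 2. Order 0 is the constant 1,
  not a step function, which is why \<open>m \<noteq> 0\<close> recurs below.\<close>

lemma DERIV_tpow:
  assumes "m \<noteq> 0"
  shows "(tpow (Suc m) has_real_derivative (real (Suc m) * tpow m z)) (at z)"
proof (cases "z = 0")
  case True
  have "((\<lambda>y. tpow (Suc m) y / y) \<longlongrightarrow> 0) (at 0)"
  proof (rule Lim_transform_eventually)
    have "isCont (tpow m) 0"
      using continuous_on_tpow[OF continuous_on_id, of UNIV m]
      by (simp add: continuous_on_eq_continuous_at)
    then show "(tpow m \<longlongrightarrow> 0) (at 0)"
      using assms by (simp add: isCont_def tpow_eq_0)
    show "\<forall>\<^sub>F y in at 0. tpow m y = tpow (Suc m) y / y"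
      by (auto simp: eventually_at_filter tpow_Suc assms)
  qed
  then show ?thesis
    using True assms by (simp add: has_field_derivative_iff tpow_eq_0)
next
  case False
  show ?thesis
  proof (cases "z > 0")
    case True
    have "((\<lambda>z. z ^ Suc m) has_real_derivative real (Suc m) * tpow m z) (at z)"
      using DERIV_pow[of "Suc m" z] True by (simp add: tpow_def)
    then show ?thesis
      by (rule has_field_derivative_transform_within_open[where S="{0<..}"])
        (use True in \<open>auto simp: tpow_def\<close>)
  next
    case neg: False
    have "((\<lambda>z. 0) has_real_derivative real (Suc m) * tpow m z) (at z)"
      using neg \<open>z \<noteq> 0\<close> assms by (auto simp: tpow_eq_0)
    then show ?thesis
      by (rule has_field_derivative_transform_within_open[where S="{..<0}"])
        (use neg \<open>z \<noteq> 0\<close> assms in \<open>auto simp: tpow_eq_0\<close>)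
  qed
qed

lemma DERIV_tpow_chain [derivative_intros]:
  assumes "m \<noteq> 0" and "(f has_real_derivative D) (at z)"
  shows "((\<lambda>x. tpow (Suc m) (f x)) has_real_derivative (real (Suc m) * tpow m (f z) * D)) (at z)"
  using DERIV_chain2[OF DERIV_tpow[OF assms(1)] assms(2)] .

subsection \<open>Signed powers\<close>

definition spow :: "real \<Rightarrow> real \<Rightarrow> real" where
  "spow p x = sgn x * \<bar>x\<bar> powr p"

lemma spow_0 [simp]: "spow p 0 = 0"
  by (simp add: spow_def)

lemma spow_1 [simp]: "spow 1 x = x"
  by (simp add: spow_def sgn_if)

lemma spow_spow: "spow p (spow q x) = spow (q * p) x"
  by (auto simp: spow_def sgn_if abs_mult powr_powr)

lemma abs_spow: "\<bar>spow p x\<bar> = \<bar>x\<bar> powr p"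
  by (auto simp: spow_def sgn_if abs_mult)

text \<open>Each of the two parts is continuous and monotone across 0, which the form with
  \<open>sgn\<close> hides.\<close>

lemma spow_eq: "spow p x = max 0 x powr p - max 0 (- x) powr p"
  by (auto simp: spow_def sgn_if max_def)

lemma continuous_on_spow: "p > 0 \<Longrightarrow> continuous_on S (spow p)"
  unfolding spow_eq[abs_def]
  by (intro continuous_intros continuous_on_powr') (auto intro!: continuous_intros)

lemma DERIV_spow:
  assumes "x \<noteq> 0"
  shows "(spow p has_real_derivative (p * \<bar>x\<bar> powr (p - 1))) (at x)"
proof (cases "x > 0")
  case True
  have "((\<lambda>x. x powr p) has_real_derivative p * \<bar>x\<bar> powr (p - 1)) (at x)"
    using True by (auto intro!: derivative_eq_intros)
  then show ?thesis
    by (rule has_field_derivative_transform_within_open[where S="{0<..}"])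
      (use True in \<open>auto simp: spow_def\<close>)
next
  case False
  have "((\<lambda>x. - ((- x) powr p)) has_real_derivative p * \<bar>x\<bar> powr (p - 1)) (at x)"
    using False assms by (auto intro!: derivative_eq_intros simp: powr_diff)
  then show ?thesis
    by (rule has_field_derivative_transform_within_open[where S="{..<0}"])
      (use False assms in \<open>auto simp: spow_def\<close>)
qed

lemma spow_strict_mono:
  assumes "p > 0" "x < y" shows "spow p x < spow p y"
proof -
  have "max 0 x powr p \<le> max 0 y powr p" "max 0 (- y) powr p \<le> max 0 (- x) powr p"
    using assms by (auto intro!: powr_mono2)
  moreover have "max 0 x powr p < max 0 y powr p \<or> max 0 (- y) powr p < max 0 (- x) powr p"
  proof (cases "y > 0")
    case True
    then have "max 0 x powr p < max 0 y powr p"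
      using assms by (intro powr_less_mono2) auto
    then show ?thesis ..
  next
    case False
    then have "max 0 (- y) powr p < max 0 (- x) powr p"
      using assms by (intro powr_less_mono2) auto
    then show ?thesis ..
  qed
  ultimately show ?thesis unfolding spow_eq by linarith
qed

section \<open>The weight and the coordinate that flattens it\<close>

locale weight =
  fixes \<alpha> :: real
  assumes \<alpha>: "\<alpha> > - 1"
begin

text \<open>The primitive of |x|^\<alpha> vanishing at 0. It is a homeomorphism of the line because
  \<alpha> > -1, and \<open>\<xi>\<close> is its inverse.\<close>

definition \<sigma> :: "real \<Rightarrow> real" where "\<sigma> x = spow (1 + \<alpha>) x / (1 + \<alpha>)"
definition \<xi> :: "real \<Rightarrow> real" where "\<xi> s = spow (1 / (1 + \<alpha>)) ((1 + \<alpha>) * s)"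

lemma \<xi>_\<sigma> [simp]: "\<xi> (\<sigma> x) = x"
  using \<alpha> by (simp add: \<xi>_def \<sigma>_def spow_spow)

lemma \<sigma>_\<xi> [simp]: "\<sigma> (\<xi> s) = s"
  using \<alpha> by (simp add: \<xi>_def \<sigma>_def spow_spow)

lemma \<xi>_0 [simp]: "\<xi> 0 = 0" by (simp add: \<xi>_def)
lemma \<sigma>_0 [simp]: "\<sigma> 0 = 0" by (simp add: \<sigma>_def)

lemma \<sigma>_strict_mono: "x < y \<Longrightarrow> \<sigma> x < \<sigma> y"
  using \<alpha> by (auto simp: \<sigma>_def divide_strict_right_mono spow_strict_mono)

lemma \<sigma>_mono: "x \<le> y \<Longrightarrow> \<sigma> x \<le> \<sigma> y"
  using \<sigma>_strict_mono by (force simp: le_less)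

lemma \<xi>_strict_mono: "x < y \<Longrightarrow> \<xi> x < \<xi> y"
  using \<alpha> by (auto simp: \<xi>_def spow_strict_mono)

lemma \<xi>_mono: "x \<le> y \<Longrightarrow> \<xi> x \<le> \<xi> y"
  using \<xi>_strict_mono by (force simp: le_less)

lemma \<xi>_eq_0 [simp]: "\<xi> s = 0 \<longleftrightarrow> s = 0"
  by (metis \<sigma>_0 \<sigma>_\<xi> \<xi>_0)

lemma \<xi>_minus: "\<xi> (- s) = - \<xi> s"
  by (simp add: \<xi>_def spow_def sgn_minus)

lemma continuous_on_\<xi> [continuous_intros]:
  "continuous_on S f \<Longrightarrow> continuous_on S (\<lambda>x. \<xi> (f x))"
  unfolding \<xi>_def using \<alpha>
  by (intro continuous_on_compose2[OF continuous_on_spow[of _ UNIV]] continuous_intros) auto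

lemma continuous_on_\<sigma> [continuous_intros]:
  "continuous_on S f \<Longrightarrow> continuous_on S (\<lambda>x. \<sigma> (f x))"
  unfolding \<sigma>_def using \<alpha>
  by (intro continuous_intros continuous_on_compose2[OF continuous_on_spow[of _ UNIV]]) auto

lemma DERIV_\<sigma>:
  assumes "x \<noteq> 0" shows "(\<sigma> has_real_derivative \<bar>x\<bar> powr \<alpha>) (at x)"
  unfolding \<sigma>_def using \<alpha> assms
  by (auto intro!: derivative_eq_intros DERIV_spow)

definition \<xi>' :: "real \<Rightarrow> real" where "\<xi>' s = \<xi> s / ((1 + \<alpha>) * s)"

lemma DERIV_\<xi>:
  assumes "s \<noteq> 0" shows "(\<xi> has_real_derivative \<xi>' s) (at s)"
proof -
  have eq: "\<bar>(1 + \<alpha>) * s\<bar> powr (1 / (1 + \<alpha>) - 1) = \<xi>' s"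
    using \<alpha> assms
    by (auto simp: \<xi>'_def \<xi>_def spow_def powr_diff sgn_if abs_mult zero_less_mult_iff mult_less_0_iff)
  have "((\<lambda>s. spow (1 / (1 + \<alpha>)) ((1 + \<alpha>) * s)) has_real_derivative
      (1 / (1 + \<alpha>) * \<bar>(1 + \<alpha>) * s\<bar> powr (1 / (1 + \<alpha>) - 1)) * (1 + \<alpha>)) (at s)"
    using \<alpha> assms by (intro DERIV_chain2[OF DERIV_spow]) (auto intro!: derivative_eq_intros)
  then show ?thesis
    unfolding eq using \<alpha> by (simp add: \<xi>_def[abs_def])
qed

text \<open>Clears the denominator of \<open>\<xi>'\<close>; at \<open>s = 0\<close> both sides are
  0, so no case distinction is needed when it is used.\<close>

lemma \<xi>'_mult: "\<xi>' s * ((1 + \<alpha>) * s) = \<xi> s"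
  using \<alpha> by (cases "s = 0") (auto simp: \<xi>'_def)

subsection \<open>The gauge\<close>

text \<open>In terms of \<open>x = \<xi> s\<close>, \<open>X s\<close> is \<open>4 / (2 + \<alpha>)\<^sup>2 * \<bar>x\<bar> powr (2 + \<alpha>)\<close>. With this constant
  \<open>\<partial>\<^sub>x\<^sub>x + \<bar>x\<bar> powr \<alpha> * \<partial>\<^sub>y\<^sub>y\<close> maps \<open>k (\<rho> y0)\<close> to \<open>\<bar>x\<bar> powr \<alpha>\<close> times the radial function
  \<open>4 \<rho> k'' + \<kappa> k'\<close>.\<close>

definition c0 :: real where "c0 = 4 / (2 + \<alpha>)"

lemma c0_pos: "c0 > 0" using \<alpha> by (simp add: c0_def)

definition X :: "real \<Rightarrow> real" where "X s = c0 * ((1 + \<alpha>) / (2 + \<alpha>)) * (s * \<xi> s)"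

lemma X_eq: "(2 + \<alpha>) * X s = c0 * (1 + \<alpha>) * s * \<xi> s"
  using \<alpha> by (simp add: X_def)

text \<open>This fixes the constant in \<open>X\<close>: it says that the square of the x derivative
  of \<open>X\<close> is 4 |x|^\<alpha> \<open>X\<close>, matching the square of the y derivative of
  (y - y0)^2, which is 4 (y - y0)^2.\<close>

lemma c0_X: "c0 * c0 * (1 + \<alpha>) * s * \<xi> s = 4 * X s"
  using \<alpha> by (simp add: X_def c0_def divide_simps)

lemma s\<xi>_nonneg: "0 \<le> s * \<xi> s"
  using \<xi>_mono[of 0 s] \<xi>_mono[of s 0] by (cases "s \<ge> 0") (auto intro: mult_nonpos_nonpos)

lemma X_nonneg: "0 \<le> X s"
  unfolding X_def using \<alpha> c0_pos by (intro mult_nonneg_nonneg[OF _ s\<xi>_nonneg]) auto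

lemma X_even [simp]: "X (- s) = X s"
  by (simp add: X_def \<xi>_minus)

lemma X_0 [simp]: "X 0 = 0" by (simp add: X_def)

lemma continuous_on_X [continuous_intros]:
  "continuous_on S f \<Longrightarrow> continuous_on S (\<lambda>x. X (f x))"
  unfolding X_def by (intro continuous_intros)

lemma DERIV_X: "(X has_real_derivative c0 * \<xi> s) (at s)"
proof (cases "s = 0")
  case True
  have "((\<lambda>s. s * \<xi> s) has_real_derivative 0) (at 0)"
  proof -
    have "isCont \<xi> 0"
      using continuous_on_\<xi>[OF continuous_on_id, of UNIV] by (simp add: continuous_on_eq_continuous_at)
    then have "(\<xi> \<longlongrightarrow> 0) (at 0)" by (simp add: isCont_def)
    then have "((\<lambda>y. y * \<xi> y / y) \<longlongrightarrow> 0) (at 0)"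
      by (rule Lim_transform_eventually) (auto simp: eventually_at_filter)
    then show ?thesis by (simp add: has_field_derivative_iff)
  qed
  then have "((\<lambda>s. c0 * ((1 + \<alpha>) / (2 + \<alpha>)) * (s * \<xi> s)) has_real_derivative
      c0 * ((1 + \<alpha>) / (2 + \<alpha>)) * 0) (at 0)"
    by (rule DERIV_cmult)
  then show ?thesis using True by (simp add: X_def[abs_def])
next
  case False
  have "((\<lambda>s. c0 * ((1 + \<alpha>) / (2 + \<alpha>)) * (s * \<xi> s)) has_real_derivative
      c0 * ((1 + \<alpha>) / (2 + \<alpha>)) * (s * \<xi>' s + 1 * \<xi> s)) (at s)"
    using DERIV_\<xi>[OF False] by (intro DERIV_cmult) (auto intro!: derivative_eq_intros)
  moreover have "2 + \<alpha> \<noteq> 0" using \<alpha> by linarith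
  then have "(1 + \<alpha>) / (2 + \<alpha>) * (s * \<xi>' s + 1 * \<xi> s) = \<xi> s"
    using \<alpha> False by (simp add: divide_simps \<xi>'_def) (simp add: algebra_simps)
  ultimately have "((\<lambda>s. c0 * ((1 + \<alpha>) / (2 + \<alpha>)) * (s * \<xi> s)) has_real_derivative c0 * \<xi> s) (at s)"
    by (metis mult.assoc)
  then show ?thesis by (simp only: X_def[abs_def])
qed

lemma X_strict_mono:
  assumes "0 \<le> s" "s < t" shows "X s < X t"
proof -
  have "s * \<xi> s < t * \<xi> t"
    using assms \<xi>_mono[of 0 s] \<xi>_strict_mono[of s t] by (intro mult_strict_mono) auto
  then show ?thesis
    unfolding X_def using \<alpha> c0_pos by (intro mult_strict_left_mono) auto
qed

text \<open>\<open>X s\<close> divided by |s| is a positive multiple of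
  \<open>\<xi> \<bar>s\<bar>\<close>, hence at least \<open>X 1\<close> once |s| >= 1; for smaller
  |s| the right side is not positive. Linear growth is enough to bound the sublevel sets.\<close>

lemma X_ge: "X s \<ge> X 1 * (\<bar>s\<bar> - 1)"
proof (cases "\<bar>s\<bar> \<le> 1")
  case True
  then have "X 1 * (\<bar>s\<bar> - 1) \<le> 0" using X_nonneg[of 1] by (simp add: mult_nonneg_nonpos)
  then show ?thesis using X_nonneg[of s] by linarith
next
  case False
  have "X s = X \<bar>s\<bar>" by (simp add: abs_if)
  moreover have "X \<bar>s\<bar> \<ge> X 1 * \<bar>s\<bar>"
  proof -
    have "\<xi> 1 * \<bar>s\<bar> \<le> \<xi> \<bar>s\<bar> * \<bar>s\<bar>" using False by (intro mult_right_mono \<xi>_mono) auto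
    then have "c0 * ((1 + \<alpha>) / (2 + \<alpha>)) * (1 * \<xi> 1 * \<bar>s\<bar>) \<le> c0 * ((1 + \<alpha>) / (2 + \<alpha>)) * (\<bar>s\<bar> * \<xi> \<bar>s\<bar>)"
      using \<alpha> c0_pos by (intro mult_left_mono) (auto simp: mult.commute)
    then show ?thesis by (simp add: X_def mult.assoc)
  qed
  ultimately show ?thesis using X_nonneg[of 1] by (simp add: algebra_simps)
qed

lemma X_1_pos: "X 1 > 0" using X_strict_mono[of 0 1] by simp

definition \<rho> :: "real \<Rightarrow> real \<times> real \<Rightarrow> real" where "\<rho> y0 p = X (fst p) + (snd p - y0)\<^sup>2"

lemma continuous_on_\<rho> [continuous_intros]:
  "continuous_on S f \<Longrightarrow> continuous_on S g \<Longrightarrow> continuous_on S (\<lambda>x. \<rho> (f x) (g x))"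
  unfolding \<rho>_def by (intro continuous_intros)

text \<open>The first entry makes \<open>X\<close> exceed \<open>B\<close> through the bound
  \<open>X_ge\<close>; the second forces |y - y0| > |B| + 1 whenever |y0| <= \<open>B\<close>. One
  box thus serves all centres and levels bounded by \<open>B\<close>.\<close>

definition box_radius :: "real \<Rightarrow> real" where
  "box_radius B = max (2 + \<bar>B\<bar> / X 1) (2 * \<bar>B\<bar> + 2)"

abbreviation support_box :: "real \<Rightarrow> (real \<times> real) set" where
  "support_box B \<equiv> cbox (- box_radius B, - box_radius B) (box_radius B, box_radius B)"

lemma box_radius_pos: "box_radius B > 0"
  unfolding box_radius_def by linarith

lemma \<rho>_coercive:
  assumes y0: "\<bar>y0\<bar> \<le> B" and p: "p \<notin> support_box B"
  shows "\<rho> y0 p > B"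
proof -
  define M where "M = max (2 + \<bar>B\<bar> / X 1) (2 * \<bar>B\<bar> + 2)"
  have p: "p \<notin> cbox (- M, - M) (M, M)" using p by (simp add: M_def box_radius_def)
  have "\<bar>fst p\<bar> > M \<or> \<bar>snd p\<bar> > M"
    using p by (cases p) (auto simp: abs_if split: if_splits)
  then show "\<rho> y0 p > B"
  proof
    assume "\<bar>fst p\<bar> > M"
    then have "\<bar>fst p\<bar> - 1 > \<bar>B\<bar> / X 1" unfolding M_def by linarith
    then have "X 1 * (\<bar>fst p\<bar> - 1) > \<bar>B\<bar>" using X_1_pos by (simp add: field_simps)
    then have "X (fst p) > B" using X_ge[of "fst p"] by linarith
    then show ?thesis unfolding \<rho>_def by (smt (verit) zero_le_power2)
  next
    assume "\<bar>snd p\<bar> > M"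
    then have *: "\<bar>snd p - y0\<bar> > \<bar>B\<bar> + 1" using y0 unfolding M_def by linarith
    have "(\<bar>B\<bar> + 1) * 1 \<le> (\<bar>B\<bar> + 1) * (\<bar>B\<bar> + 1)" by (intro mult_left_mono) auto
    also have "\<dots> \<le> \<bar>snd p - y0\<bar> * \<bar>snd p - y0\<bar>" using * by (intro mult_mono) auto
    also have "\<dots> = (snd p - y0)\<^sup>2" by (simp add: power2_eq_square)
    finally have "(snd p - y0)\<^sup>2 \<ge> \<bar>B\<bar> + 1" by simp
    then show ?thesis unfolding \<rho>_def using X_nonneg[of "fst p"] abs_ge_self[of B] by linarith
  qed
qed

end

subsection \<open>Moments over gauge balls\<close>

lemma integral_compact_support:
  fixes F :: "real \<times> real \<Rightarrow> real"
  assumes "continuous_on UNIV F" and "\<And>p. p \<notin> cbox a b \<Longrightarrow> F p = 0"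
  shows "F integrable_on UNIV" and "integral UNIV F = integral (cbox a b) F"
proof -
  have "F integrable_on cbox a b"
    using assms(1) by (intro integrable_continuous) (auto intro: continuous_on_subset)
  then have "(F has_integral integral (cbox a b) F) UNIV"
    using has_integral_on_superset assms(2) by blast
  then show "F integrable_on UNIV" and "integral UNIV F = integral (cbox a b) F"
    by (auto simp: integral_unique)
qed

context weight
begin

text \<open>The point \<open>p\<close> is (s, y), so Lebesgue measure here is |x|^\<alpha> dx dy in
  the original coordinates. For \<open>m \<noteq> 0\<close> and continuous \<open>F\<close> the
  integrand is continuous with compact support.\<close>

definition mom :: "(real \<times> real \<Rightarrow> real) \<Rightarrow> nat \<Rightarrow> real \<Rightarrow> real \<Rightarrow> real" where
  "mom F m T y0 = integral UNIV (\<lambda>p. F p * tpow m (T - \<rho> y0 p))"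

lemma continuous_on_mom_integrand:
  assumes "continuous_on UNIV F"
  shows "continuous_on UNIV (\<lambda>p. F p * tpow m (T - \<rho> y0 p))"
  using assms by (intro continuous_intros)

lemma tpow_outside:
  assumes "m \<noteq> 0" "\<bar>y0\<bar> \<le> B" "T \<le> B" "p \<notin> support_box B"
  shows "tpow m (T - \<rho> y0 p) = 0"
  using \<rho>_coercive[of y0 B p] assms by (simp add: tpow_eq_0)

lemma mom_box:
  assumes "continuous_on UNIV F" "m \<noteq> 0" "\<bar>y0\<bar> \<le> B" "T \<le> B"
  shows "mom F m T y0 = integral (support_box B) (\<lambda>p. F p * tpow m (T - \<rho> y0 p))"
  unfolding mom_def
  by (rule integral_compact_support(2)[OF continuous_on_mom_integrand])
    (use assms tpow_outside in auto)

lemma mom_integrable: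
  assumes "continuous_on UNIV F" "m \<noteq> 0"
  shows "(\<lambda>p. F p * tpow m (T - \<rho> y0 p)) integrable_on UNIV"
  by (rule integral_compact_support(1)[OF continuous_on_mom_integrand[OF assms(1)]])
    (use assms(2) tpow_outside[of m y0 "max T \<bar>y0\<bar>" T] in auto)

lemma mom_add:
  assumes "continuous_on UNIV F" "continuous_on UNIV G" "m \<noteq> 0"
  shows "mom (\<lambda>p. F p + G p) m T y0 = mom F m T y0 + mom G m T y0"
  unfolding mom_def distrib_right
  by (rule integral_add; rule mom_integrable; fact)

lemma mom_cmult: "mom (\<lambda>p. c * F p) m T y0 = c * mom F m T y0"
  unfolding mom_def by (simp add: mult.assoc)

lemma mom_diff:
  assumes "continuous_on UNIV F" "continuous_on UNIV G" "m \<noteq> 0"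
  shows "mom (\<lambda>p. F p - G p) m T y0 = mom F m T y0 - mom G m T y0"
  unfolding mom_def left_diff_distrib
  by (rule integral_diff; rule mom_integrable; fact)

lemma mom_mono:
  assumes "continuous_on UNIV F" "continuous_on UNIV G" "m \<noteq> 0"
    and "\<And>p. F p * tpow m (T - \<rho> y0 p) \<le> G p * tpow m (T' - \<rho> y1 p)"
  shows "mom F m T y0 \<le> mom G m T' y1"
  unfolding mom_def
  by (rule integral_le[OF mom_integrable mom_integrable]) (use assms in auto)

lemma DERIV_mom:
  assumes F: "continuous_on UNIV F" and m: "m \<noteq> 0"
  shows "((\<lambda>T. mom F (Suc m) T y0) has_real_derivative real (Suc m) * mom F m T y0) (at T)"
proof -
  \<comment> \<open>One box for all levels below \<open>T + 1\<close>, so that the domain of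
    integration does not move with the parameter.\<close>
  let ?B = "max (T + 1) \<bar>y0\<bar>"
  note M = mom_box[where B = ?B]
  let ?U = "{..<T + 1}"
  have c: "continuous_on S (\<lambda>z. F (snd z))" for S :: "(real \<times> real \<times> real) set"
    by (rule continuous_on_compose2[OF F]) (auto intro!: continuous_intros)
  have "((\<lambda>T. integral (support_box ?B) (\<lambda>p. F p * tpow (Suc m) (T - \<rho> y0 p)))
      has_real_derivative integral (support_box ?B) (\<lambda>p. F p * (real (Suc m) * tpow m (T - \<rho> y0 p))))
      (at T within ?U)"
  proof (rule leibniz_rule_field_derivative)
    show "((\<lambda>T. F p * tpow (Suc m) (T - \<rho> y0 p)) has_real_derivative
        F p * (real (Suc m) * tpow m (T - \<rho> y0 p))) (at T within ?U)" for T p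
      by (rule has_field_derivative_at_within) (use m in \<open>auto intro!: derivative_eq_intros\<close>)
    show "(\<lambda>p. F p * tpow (Suc m) (T - \<rho> y0 p)) integrable_on support_box ?B" for T
      by (rule integrable_continuous)
        (rule continuous_on_subset[OF continuous_on_mom_integrand[OF F]], auto)
    show "continuous_on (?U \<times> support_box ?B) (\<lambda>(T, p). F p * (real (Suc m) * tpow m (T - \<rho> y0 p)))"
      unfolding case_prod_beta by (intro continuous_intros c)
  qed auto
  moreover have "integral (support_box ?B) (\<lambda>p. F p * (real (Suc m) * tpow m (T - \<rho> y0 p))) =
      real (Suc m) * mom F m T y0"
    using M[OF F m, of y0 T] by (simp add: mult.left_commute[of _ "real (Suc m)"] del: of_nat_Suc)
  ultimately have "((\<lambda>T. integral (support_box ?B) (\<lambda>p. F p * tpow (Suc m) (T - \<rho> y0 p)))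
      has_real_derivative real (Suc m) * mom F m T y0) (at T)"
    by (simp add: at_within_open[of T "?U"])
  then show ?thesis
    by (rule has_field_derivative_transform_within_open[where S="?U"]) (use M[OF F, of "Suc m" y0] in auto)
qed

text \<open>The weight depends on the centre only through (y - y0)^2, so moving the centre produces
  the multiplier y - y0; this is how multiplication by y is reached later.\<close>

lemma DERIV_mom_center:
  assumes F: "continuous_on UNIV F" and m: "m \<noteq> 0"
  shows "((\<lambda>y0. mom F (Suc m) T y0) has_real_derivative
      real (Suc m) * mom (\<lambda>p. F p * (2 * (snd p - y0))) m T y0) (at y0)"
proof -
  let ?B = "max T (\<bar>y0\<bar> + 1)"
  note M = mom_box[where B = ?B]
  let ?U = "{y0 - 1 <..< y0 + 1}"
  have c: "continuous_on S (\<lambda>z. F (snd z))" for S :: "(real \<times> real \<times> real) set"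
    by (rule continuous_on_compose2[OF F]) (auto intro!: continuous_intros)
  have "((\<lambda>y0. integral (support_box ?B) (\<lambda>p. F p * tpow (Suc m) (T - \<rho> y0 p)))
      has_real_derivative integral (support_box ?B)
        (\<lambda>p. F p * (real (Suc m) * tpow m (T - \<rho> y0 p) * (2 * (snd p - y0)))))
      (at y0 within ?U)"
  proof (rule leibniz_rule_field_derivative)
    show "((\<lambda>y0. F p * tpow (Suc m) (T - \<rho> y0 p)) has_real_derivative
        F p * (real (Suc m) * tpow m (T - \<rho> y0 p) * (2 * (snd p - y0)))) (at y0 within ?U)" for y0 p
    proof -
      have "((\<lambda>y0. T - \<rho> y0 p) has_real_derivative 2 * (snd p - y0)) (at y0)"
        unfolding \<rho>_def by (auto intro!: derivative_eq_intros)
      from DERIV_cmult[OF DERIV_tpow_chain[OF m this], of "F p"] show ?thesis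
        by (rule has_field_derivative_at_within)
    qed
    show "(\<lambda>p. F p * tpow (Suc m) (T - \<rho> y0 p)) integrable_on support_box ?B" for y0
      by (rule integrable_continuous)
        (rule continuous_on_subset[OF continuous_on_mom_integrand[OF F]], auto)
    show "continuous_on (?U \<times> support_box ?B)
        (\<lambda>(y0, p). F p * (real (Suc m) * tpow m (T - \<rho> y0 p) * (2 * (snd p - y0))))"
      unfolding case_prod_beta by (intro continuous_intros c)
  qed auto
  moreover have "integral (support_box ?B)
        (\<lambda>p. F p * (real (Suc m) * tpow m (T - \<rho> y0 p) * (2 * (snd p - y0)))) =
      real (Suc m) * mom (\<lambda>p. F p * (2 * (snd p - y0))) m T y0"
  proof -
    have "continuous_on UNIV (\<lambda>p. F p * (2 * (snd p - y0)))"
      using F by (intro continuous_intros)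
    from M[OF this m, of y0 T] have "real (Suc m) * mom (\<lambda>p. F p * (2 * (snd p - y0))) m T y0 =
      real (Suc m) * integral (support_box ?B) (\<lambda>p. F p * (2 * (snd p - y0)) * tpow m (T - \<rho> y0 p))"
      by simp
    also have "\<dots> = integral (support_box ?B)
        (\<lambda>p. real (Suc m) * (F p * (2 * (snd p - y0)) * tpow m (T - \<rho> y0 p)))"
      by (rule integral_mult_right[symmetric])
    finally show ?thesis
      by (simp only: mult.left_commute mult.commute mult.assoc)
  qed
  ultimately have "((\<lambda>y0. integral (support_box ?B) (\<lambda>p. F p * tpow (Suc m) (T - \<rho> y0 p)))
      has_real_derivative real (Suc m) * mom (\<lambda>p. F p * (2 * (snd p - y0))) m T y0) (at y0)"
    by (simp add: at_within_open[of y0 "?U"] del: of_nat_Suc)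
  then show ?thesis
    by (rule has_field_derivative_transform_within_open[where S="?U"]) (use M[OF F, of "Suc m" _ T] in auto)
qed

text \<open>Since \<open>d/dT mom F m T = m * mom F (m - 1) T\<close>, the hypothesis is Euler's equation for the power \<open>m + \<kappa>/4\<close>.\<close>

lemma mom_power_law:
  assumes F: "continuous_on UNIV F" and m: "2 \<le> m" and T: "T > 0"
    and eq: "\<And>T. T > 0 \<Longrightarrow> 4 * T * real m * mom F (m - 1) T y0 = (4 * real m + \<kappa>) * mom F m T y0"
  shows "mom F m T y0 = mom F m 1 y0 * T powr (m + \<kappa> / 4)"
proof -
  obtain k where k: "m = Suc k" "k \<noteq> 0" using m by (cases m) auto
  define e where "e = m + \<kappa> / 4"
  let ?g = "\<lambda>T. mom F m T y0 * T powr (- e)"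
  have "(?g has_real_derivative 0) (at T)" if "T > 0" for T
  proof -
    have 1: "T powr (- e - 1) = T powr (- e) / T" using that by (simp add: powr_diff)
    have 2: "m * mom F k T y0 = e * mom F m T y0 / T"
      using eq[OF that] that k by (simp add: field_simps e_def)
    have "(?g has_real_derivative
        (m * mom F k T y0) * T powr (- e) + (- e * T powr (- e - 1)) * mom F m T y0) (at T)"
      using DERIV_mult[OF DERIV_mom[OF F k(2), of y0 T]
          has_real_derivative_powr[OF that, of "- e"]] unfolding k(1) .
    then show ?thesis unfolding 1 2 by (simp add: mult.commute)
  qed
  then have "\<forall>T\<in>{0<..}. (?g has_real_derivative 0) (at T within {0<..})"
    by (auto intro: has_field_derivative_at_within)
  then obtain c where "\<And>T. T \<in> {0<..} \<Longrightarrow> ?g T = c"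
    using has_field_derivative_zero_constant[of "{0<..}" ?g] by (auto simp: convex_real_interval)
  from this[of T] this[of 1] T have "?g T = ?g 1" by simp
  then show ?thesis using T by (simp add: powr_minus field_simps e_def)
qed

subsection \<open>Green's identity\<close>

text \<open>Solutions are written in the coordinate \<open>s = \<sigma> x\<close>, in which the weight \<open>\<bar>x\<bar>\<^sup>\<alpha>\<close> becomes Lebesgue measure;
  \<open>Z\<close> is the derivative in \<open>x\<close>, so that the last condition is \<open>v_xx = - \<bar>x\<bar>\<^sup>\<alpha> v_yy\<close>.\<close>

definition solution :: "(real \<times> real \<Rightarrow> real) \<Rightarrow> bool" where
  "solution V \<longleftrightarrow> continuous_on UNIV V \<and> (\<exists>V1 V2 Z. continuous_on UNIV V2 \<and>
     (\<forall>s y. ((\<lambda>y. V (s, y)) has_real_derivative V1 (s, y)) (at y)) \<and>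
     (\<forall>s y. ((\<lambda>y. V1 (s, y)) has_real_derivative V2 (s, y)) (at y)) \<and>
     (\<forall>s y. s \<noteq> 0 \<longrightarrow> ((\<lambda>s. V (s, y)) has_real_derivative \<xi>' s * Z (s, y)) (at s)) \<and>
     (\<forall>s y. ((\<lambda>s. Z (s, y)) has_real_derivative - V2 (s, y)) (at s)))"

lemma solution_const: "solution (\<lambda>_. c)"
  unfolding solution_def
  by (intro conjI exI[of _ "\<lambda>_. 0"]) (auto intro: continuous_intros)

lemma solution_diff_const:
  assumes "solution V" shows "solution (\<lambda>p. V p - c)"
proof -
  obtain V1 V2 Z where "continuous_on UNIV V" "continuous_on UNIV V2"
     "\<And>s y. ((\<lambda>y. V (s, y)) has_real_derivative V1 (s, y)) (at y)"
     "\<And>s y. ((\<lambda>y. V1 (s, y)) has_real_derivative V2 (s, y)) (at y)"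
     "\<And>s y. s \<noteq> 0 \<Longrightarrow> ((\<lambda>s. V (s, y)) has_real_derivative \<xi>' s * Z (s, y)) (at s)"
     "\<And>s y. ((\<lambda>s. Z (s, y)) has_real_derivative - V2 (s, y)) (at s)"
    using assms unfolding solution_def by blast
  then show ?thesis
    unfolding solution_def
    by (intro conjI exI[of _ V1] exI[of _ V2] exI[of _ Z])
      (auto intro!: continuous_intros derivative_eq_intros)
qed

text \<open>Here \<zeta> is the x derivative of \<phi>, and \<eta> + \<open>\<phi>2\<close> is the
  operator applied to \<phi>, divided by |x|^\<alpha>. In the s direction the expression \<phi> Z -
  V \<zeta> is differentiated: the two terms containing \<open>\<xi>'\<close> cancel, so its
  possible singularity at \<open>s = 0\<close> is never integrated and continuity there suffices.
  The boundary conditions remove all end terms.\<close>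

lemma green_identity:
  assumes "solution V"
    and \<phi>: "continuous_on UNIV \<phi>" "continuous_on UNIV \<eta>" "continuous_on UNIV \<phi>2"
    and \<phi>s: "\<And>s y. s \<noteq> 0 \<Longrightarrow> ((\<lambda>s. \<phi> (s, y)) has_real_derivative \<xi>' s * \<zeta> (s, y)) (at s)"
    and \<zeta>s: "\<And>s y. ((\<lambda>s. \<zeta> (s, y)) has_real_derivative \<eta> (s, y)) (at s)"
    and \<phi>y: "\<And>s y. ((\<lambda>y. \<phi> (s, y)) has_real_derivative \<phi>1 (s, y)) (at y)"
    and \<phi>1y: "\<And>s y. ((\<lambda>y. \<phi>1 (s, y)) has_real_derivative \<phi>2 (s, y)) (at y)"
    and M: "M \<ge> 0"
    and bd: "\<And>s y. \<bar>s\<bar> = M \<or> \<bar>y\<bar> = M \<Longrightarrow> \<phi> (s, y) = 0 \<and> \<zeta> (s, y) = 0 \<and> \<phi>1 (s, y) = 0"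
  shows "integral (cbox (- M, - M) (M, M)) (\<lambda>p. V p * (\<eta> p + \<phi>2 p)) = 0"
proof -
  obtain V1 V2 Z where V: "continuous_on UNIV V" "continuous_on UNIV V2"
     "\<And>s y. ((\<lambda>y. V (s, y)) has_real_derivative V1 (s, y)) (at y)"
     "\<And>s y. ((\<lambda>y. V1 (s, y)) has_real_derivative V2 (s, y)) (at y)"
     "\<And>s y. s \<noteq> 0 \<Longrightarrow> ((\<lambda>s. V (s, y)) has_real_derivative \<xi>' s * Z (s, y)) (at s)"
     "\<And>s y. ((\<lambda>s. Z (s, y)) has_real_derivative - V2 (s, y)) (at s)"
    using assms(1) unfolding solution_def by blast
  have cs: "continuous_on S (\<lambda>s. F (s, y))" if "continuous_on UNIV F" for F :: "real \<times> real \<Rightarrow> real" and S y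
    by (rule continuous_on_compose2[OF that]) (auto intro!: continuous_intros)
  have cy: "continuous_on S (\<lambda>y. F (s, y))" if "continuous_on UNIV F" for F :: "real \<times> real \<Rightarrow> real" and S s
    by (rule continuous_on_compose2[OF that]) (auto intro!: continuous_intros)
  have cd: "continuous_on S f" if "\<And>s. (f has_real_derivative f' s) (at s)" for f f' :: "real \<Rightarrow> real" and S
    by (meson DERIV_continuous continuous_at_imp_continuous_on that)
  have 1: "integral (cbox (- M) M) (\<lambda>s. \<phi> (s, y) * V2 (s, y) + V (s, y) * \<eta> (s, y)) = 0" for y
  proof -
    have "((\<lambda>s. - (\<phi> (s, y) * V2 (s, y) + V (s, y) * \<eta> (s, y))) has_integral
        (\<phi> (M, y) * Z (M, y) - V (M, y) * \<zeta> (M, y)) - (\<phi> (- M, y) * Z (- M, y) - V (- M, y) * \<zeta> (- M, y))) {- M..M}"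
    proof (rule fundamental_theorem_of_calculus_interior_strong[where S="{0}"])
      show "continuous_on {- M..M} (\<lambda>s. \<phi> (s, y) * Z (s, y) - V (s, y) * \<zeta> (s, y))"
        by (intro continuous_intros cs[OF \<phi>(1)] cs[OF V(1)] cd[OF V(6)] cd[OF \<zeta>s])
      fix s :: real assume "s \<in> {- M<..<M} - {0}"
      then have "s \<noteq> 0" by simp
      have "((\<lambda>s. \<phi> (s, y) * Z (s, y) - V (s, y) * \<zeta> (s, y)) has_real_derivative
         - (\<phi> (s, y) * V2 (s, y) + V (s, y) * \<eta> (s, y))) (at s)"
        using \<phi>s[OF \<open>s \<noteq> 0\<close>, of y] V(5)[OF \<open>s \<noteq> 0\<close>, of y] V(6)[of y s] \<zeta>s[of y s]
        by (auto intro!: derivative_eq_intros simp: algebra_simps)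
      then show "((\<lambda>s. \<phi> (s, y) * Z (s, y) - V (s, y) * \<zeta> (s, y)) has_vector_derivative
         - (\<phi> (s, y) * V2 (s, y) + V (s, y) * \<eta> (s, y))) (at s)"
        by (simp add: has_real_derivative_iff_has_vector_derivative)
    qed (use M in auto)
    then have "((\<lambda>s. - (\<phi> (s, y) * V2 (s, y) + V (s, y) * \<eta> (s, y))) has_integral 0) {- M..M}"
      using bd[of M y] bd[of "- M" y] M by simp
    from has_integral_neg[OF this] show ?thesis by (simp add: integral_unique add.commute)
  qed
  have 2: "integral (cbox (- M) M) (\<lambda>y. \<phi> (s, y) * V2 (s, y) - V (s, y) * \<phi>2 (s, y)) = 0" for s
  proof -
    have "((\<lambda>y. \<phi> (s, y) * V2 (s, y) - V (s, y) * \<phi>2 (s, y)) has_integral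
        (\<phi> (s, M) * V1 (s, M) - V (s, M) * \<phi>1 (s, M)) - (\<phi> (s, - M) * V1 (s, - M) - V (s, - M) * \<phi>1 (s, - M))) {- M..M}"
    proof (rule fundamental_theorem_of_calculus)
      fix y :: real
      have "((\<lambda>y. \<phi> (s, y) * V1 (s, y) - V (s, y) * \<phi>1 (s, y)) has_real_derivative
         \<phi> (s, y) * V2 (s, y) - V (s, y) * \<phi>2 (s, y)) (at y)"
        using \<phi>y[of s y] \<phi>1y[of s y] V(3)[of s y] V(4)[of s y]
        by (auto intro!: derivative_eq_intros simp: algebra_simps)
      then show "((\<lambda>y. \<phi> (s, y) * V1 (s, y) - V (s, y) * \<phi>1 (s, y)) has_vector_derivative
         \<phi> (s, y) * V2 (s, y) - V (s, y) * \<phi>2 (s, y)) (at y within {- M..M})"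
        by (simp add: has_real_derivative_iff_has_vector_derivative has_vector_derivative_at_within)
    qed (use M in auto)
    then show ?thesis using bd[of s M] bd[of s "- M"] M by (simp add: integral_unique)
  qed
  let ?Q = "cbox (- M, - M) (M, M)"
  have c1: "continuous_on ?Q (\<lambda>(s, y). \<phi> (s, y) * V2 (s, y) + V (s, y) * \<eta> (s, y))"
    and c2: "continuous_on ?Q (\<lambda>p. \<phi> p * V2 p - V p * \<phi>2 p)"
    and c1': "continuous_on ?Q (\<lambda>p. \<phi> p * V2 p + V p * \<eta> p)"
    using V(1,2) \<phi> unfolding case_prod_beta prod.collapse
    by (auto intro!: continuous_intros intro: continuous_on_subset)
  have "integral ?Q (\<lambda>p. \<phi> p * V2 p + V p * \<eta> p) =
      integral (cbox (- M) M) (\<lambda>s. integral (cbox (- M) M) (\<lambda>y. \<phi> (s, y) * V2 (s, y) + V (s, y) * \<eta> (s, y)))"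
    using integral_prod_continuous[OF c1'] .
  also have "\<dots> = integral (cbox (- M) M) (\<lambda>y. integral (cbox (- M) M) (\<lambda>s. \<phi> (s, y) * V2 (s, y) + V (s, y) * \<eta> (s, y)))"
    by (rule integral_swap_continuous[OF c1])
  also have "\<dots> = 0" unfolding 1 by simp
  finally have 3: "integral ?Q (\<lambda>p. \<phi> p * V2 p + V p * \<eta> p) = 0" .
  have 4: "integral ?Q (\<lambda>p. \<phi> p * V2 p - V p * \<phi>2 p) = 0"
    unfolding integral_prod_continuous[OF c2] 2 by simp
  have "integral ?Q (\<lambda>p. V p * (\<eta> p + \<phi>2 p)) =
      integral ?Q (\<lambda>p. (\<phi> p * V2 p + V p * \<eta> p) - (\<phi> p * V2 p - V p * \<phi>2 p))"
    by (simp add: algebra_simps)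
  also have "\<dots> = 0"
    using integral_diff[OF integrable_continuous[OF c1'] integrable_continuous[OF c2]] 3 4 by simp
  finally show ?thesis .
qed

text \<open>\<open>\<kappa> / 4\<close> is the homogeneous dimension of the gauge: s scales like the
  power (1 + \<alpha>) / (2 + \<alpha>) of the level \<open>T\<close> and y like its square root,
  and the two exponents add up to \<open>\<kappa> / 4\<close>.\<close>

definition \<kappa> :: real where "\<kappa> = 2 + c0 * (1 + \<alpha>)"

lemma mom_eq_big_box:
  assumes "continuous_on UNIV F" "m \<noteq> 0" "\<bar>y0\<bar> \<le> B" "T \<le> B" "M \<ge> box_radius B"
  shows "mom F m T y0 = integral (cbox (- M, - M) (M, M)) (\<lambda>p. F p * tpow m (T - \<rho> y0 p))"
  unfolding mom_def
proof (rule integral_compact_support(2)[OF continuous_on_mom_integrand[OF assms(1)]])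
  fix p assume "p \<notin> cbox (- M, - M) (M, M)"
  then have "p \<notin> support_box B" using assms(5) by (cases p) auto
  then show "F p * tpow m (T - \<rho> y0 p) = 0" using tpow_outside assms(2-4) by simp
qed

text \<open>The extra 1 puts these lines strictly outside the support box, so that test functions
  vanish on the boundary of the domain used in Green's identity.\<close>

lemma tpow_\<rho>_boundary:
  assumes "m \<noteq> 0" "\<bar>y0\<bar> \<le> B" "T \<le> B" "\<bar>s\<bar> = box_radius B + 1 \<or> \<bar>y\<bar> = box_radius B + 1"
  shows "tpow m (T - \<rho> y0 (s, y)) = 0"
proof (rule tpow_outside[OF assms(1-3)])
  show "(s, y) \<notin> support_box B"
    using assms(4) by (auto simp: abs_if split: if_splits)
qed

lemma DERIV_tpow_\<rho>_s:
  "m \<noteq> 0 \<Longrightarrow> ((\<lambda>s. tpow (Suc m) (T - \<rho> y0 (s, y))) has_real_derivative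
     - (real (Suc m) * tpow m (T - \<rho> y0 (s, y)) * (c0 * \<xi> s))) (at s)"
  unfolding \<rho>_def using DERIV_X[of s]
  by (auto intro!: derivative_eq_intros)

lemma DERIV_tpow_\<rho>_y:
  "m \<noteq> 0 \<Longrightarrow> ((\<lambda>y. tpow (Suc m) (T - \<rho> y0 (s, y))) has_real_derivative
     - (real (Suc m) * tpow m (T - \<rho> y0 (s, y)) * (2 * (y - y0)))) (at y)"
  unfolding \<rho>_def by (auto intro!: derivative_eq_intros simp: algebra_simps)

text \<open>Common end of the even and odd cases: \<open>G\<close> is the solution times the
  operator applied to a test function of order \<open>Suc m\<close>, whose first derivative
  contributes the factor \<open>Suc m\<close>. Only linearity of the integral is left.\<close>

lemma mom_identity_generic:
  assumes m: "2 \<le> m" and c: "continuous_on UNIV F"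
    and int: "integral (cbox (- (box_radius (max T \<bar>y0\<bar>) + 1), - (box_radius (max T \<bar>y0\<bar>) + 1))
         (box_radius (max T \<bar>y0\<bar>) + 1, box_radius (max T \<bar>y0\<bar>) + 1)) G = 0"
    and G: "\<And>p. G p = - real (Suc m) *
       (F p * ((4 * real m + k) * tpow m (T - \<rho> y0 p) - 4 * T * real m * tpow (m - 1) (T - \<rho> y0 p)))"
  shows "4 * T * real m * mom F (m - 1) T y0 = (4 * real m + k) * mom F m T y0"
proof -
  let ?M = "box_radius (max T \<bar>y0\<bar>) + 1"
  define Q where "Q = cbox (- ?M, - ?M) (?M, ?M)"
  have i: "(\<lambda>p. F p * tpow n (T - \<rho> y0 p)) integrable_on Q" for n
    unfolding Q_def
    by (rule integrable_continuous) (rule continuous_on_subset[OF continuous_on_mom_integrand[OF c]], auto)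
  have "integral Q (\<lambda>p. - real (Suc m) *
       (F p * ((4 * real m + k) * tpow m (T - \<rho> y0 p) - 4 * T * real m * tpow (m - 1) (T - \<rho> y0 p)))) = 0"
    using int unfolding Q_def G[abs_def] .
  then have int': "integral Q (\<lambda>p. F p * ((4 * real m + k) * tpow m (T - \<rho> y0 p) - 4 * T * real m * tpow (m - 1) (T - \<rho> y0 p))) = 0"
    unfolding integral_mult_right by simp
  have "0 = integral Q (\<lambda>p. (4 * real m + k) * (F p * tpow m (T - \<rho> y0 p)) - 4 * T * real m * (F p * tpow (m - 1) (T - \<rho> y0 p)))"
    using int' by (simp add: algebra_simps)
  also have "\<dots> = (4 * real m + k) * integral Q (\<lambda>p. F p * tpow m (T - \<rho> y0 p))
       - 4 * T * real m * integral Q (\<lambda>p. F p * tpow (m - 1) (T - \<rho> y0 p))"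
    using integral_diff[OF integrable_on_mult_right[OF i[of m]] integrable_on_mult_right[OF i[of "m - 1"]]]
    by simp
  finally have "4 * T * real m * integral Q (\<lambda>p. F p * tpow (m - 1) (T - \<rho> y0 p)) =
       (4 * real m + k) * integral Q (\<lambda>p. F p * tpow m (T - \<rho> y0 p))" by linarith
  moreover have "mom F n T y0 = integral Q (\<lambda>p. F p * tpow n (T - \<rho> y0 p))" if "n \<noteq> 0" for n
    unfolding Q_def by (rule mom_eq_big_box[OF c that, where B = "max T \<bar>y0\<bar>"]) auto
  moreover have "m \<noteq> 0" "m - 1 \<noteq> 0" using m by auto
  ultimately show ?thesis by (simp only: not_False_eq_True of_nat_mult of_nat_numeral)
qed

text \<open>Green's identity with the radial test function of order m + 1. The operator produces
  \<rho> times the weight of order m - 1; writing \<rho> = T - (T - \<rho>) splits this into weights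
  of orders m - 1 and m. The bound \<open>2 \<le> m\<close> keeps the lowest weight
  continuous.\<close>

lemma mom_identity_even:
  assumes V: "solution V" and m: "2 \<le> m"
  shows "4 * T * real m * mom V (m - 1) T y0 = (4 * real m + \<kappa>) * mom V m T y0"
proof -
  obtain k where k: "m = Suc k" "k \<noteq> 0" using m by (cases m) auto
  let ?t = "\<lambda>m p. tpow m (T - \<rho> y0 p)"
  let ?B = "max T \<bar>y0\<bar>"
  let ?M = "box_radius ?B + 1"
  let ?\<eta> = "\<lambda>p. - real (Suc m) * (c0 * (1 + \<alpha>) * ?t m p - 4 * real m * X (fst p) * ?t k p)"
  let ?\<phi>2 = "\<lambda>p. - real (Suc m) * (2 * ?t m p - 4 * real m * (snd p - y0)\<^sup>2 * ?t k p)"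
  have cV: "continuous_on UNIV V" using V by (simp add: solution_def)
  have "integral (cbox (- ?M, - ?M) (?M, ?M)) (\<lambda>p. V p * (?\<eta> p + ?\<phi>2 p)) = 0"
  \<comment> \<open>\<open>\<zeta>\<close> is the x derivative of the test function:
    \<open>X\<close> has x derivative \<open>c0 * (1 + \<alpha>) * s\<close>.\<close>
  proof (rule green_identity[OF V, where \<phi> = "?t (Suc m)"
        and \<zeta> = "\<lambda>p. - (real (Suc m) * c0 * (1 + \<alpha>) * fst p * ?t m p)"
        and ?\<phi>1.0 = "\<lambda>p. - (real (Suc m) * (2 * (snd p - y0)) * ?t m p)"])
    show "continuous_on UNIV (?t (Suc m))" "continuous_on UNIV ?\<eta>" "continuous_on UNIV ?\<phi>2"
      by (intro continuous_intros)+
    fix s y :: real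
    show "((\<lambda>s. ?t (Suc m) (s, y)) has_real_derivative
        \<xi>' s * - (real (Suc m) * c0 * (1 + \<alpha>) * fst (s, y) * ?t m (s, y))) (at s)"
    proof -
      have "\<xi>' s * - (real (Suc m) * c0 * (1 + \<alpha>) * fst (s, y) * ?t m (s, y)) =
         - (real (Suc m) * ?t m (s, y) * (c0 * \<xi> s))"
        unfolding \<xi>'_mult[of s, symmetric] by (simp add: algebra_simps)
      then show ?thesis using DERIV_tpow_\<rho>_s[of m T y0 y s] m by (simp only:)
    qed
    show "((\<lambda>s. - (real (Suc m) * c0 * (1 + \<alpha>) * fst (s, y) * ?t m (s, y))) has_real_derivative ?\<eta> (s, y)) (at s)"
    proof -
      have "((\<lambda>s. (- (real (Suc m) * c0 * (1 + \<alpha>))) * (s * ?t m (s, y))) has_real_derivative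
          (- (real (Suc m) * c0 * (1 + \<alpha>))) * (s * (- (real m * ?t k (s, y) * (c0 * \<xi> s))) + 1 * ?t m (s, y))) (at s)"
        unfolding k(1) by (intro DERIV_cmult DERIV_mult' DERIV_ident DERIV_tpow_\<rho>_s k(2))
      moreover have "(- (real (Suc m) * c0 * (1 + \<alpha>))) * (s * (- (real m * ?t k (s, y) * (c0 * \<xi> s))) + 1 * ?t m (s, y))
        = - real (Suc m) * (c0 * (1 + \<alpha>) * ?t m (s, y) - real m * (c0 * c0 * (1 + \<alpha>) * s * \<xi> s) * ?t k (s, y))"
        by (simp add: algebra_simps)
      ultimately show ?thesis unfolding c0_X by (simp add: mult.assoc mult.left_commute)
    qed
    show "((\<lambda>y. ?t (Suc m) (s, y)) has_real_derivative - (real (Suc m) * (2 * (snd (s, y) - y0)) * ?t m (s, y))) (at y)"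
      using DERIV_tpow_\<rho>_y[of m T y0 s y] m by (simp add: algebra_simps)
    show "((\<lambda>y. - (real (Suc m) * (2 * (snd (s, y) - y0)) * ?t m (s, y))) has_real_derivative ?\<phi>2 (s, y)) (at y)"
    proof -
      have "((\<lambda>y. (- real (Suc m)) * ((2 * (y - y0)) * ?t m (s, y))) has_real_derivative
          (- real (Suc m)) * ((2 * (y - y0)) * (- (real m * ?t k (s, y) * (2 * (y - y0)))) + 2 * ?t m (s, y))) (at y)"
        unfolding k(1) by (intro DERIV_cmult DERIV_mult' DERIV_tpow_\<rho>_y k(2)) (auto intro!: derivative_eq_intros)
      then show ?thesis by (simp add: algebra_simps power2_eq_square)
    qed
    assume "\<bar>s\<bar> = ?M \<or> \<bar>y\<bar> = ?M"
    then show "?t (Suc m) (s, y) = 0 \<and> - (real (Suc m) * c0 * (1 + \<alpha>) * fst (s, y) * ?t m (s, y)) = 0 \<and>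
        - (real (Suc m) * (2 * (snd (s, y) - y0)) * ?t m (s, y)) = 0"
      using tpow_\<rho>_boundary[of _ y0 ?B T s y] m by simp
  qed (use box_radius_pos[of ?B] in auto)
  then show ?thesis
  proof (rule mom_identity_generic[OF m cV])
    fix p
    show "V p * (?\<eta> p + ?\<phi>2 p) = (- real (Suc m)) *
      (V p * ((4 * real m + \<kappa>) * ?t m p - 4 * T * real m * ?t (m - 1) p))"
    proof -
      have "\<rho> y0 p * ?t k p = T * ?t k p - ?t m p"
        using tpow_Suc[OF k(2), of "T - \<rho> y0 p"] k(1) by (simp add: algebra_simps)
      then have e: "X (fst p) * ?t k p + (snd p - y0)\<^sup>2 * ?t k p = T * ?t k p - ?t m p"
        by (simp add: \<rho>_def distrib_right)
      have "?\<eta> p + ?\<phi>2 p = - real (Suc m) *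
         (\<kappa> * ?t m p - 4 * real m * (X (fst p) * ?t k p + (snd p - y0)\<^sup>2 * ?t k p))"
        by (simp add: \<kappa>_def algebra_simps)
      also have "\<dots> = - real (Suc m) * ((4 * real m + \<kappa>) * ?t m p - 4 * T * real m * ?t k p)"
        unfolding e by (simp add: algebra_simps)
      finally show ?thesis using k by simp
    qed
  qed
qed

text \<open>The test function is x times the radial one. Since x itself is annihilated by the
  operator, the only change is the cross term, twice the x derivative of the radial factor; it adds
  \<open>2 * c0\<close> to the constant.\<close>

lemma mom_identity_odd:
  assumes V: "solution V" and m: "2 \<le> m"
  shows "4 * T * real m * mom (\<lambda>p. V p * \<xi> (fst p)) (m - 1) T y0 =
    (4 * real m + (\<kappa> + 2 * c0)) * mom (\<lambda>p. V p * \<xi> (fst p)) m T y0"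
proof -
  obtain k where k: "m = Suc k" "k \<noteq> 0" using m by (cases m) auto
  let ?t = "\<lambda>m p. tpow m (T - \<rho> y0 p)"
  let ?B = "max T \<bar>y0\<bar>"
  let ?M = "box_radius ?B + 1"
  let ?\<phi> = "\<lambda>p. \<xi> (fst p) * ?t (Suc m) p"
  \<comment> \<open>The x derivative of x times the radial weight: x times the x derivative of
    \<open>X\<close> equals \<open>(2 + \<alpha>) * X\<close>.\<close>
  let ?\<zeta> = "\<lambda>p. ?t (Suc m) p - (2 + \<alpha>) * X (fst p) * real (Suc m) * ?t m p"
  let ?\<phi>1 = "\<lambda>p. - (\<xi> (fst p) * (real (Suc m) * (2 * (snd p - y0)) * ?t m p))"
  let ?\<eta> = "\<lambda>p. - real (Suc m) * \<xi> (fst p) * (c0 * (3 + \<alpha>) * ?t m p - 4 * real m * X (fst p) * ?t k p)"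
  let ?\<phi>2 = "\<lambda>p. - real (Suc m) * \<xi> (fst p) * (2 * ?t m p - 4 * real m * (snd p - y0)\<^sup>2 * ?t k p)"
  have c4: "(2 + \<alpha>) * c0 = 4" using \<alpha> by (simp add: c0_def divide_simps)
  have cV: "continuous_on UNIV (\<lambda>p. V p * \<xi> (fst p))"
    using V by (auto simp: solution_def intro!: continuous_intros)
  have "integral (cbox (- ?M, - ?M) (?M, ?M)) (\<lambda>p. V p * (?\<eta> p + ?\<phi>2 p)) = 0"
  proof (rule green_identity[OF V, where \<phi> = ?\<phi> and \<zeta> = ?\<zeta> and ?\<phi>1.0 = ?\<phi>1])
    show "continuous_on UNIV ?\<phi>" "continuous_on UNIV ?\<eta>" "continuous_on UNIV ?\<phi>2"
      by (intro continuous_intros)+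
    fix s y :: real
    show "((\<lambda>s. ?\<phi> (s, y)) has_real_derivative \<xi>' s * ?\<zeta> (s, y)) (at s)" if "s \<noteq> 0"
    proof -
      have "((\<lambda>s. \<xi> s * ?t (Suc m) (s, y)) has_real_derivative
          \<xi> s * (- (real (Suc m) * ?t m (s, y) * (c0 * \<xi> s))) + \<xi>' s * ?t (Suc m) (s, y)) (at s)"
        by (intro DERIV_mult' DERIV_\<xi> that DERIV_tpow_\<rho>_s) (use m in auto)
      moreover have "\<xi>' s * ((2 + \<alpha>) * X s) = c0 * \<xi> s * \<xi> s"
      proof -
        have "\<xi>' s * ((2 + \<alpha>) * X s) = c0 * \<xi> s * (\<xi>' s * ((1 + \<alpha>) * s))"
          unfolding X_eq by (simp only: mult_ac)
        then show ?thesis unfolding \<xi>'_mult .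
      qed
      moreover have "\<xi>' s * ?\<zeta> (s, y) = \<xi>' s * ?t (Suc m) (s, y) - \<xi>' s * ((2 + \<alpha>) * X s) * (real (Suc m) * ?t m (s, y))"
        by (simp add: algebra_simps)
      ultimately have "((\<lambda>s. \<xi> s * ?t (Suc m) (s, y)) has_real_derivative \<xi>' s * ?\<zeta> (s, y)) (at s)"
        by (simp add: algebra_simps)
      then show ?thesis by (simp only: fst_conv)
    qed
    show "((\<lambda>s. ?\<zeta> (s, y)) has_real_derivative ?\<eta> (s, y)) (at s)"
    proof -
      have "((\<lambda>s. ?t (Suc m) (s, y) - ((2 + \<alpha>) * real (Suc m)) * (X s * ?t m (s, y))) has_real_derivative
          - (real (Suc m) * ?t m (s, y) * (c0 * \<xi> s)) - ((2 + \<alpha>) * real (Suc m)) *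
           (X s * (- (real m * ?t k (s, y) * (c0 * \<xi> s))) + (c0 * \<xi> s) * ?t m (s, y))) (at s)"
        unfolding k(1) by (intro DERIV_diff DERIV_cmult DERIV_mult' DERIV_X DERIV_tpow_\<rho>_s k(2)) simp
      moreover have "- (real (Suc m) * ?t m (s, y) * (c0 * \<xi> s)) - ((2 + \<alpha>) * real (Suc m)) *
           (X s * (- (real m * ?t k (s, y) * (c0 * \<xi> s))) + (c0 * \<xi> s) * ?t m (s, y))
        = - real (Suc m) * \<xi> s * (c0 * (3 + \<alpha>) * ?t m (s, y) - ((2 + \<alpha>) * c0) * real m * X s * ?t k (s, y))"
        by (simp add: algebra_simps)
      ultimately show ?thesis unfolding c4 by (simp add: mult.assoc mult.left_commute del: of_nat_Suc)
    qed
    show "((\<lambda>y. ?\<phi> (s, y)) has_real_derivative ?\<phi>1 (s, y)) (at y)"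
      using DERIV_cmult[OF DERIV_tpow_\<rho>_y[of m T y0 s y], of "\<xi> s"] m by (simp add: algebra_simps)
    show "((\<lambda>y. ?\<phi>1 (s, y)) has_real_derivative ?\<phi>2 (s, y)) (at y)"
    proof -
      have "((\<lambda>y. (- real (Suc m) * \<xi> s) * ((2 * (y - y0)) * ?t m (s, y))) has_real_derivative
          (- real (Suc m) * \<xi> s) * ((2 * (y - y0)) * (- (real m * ?t k (s, y) * (2 * (y - y0)))) + 2 * ?t m (s, y))) (at y)"
        unfolding k(1) by (intro DERIV_cmult DERIV_mult' DERIV_tpow_\<rho>_y k(2)) (auto intro!: derivative_eq_intros)
      then show ?thesis by (simp add: algebra_simps power2_eq_square)
    qed
    assume "\<bar>s\<bar> = ?M \<or> \<bar>y\<bar> = ?M"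
    then show "?\<phi> (s, y) = 0 \<and> ?\<zeta> (s, y) = 0 \<and> ?\<phi>1 (s, y) = 0"
      using tpow_\<rho>_boundary[of _ y0 ?B T s y] m by simp
  qed (use box_radius_pos[of ?B] in auto)
  then show ?thesis
  proof (rule mom_identity_generic[OF m cV])
    fix p
    have "\<rho> y0 p * ?t k p = T * ?t k p - ?t m p"
      using tpow_Suc[OF k(2), of "T - \<rho> y0 p"] k(1) by (simp add: algebra_simps)
    then have e: "X (fst p) * ?t k p + (snd p - y0)\<^sup>2 * ?t k p = T * ?t k p - ?t m p"
      by (simp add: \<rho>_def distrib_right)
    have "?\<eta> p + ?\<phi>2 p = - real (Suc m) * \<xi> (fst p) *
       ((\<kappa> + 2 * c0) * ?t m p - 4 * real m * (X (fst p) * ?t k p + (snd p - y0)\<^sup>2 * ?t k p))"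
      by (simp add: \<kappa>_def algebra_simps)
    also have "\<dots> = - real (Suc m) * \<xi> (fst p) * ((4 * real m + (\<kappa> + 2 * c0)) * ?t m p - 4 * T * real m * ?t k p)"
      unfolding e by (simp add: algebra_simps)
    finally show "V p * (?\<eta> p + ?\<phi>2 p) = (- real (Suc m)) *
      (V p * \<xi> (fst p) * ((4 * real m + (\<kappa> + 2 * c0)) * ?t m p - 4 * T * real m * ?t (m - 1) p))"
      using k by simp
  qed
qed

lemma mom_law_even:
  assumes "solution V" "2 \<le> m" "T > 0"
  shows "mom V m T y0 = mom V m 1 y0 * T powr (m + \<kappa> / 4)"
  by (rule mom_power_law[OF _ assms(2,3) mom_identity_even[OF assms(1,2)]])
    (use assms(1) in \<open>simp add: solution_def\<close>)

lemma mom_law_odd: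
  assumes "solution V" "2 \<le> m" "T > 0"
  shows "mom (\<lambda>p. V p * \<xi> (fst p)) m T y0 =
    mom (\<lambda>p. V p * \<xi> (fst p)) m 1 y0 * T powr (m + (\<kappa> + 2 * c0) / 4)"
  by (rule mom_power_law[OF _ assms(2,3) mom_identity_odd[OF assms(1,2)]])
    (use assms(1) in \<open>auto simp: solution_def intro!: continuous_intros\<close>)

subsection \<open>Positive solutions are constant\<close>

text \<open>As in Nelson's proof of Liouville's theorem: a gauge ball of radius \<open>R\<close> about one point of the axis lies in
  the ball of radius \<open>R + d\<close> about another, and \<open>(R + d) / R\<close> tends to 1.\<close>

lemma mom_center_le:
  assumes V: "solution V" and pos: "\<And>p. V p \<ge> 0" and m: "2 \<le> m"
  shows "mom V m 1 y0 \<le> mom V m 1 y1"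
proof -
  let ?d = "\<bar>y0 - y1\<bar>" and ?e = "m + \<kappa> / 4"
  have cV: "continuous_on UNIV V" using V by (simp add: solution_def)
  have le: "mom V m 1 y0 \<le> mom V m 1 y1 * ((1 + ?d / R)\<^sup>2 powr ?e)" if R: "R > 0" for R
  proof -
    have "mom V m (R\<^sup>2) y0 \<le> mom V m ((R + ?d)\<^sup>2) y1"
    proof (rule mom_mono[OF cV cV])
      fix p :: "real \<times> real"
      show "V p * tpow m (R\<^sup>2 - \<rho> y0 p) \<le> V p * tpow m ((R + ?d)\<^sup>2 - \<rho> y1 p)"
      proof (cases "R\<^sup>2 - \<rho> y0 p \<le> 0")
        case True
        then show ?thesis using pos[of p] m by (simp add: tpow_eq_0)
      next
        case False
        then have "(snd p - y0)\<^sup>2 \<le> R\<^sup>2" unfolding \<rho>_def using X_nonneg[of "fst p"] by linarith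
        then have a: "\<bar>snd p - y0\<bar> \<le> R" using R by (simp add: abs_le_square_iff[symmetric])
        have "(y0 - y1) * (snd p - y0) \<le> ?d * \<bar>snd p - y0\<bar>"
          by (metis abs_ge_self abs_mult)
        also have "\<dots> \<le> ?d * R" using a by (intro mult_left_mono) auto
        finally have b: "(y0 - y1) * (snd p - y0) \<le> ?d * R" .
        have "(snd p - y1)\<^sup>2 = (snd p - y0)\<^sup>2 + 2 * ((y0 - y1) * (snd p - y0)) + (y0 - y1)\<^sup>2"
          by (simp add: power2_eq_square algebra_simps)
        also have "\<dots> \<le> (snd p - y0)\<^sup>2 + 2 * (?d * R) + ?d\<^sup>2" using b by simp
        finally have "R\<^sup>2 - \<rho> y0 p \<le> (R + ?d)\<^sup>2 - \<rho> y1 p"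
          by (simp add: \<rho>_def power2_sum algebra_simps)
        then show ?thesis by (intro mult_left_mono tpow_mono pos)
      qed
    qed (use m in auto)
    then have "mom V m 1 y0 * (R\<^sup>2) powr ?e \<le> mom V m 1 y1 * ((R + ?d)\<^sup>2) powr ?e"
      using mom_law_even[OF V m, of "R\<^sup>2" y0] mom_law_even[OF V m, of "(R + ?d)\<^sup>2" y1] R by simp
    moreover have "(R + ?d)\<^sup>2 = R\<^sup>2 * (1 + ?d / R)\<^sup>2" using R by (simp add: field_simps flip: power_mult_distrib)
    moreover have "(R\<^sup>2 * (1 + ?d / R)\<^sup>2) powr ?e = (R\<^sup>2) powr ?e * ((1 + ?d / R)\<^sup>2 powr ?e)"
      by (rule powr_mult)
    ultimately have "(R\<^sup>2) powr ?e * mom V m 1 y0 \<le> (R\<^sup>2) powr ?e * (mom V m 1 y1 * ((1 + ?d / R)\<^sup>2 powr ?e))"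
      by (simp add: mult_ac)
    then show ?thesis using R by (simp add: mult_le_cancel_left)
  qed
  have "((\<lambda>R. ?d / R) \<longlongrightarrow> 0) at_top"
    by (rule real_tendsto_divide_at_top[OF tendsto_const filterlim_ident])
  then have "((\<lambda>R. mom V m 1 y1 * ((1 + ?d / R)\<^sup>2 powr ?e)) \<longlongrightarrow> mom V m 1 y1 * ((1 + 0)\<^sup>2 powr ?e)) at_top"
    by (intro tendsto_intros) auto
  moreover have "\<forall>\<^sub>F R in at_top. mom V m 1 y0 \<le> mom V m 1 y1 * ((1 + ?d / R)\<^sup>2 powr ?e)"
    using eventually_gt_at_top[of 0] by eventually_elim (rule le)
  ultimately show ?thesis
    using tendsto_lowerbound[where F = at_top] by fastforce
qed

lemma mom_eq_0_imp:
  assumes F: "continuous_on UNIV F" "\<And>p. F p \<ge> 0" and m: "m \<noteq> 0" and 0: "mom F m T y0 = 0"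
  shows "F p * tpow m (T - \<rho> y0 p) = 0"
proof (cases "p \<in> support_box (max T \<bar>y0\<bar>)")
  case True
  let ?B = "max T \<bar>y0\<bar>"
  have "integral (support_box ?B) (\<lambda>p. F p * tpow m (T - \<rho> y0 p)) = 0"
    using mom_box[OF F(1) m, of y0 ?B T] 0 by simp
  moreover have "(0, 0) \<in> box (- box_radius ?B, - box_radius ?B) (box_radius ?B, box_radius ?B)"
    using box_radius_pos[of ?B] by (auto simp: mem_box Basis_prod_def)
  then have "box (- box_radius ?B, - box_radius ?B) (box_radius ?B, box_radius ?B) \<noteq> {}" by blast
  ultimately show ?thesis
    using True F(2)
    by (subst (asm) integral_cbox_eq_0_iff)
      (auto intro!: continuous_on_subset[OF continuous_on_mom_integrand[OF F(1)]])
next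
  case False
  then show ?thesis using tpow_outside[OF m, of y0 "max T \<bar>y0\<bar>" T p] by simp
qed

text \<open>Inverts \<open>X\<close> = c0 / (2 + \<alpha>) |x|^(2 + \<alpha>): on a gauge ball of
  level \<open>T\<close> the coordinate x has order at most
  \<open>T powr (1 / (2 + \<alpha>))\<close>.\<close>

lemma abs_\<xi>_le:
  assumes "X s \<le> T"
  shows "\<bar>\<xi> s\<bar> \<le> ((2 + \<alpha>) / c0) powr (1 / (2 + \<alpha>)) * T powr (1 / (2 + \<alpha>))"
proof (cases "s = 0")
  case False
  let ?a = "\<bar>\<xi> s\<bar>"
  have a: "?a > 0" using False by simp
  have "(1 + \<alpha>) * s = spow (1 + \<alpha>) (\<xi> s)"
    using \<sigma>_\<xi>[of s] \<alpha> by (simp add: \<sigma>_def field_simps)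
  then have "\<bar>(1 + \<alpha>) * s\<bar> = ?a powr (1 + \<alpha>)" by (simp only: abs_spow)
  then have "(1 + \<alpha>) * \<bar>s\<bar> = ?a powr (1 + \<alpha>)" using \<alpha> by (simp add: abs_mult)
  moreover have "s * \<xi> s = \<bar>s\<bar> * ?a" using s\<xi>_nonneg[of s] by (metis abs_mult abs_of_nonneg)
  moreover have "(2 + \<alpha>) / c0 * X s = (1 + \<alpha>) * (s * \<xi> s)"
    using X_eq[of s] c0_pos by (simp add: divide_simps)
  ultimately have "(2 + \<alpha>) / c0 * X s = ?a powr (1 + \<alpha>) * ?a"
    by simp
  also have "\<dots> = ?a powr (2 + \<alpha>)" using a powr_add[of ?a "1 + \<alpha>" 1] by (simp add: add.commute add.left_commute)
  finally have "(2 + \<alpha>) / c0 * X s = ?a powr (2 + \<alpha>)" .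
  moreover have "(2 + \<alpha>) / c0 * X s \<le> (2 + \<alpha>) / c0 * T"
    using assms c0_pos \<alpha> by (intro mult_left_mono) auto
  ultimately have "?a powr (2 + \<alpha>) \<le> (2 + \<alpha>) / c0 * T" by simp
  then have "(?a powr (2 + \<alpha>)) powr (1 / (2 + \<alpha>)) \<le> ((2 + \<alpha>) / c0 * T) powr (1 / (2 + \<alpha>))"
    using \<alpha> by (intro powr_mono2) auto
  also have "\<dots> = ((2 + \<alpha>) / c0) powr (1 / (2 + \<alpha>)) * T powr (1 / (2 + \<alpha>))"
    by (rule powr_mult)
  finally show ?thesis using \<alpha> a by (simp add: powr_powr)
qed (auto intro!: mult_nonneg_nonneg)

text \<open>By \<open>mom_law_odd\<close> the odd moment has exponent m + \<kappa>/4 + 2/(2 +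
  \<alpha>). For nonnegative \<open>V\<close> it is bounded by the even moment times the size of x
  on the ball, which gives only the exponent m + \<kappa>/4 + 1/(2 + \<alpha>). Large
  \<open>T\<close> forces the coefficient to vanish.\<close>

lemma mom_odd_eq_0:
  assumes V: "solution V" and pos: "\<And>p. V p \<ge> 0" and m: "2 \<le> m" and T: "T > 0"
  shows "mom (\<lambda>p. V p * \<xi> (fst p)) m T y0 = 0"
proof -
  let ?F = "\<lambda>p. V p * \<xi> (fst p)"
  let ?\<theta> = "1 / (2 + \<alpha>)" and ?e = "m + \<kappa> / 4"
  let ?K = "((2 + \<alpha>) / c0) powr ?\<theta>"
  have cV: "continuous_on UNIV V" using V by (simp add: solution_def)
  have cF: "continuous_on UNIV ?F" using cV by (intro continuous_intros)
  have bound: "\<bar>mom ?F m T y0\<bar> \<le> ?K * T powr ?\<theta> * mom V m T y0" for T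
  proof -
    have *: "\<bar>?F p * tpow m (T - \<rho> y0 p)\<bar> \<le> (?K * T powr ?\<theta> * V p) * tpow m (T - \<rho> y0 p)" for p
    proof (cases "T - \<rho> y0 p \<le> 0")
      case False
      then have "X (fst p) \<le> T" unfolding \<rho>_def by (smt (verit) zero_le_power2)
      then have "V p * \<bar>\<xi> (fst p)\<bar> * tpow m (T - \<rho> y0 p) \<le> V p * (?K * T powr ?\<theta>) * tpow m (T - \<rho> y0 p)"
        by (intro mult_right_mono mult_left_mono abs_\<xi>_le pos tpow_nonneg)
      then show ?thesis using pos[of p] by (simp add: abs_mult mult_ac)
    qed (use m in \<open>simp add: tpow_eq_0\<close>)
    have "mom ?F m T y0 \<le> mom (\<lambda>p. (?K * T powr ?\<theta>) * V p) m T y0"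
      by (rule mom_mono[OF cF]) (use * cV m in \<open>auto simp: abs_le_iff intro!: continuous_intros\<close>)
    moreover have "mom (\<lambda>p. - 1 * ?F p) m T y0 \<le> mom (\<lambda>p. (?K * T powr ?\<theta>) * V p) m T y0"
      by (rule mom_mono) (use * cV m in \<open>auto simp: abs_le_iff intro!: continuous_intros\<close>)
    ultimately show ?thesis unfolding mom_cmult by simp
  qed
  have c0\<theta>: "c0 / 2 = 2 * ?\<theta>" using \<alpha> by (simp add: c0_def divide_simps)
  have "\<bar>mom ?F m 1 y0\<bar> * T powr ?\<theta> \<le> ?K * mom V m 1 y0" if T: "T > 0" for T
  proof -
    have "T powr (m + (\<kappa> + 2 * c0) / 4) = T powr ?e * T powr ?\<theta> * T powr ?\<theta>"
    proof -
      have "m + (\<kappa> + 2 * c0) / 4 = ?e + ?\<theta> + ?\<theta>" using c0\<theta> by (simp add: field_simps)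
      then show ?thesis by (simp only: powr_add)
    qed
    then have "\<bar>mom ?F m 1 y0\<bar> * (T powr ?e * T powr ?\<theta> * T powr ?\<theta>) \<le>
        ?K * T powr ?\<theta> * (mom V m 1 y0 * T powr ?e)"
      using bound[of T] mom_law_even[OF V m T, of y0] mom_law_odd[OF V m T, of y0] T by (simp add: abs_mult)
    then have "(T powr ?e * T powr ?\<theta>) * (\<bar>mom ?F m 1 y0\<bar> * T powr ?\<theta>) \<le>
        (T powr ?e * T powr ?\<theta>) * (?K * mom V m 1 y0)" by (simp add: mult_ac)
    then show ?thesis using T by (subst (asm) mult_le_cancel_left_pos) auto
  qed
  note b = this
  have "mom ?F m 1 y0 = 0"
  proof (rule ccontr)
    assume n: "mom ?F m 1 y0 \<noteq> 0"
    \<comment> \<open>At the level \<open>c powr (2 + \<alpha>)\<close> the growing factor equals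
      \<open>c\<close>; the summand 1 pushes the left side of \<open>b\<close> beyond its
      bound.\<close>
    define c where "c = ?K * mom V m 1 y0 / \<bar>mom ?F m 1 y0\<bar> + 1"
    have "mom (\<lambda>_. 0) m 1 y0 \<le> mom V m 1 y0"
      by (rule mom_mono) (use cV pos m in auto)
    then have c: "c > 0" unfolding c_def by (simp add: mom_def add_nonneg_pos)
    have "(c powr (2 + \<alpha>)) powr ?\<theta> = c" using c \<alpha> by (simp add: powr_powr)
    then have "\<bar>mom ?F m 1 y0\<bar> * c \<le> ?K * mom V m 1 y0" using b[of "c powr (2 + \<alpha>)"] c by simp
    moreover have "\<bar>mom ?F m 1 y0\<bar> * c = ?K * mom V m 1 y0 + \<bar>mom ?F m 1 y0\<bar>"
      using n by (simp add: c_def distrib_left)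
    ultimately show False using n by linarith
  qed
  then show ?thesis using mom_law_odd[OF V m T, of y0] by simp
qed

text \<open>The multipliers \<open>h\<close> for which \<open>f * h\<close> is orthogonal to every
  gauge weight. The closure properties below make this set a module over the continuous functions
  even in s; \<open>f\<close> vanishes once a suitable multiple of \<open>f\<close> itself belongs
  to it.\<close>

definition annih :: "(real \<times> real \<Rightarrow> real) \<Rightarrow> (real \<times> real \<Rightarrow> real) set" where
  "annih f = {h. continuous_on UNIV h \<and>
     (\<forall>m\<ge>2. \<forall>T y0. mom (\<lambda>p. f p * h p) m T y0 = 0)}"

lemma annih_add:
  assumes f: "continuous_on UNIV f" and "g \<in> annih f" "h \<in> annih f"
  shows "(\<lambda>p. g p + h p) \<in> annih f"
  using assms unfolding annih_def
  by (auto simp: distrib_left mom_add continuous_intros intro!: continuous_intros)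

lemma annih_cmult:
  assumes "h \<in> annih f"
  shows "(\<lambda>p. c * h p) \<in> annih f"
  using assms mom_cmult[of c "\<lambda>p. f p * h p"] unfolding annih_def
  by (auto simp: mult.left_commute intro!: continuous_intros)

text \<open>Moments of order m + 1 vanish for every centre, hence so does their derivative in the
  centre, which is a moment of order m with the factor 2 (y - y0).\<close>

lemma annih_snd:
  assumes f: "continuous_on UNIV f" and h: "h \<in> annih f"
  shows "(\<lambda>p. snd p * h p) \<in> annih f"
proof -
  have ch: "continuous_on UNIV h" using h by (simp add: annih_def)
  have c: "continuous_on UNIV (\<lambda>p. f p * h p)" using f ch by (intro continuous_intros)
  have "mom (\<lambda>p. f p * (snd p * h p)) m T y0 = 0" if m: "2 \<le> m" for m T y0
  proof -
    have "((\<lambda>y0. mom (\<lambda>p. f p * h p) (Suc m) T y0) has_real_derivative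
      real (Suc m) * mom (\<lambda>p. f p * h p * (2 * (snd p - y0))) m T y0) (at y0)"
      using m by (intro DERIV_mom_center c) auto
    moreover have "(\<lambda>y0. mom (\<lambda>p. f p * h p) (Suc m) T y0) = (\<lambda>_. 0)"
      using h m by (auto simp: annih_def)
    ultimately have "((\<lambda>_. 0) has_real_derivative
      real (Suc m) * mom (\<lambda>p. f p * h p * (2 * (snd p - y0))) m T y0) (at y0)" by simp
    then have "mom (\<lambda>p. f p * h p * (2 * (snd p - y0))) m T y0 = 0"
      using DERIV_unique[OF _ DERIV_const] by fastforce
    moreover have "mom (\<lambda>p. f p * (snd p * h p)) m T y0 =
        mom (\<lambda>p. 1 / 2 * (f p * h p * (2 * (snd p - y0))) + y0 * (f p * h p)) m T y0"
      by (simp add: algebra_simps)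
    moreover have "mom (\<lambda>p. 1 / 2 * (f p * h p * (2 * (snd p - y0))) + y0 * (f p * h p)) m T y0 =
        1 / 2 * mom (\<lambda>p. f p * h p * (2 * (snd p - y0))) m T y0 + y0 * mom (\<lambda>p. f p * h p) m T y0"
      using m unfolding mom_cmult[symmetric]
      by (intro mom_add continuous_intros c) auto
    ultimately show ?thesis using h m by (simp add: annih_def)
  qed
  then show ?thesis using ch by (auto simp: annih_def intro!: continuous_intros)
qed

text \<open>A weight of order m + 1 is T - \<rho> times the weight of order m, so the multiplier T -
  \<rho> is admissible. Removing (y - y0)^2 by two uses of \<open>annih_snd\<close> leaves
  \<open>X\<close>.\<close>

lemma annih_X:
  assumes f: "continuous_on UNIV f" and h: "h \<in> annih f"
  shows "(\<lambda>p. X (fst p) * h p) \<in> annih f"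
proof -
  have ch: "continuous_on UNIV h" using h by (simp add: annih_def)
  have c: "continuous_on UNIV (\<lambda>p. f p * h p)" using f ch by (intro continuous_intros)
  have "mom (\<lambda>p. f p * (X (fst p) * h p)) m T y0 = 0" if m: "2 \<le> m" for m T y0
  proof -
    have 1: "mom (\<lambda>p. f p * h p) (Suc m) T y0 = mom (\<lambda>p. (f p * h p) * (T - \<rho> y0 p)) m T y0"
      unfolding mom_def using m by (simp add: tpow_Suc mult.assoc)
    have 2: "(\<lambda>p. (snd p - y0)\<^sup>2 * h p) \<in> annih f"
    proof -
      have "(\<lambda>p. snd p * h p + (- y0) * h p) \<in> annih f"
        by (intro annih_add f annih_snd annih_cmult h)
      then have "(\<lambda>p. snd p * (snd p * h p + (- y0) * h p) + (- y0) * (snd p * h p + (- y0) * h p)) \<in> annih f"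
        by (intro annih_add f annih_snd annih_cmult h)
      then show ?thesis by (simp add: power2_eq_square algebra_simps)
    qed
    have "mom (\<lambda>p. f p * (X (fst p) * h p)) m T y0 =
        mom (\<lambda>p. (T * (f p * h p) + - 1 * ((f p * h p) * (T - \<rho> y0 p))) + - 1 * (f p * ((snd p - y0)\<^sup>2 * h p))) m T y0"
      by (simp add: \<rho>_def algebra_simps)
    also have "\<dots> = T * mom (\<lambda>p. f p * h p) m T y0 + - 1 * mom (\<lambda>p. (f p * h p) * (T - \<rho> y0 p)) m T y0 +
        - 1 * mom (\<lambda>p. f p * ((snd p - y0)\<^sup>2 * h p)) m T y0"
      using m unfolding mom_cmult[symmetric]
      by (subst mom_add; (subst mom_add)?; (intro continuous_intros c f ch)?; simp)
    also have "\<dots> = 0"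
      using h 2 m unfolding 1[symmetric] by (auto simp: annih_def)
    finally show ?thesis .
  qed
  then show ?thesis using ch by (auto simp: annih_def intro!: continuous_intros)
qed

text \<open>By Stone-Weierstrass, multipliers generated by \<open>y\<close> and \<open>X\<close> approximate every function that is even in \<open>s\<close>.\<close>

lemma annih_even:
  assumes f: "continuous_on UNIV f" and h: "h \<in> annih f"
    and \<phi>: "continuous_on UNIV \<phi>" and even: "\<And>s y. \<phi> (- s, y) = \<phi> (s, y)"
  shows "(\<lambda>p. \<phi> p * h p) \<in> annih f"
proof -
  have ch: "continuous_on UNIV h" using h by (simp add: annih_def)
  define R where "R = {g. continuous_on UNIV g \<and> (\<forall>s y. g (- s, y) = g (s, y :: real)) \<and>
      (\<forall>h\<in>annih f. (\<lambda>p. g p * h p) \<in> annih f)}"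
  have "mom (\<lambda>p. f p * (\<phi> p * h p)) m T y0 = 0" if m: "2 \<le> m" for m T y0
  proof -
    let ?M = "box_radius (max T \<bar>y0\<bar>)"
    \<comment> \<open>Only the half box s >= 0 is used, because \<open>X\<close> is injective there
      and so y and \<open>X\<close> separate points; evenness carries the approximation to the other
      half.\<close>
    interpret function_ring_on R "cbox (0, - ?M) (?M, ?M)"
    proof
      fix g1 g2 assume g: "g1 \<in> R" "g2 \<in> R"
      show "(\<lambda>p. g1 p + g2 p) \<in> R"
        using g by (auto simp: R_def distrib_right intro!: continuous_intros annih_add f)
      have "(\<lambda>p. g1 p * g2 p * h p) \<in> annih f" if "h \<in> annih f" for h
      proof -
        have "(\<lambda>p. g1 p * (g2 p * h p)) \<in> annih f" using g that by (auto simp: R_def)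
        then show ?thesis by (simp add: mult.assoc)
      qed
      then show "(\<lambda>p. g1 p * g2 p) \<in> R"
        using g by (auto simp: R_def intro!: continuous_intros)
    next
      show "g \<in> R \<Longrightarrow> continuous_on (cbox (0, - ?M) (?M, ?M)) g" for g
        by (auto simp: R_def intro: continuous_on_subset)
      show "(\<lambda>_. c) \<in> R" for c
        by (auto simp: R_def annih_cmult)
      have R1: "snd \<in> R"
        by (auto simp: R_def intro!: continuous_intros annih_snd f)
      have R2: "(\<lambda>p. X (fst p)) \<in> R"
        by (auto simp: R_def intro!: continuous_intros annih_X f)
      fix p q :: "real \<times> real"
      assume pq: "p \<in> cbox (0, - ?M) (?M, ?M)" "q \<in> cbox (0, - ?M) (?M, ?M)" "p \<noteq> q"
      show "\<exists>g\<in>R. g p \<noteq> g q"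
      proof (cases "snd p = snd q")
        case True
        then have "fst p \<noteq> fst q" using pq(3) by (simp add: prod_eq_iff)
        moreover have "fst p \<ge> 0" "fst q \<ge> 0" using pq by (auto simp: cbox_Pair_eq)
        ultimately have "X (fst p) \<noteq> X (fst q)"
          using X_strict_mono[of "fst p" "fst q"] X_strict_mono[of "fst q" "fst p"]
          by (cases "fst p < fst q") auto
        then show ?thesis by (intro bexI[OF _ R2])
      qed (rule bexI[OF _ R1])
    qed auto
    let ?C = "mom (\<lambda>p. \<bar>f p * h p\<bar>) m T y0"
    have le: "\<bar>mom (\<lambda>p. f p * (\<phi> p * h p)) m T y0\<bar> \<le> e * ?C" if e: "e > 0" for e
    proof -
      obtain g where g: "g \<in> R" "\<And>p. p \<in> cbox (0, - ?M) (?M, ?M) \<Longrightarrow> \<bar>\<phi> p - g p\<bar> < e"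
        using Stone_Weierstrass_basic[OF continuous_on_subset[OF \<phi> subset_UNIV] e] by blast
      have cg: "continuous_on UNIV g" using g(1) by (simp add: R_def)
      have ge: "\<bar>\<phi> p - g p\<bar> \<le> e" if "p \<in> support_box (max T \<bar>y0\<bar>)" for p
      proof -
        obtain s y where p: "p = (s, y)" by (cases p)
        have "(\<bar>s\<bar>, y) \<in> cbox (0, - ?M) (?M, ?M)" using that p by (auto simp: abs_le_iff)
        from g(2)[OF this] have "\<bar>\<phi> (\<bar>s\<bar>, y) - g (\<bar>s\<bar>, y)\<bar> \<le> e" by simp
        moreover have "\<phi> (\<bar>s\<bar>, y) = \<phi> (s, y)" "g (\<bar>s\<bar>, y) = g (s, y)"
          using even g(1) by (auto simp: abs_if R_def)
        ultimately show ?thesis by (simp add: p)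
      qed
      let ?D = "\<lambda>p. f p * (\<phi> p * h p) - f p * (g p * h p)"
      have cD: "continuous_on UNIV ?D" using f \<phi> ch cg by (intro continuous_intros)
      have *: "\<bar>?D p * tpow m (T - \<rho> y0 p)\<bar> \<le> (e * \<bar>f p * h p\<bar>) * tpow m (T - \<rho> y0 p)" for p
      proof (cases "p \<in> support_box (max T \<bar>y0\<bar>)")
        case True
        have "\<bar>\<phi> p - g p\<bar> * \<bar>f p * h p\<bar> * tpow m (T - \<rho> y0 p) \<le> e * \<bar>f p * h p\<bar> * tpow m (T - \<rho> y0 p)"
          by (intro mult_right_mono ge True) auto
        moreover have "?D p = (\<phi> p - g p) * (f p * h p)" by (simp add: algebra_simps)
        ultimately show ?thesis by (simp add: abs_mult)
      next
        case False
        then show ?thesis using tpow_outside[of m y0 "max T \<bar>y0\<bar>" T p] m by simp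
      qed
      have "mom ?D m T y0 \<le> mom (\<lambda>p. e * \<bar>f p * h p\<bar>) m T y0"
        by (rule mom_mono[OF cD]) (use * f ch m in \<open>auto simp: abs_le_iff intro!: continuous_intros\<close>)
      moreover have "mom (\<lambda>p. - 1 * ?D p) m T y0 \<le> mom (\<lambda>p. e * \<bar>f p * h p\<bar>) m T y0"
      proof (rule mom_mono)
        show "- 1 * ?D p * tpow m (T - \<rho> y0 p) \<le> e * \<bar>f p * h p\<bar> * tpow m (T - \<rho> y0 p)" for p
          using abs_le_D2[OF *[of p]] by (simp only: mult_minus1 mult_minus_left)
      qed (use cg \<phi> f ch m in \<open>auto intro!: continuous_intros\<close>)
      ultimately have "\<bar>mom ?D m T y0\<bar> \<le> e * ?C" unfolding mom_cmult by simp
      moreover have "mom ?D m T y0 = mom (\<lambda>p. f p * (\<phi> p * h p)) m T y0 - mom (\<lambda>p. f p * (g p * h p)) m T y0"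
        using m by (intro mom_diff continuous_intros f \<phi> ch cg) auto
      moreover have "mom (\<lambda>p. f p * (g p * h p)) m T y0 = 0"
        using g(1) h m by (auto simp: R_def annih_def)
      ultimately show ?thesis by simp
    qed
    show ?thesis
    proof (rule ccontr)
      assume n: "mom (\<lambda>p. f p * (\<phi> p * h p)) m T y0 \<noteq> 0" (is "?J \<noteq> 0")
      have "?C > 0" using le[of 1] n by simp
      then have "\<bar>?J\<bar> / (2 * ?C) * ?C = \<bar>?J\<bar> / 2" by simp
      then show False using le[of "\<bar>?J\<bar> / (2 * ?C)"] n \<open>?C > 0\<close> by simp
    qed
  qed
  then show ?thesis using ch \<phi> by (auto simp: annih_def intro!: continuous_intros)
qed

text \<open>Split \<open>f\<close> into its even and odd parts in s. Then x^2 f is x^2 times the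
  even part, an even multiplier of 1, plus x times the odd part, an even multiplier of x; the factor
  x^2 avoids dividing the odd part by x. Testing \<open>f\<close> against x^2 f gives a nonnegative
  integrand with zero integral, hence \<open>f = 0\<close> off the axis, and on it by
  continuity.\<close>

lemma annih_imp_zero:
  assumes f: "continuous_on UNIV f" and 1: "(\<lambda>_. 1) \<in> annih f" and \<xi>: "(\<lambda>p. \<xi> (fst p)) \<in> annih f"
  shows "f p = 0"
proof -
  let ?r = "\<lambda>p :: real \<times> real. (- fst p, snd p)"
  have cr: "continuous_on UNIV (\<lambda>p. f (?r p))"
    by (rule continuous_on_compose2[OF f]) (auto intro!: continuous_intros)
  let ?e = "\<lambda>p. (\<xi> (fst p))\<^sup>2 * ((f p + f (?r p)) / 2)"
  let ?o = "\<lambda>p. \<xi> (fst p) * ((f p - f (?r p)) / 2)"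
  have "(\<lambda>p. ?e p * 1) \<in> annih f"
    by (rule annih_even[OF f 1]) (auto simp: \<xi>_minus intro!: continuous_intros f cr)
  moreover have "(\<lambda>p. ?o p * \<xi> (fst p)) \<in> annih f"
    by (rule annih_even[OF f \<xi>]) (auto simp: \<xi>_minus algebra_simps diff_divide_distrib intro!: continuous_intros f cr)
  ultimately have "(\<lambda>p. ?e p * 1 + ?o p * \<xi> (fst p)) \<in> annih f"
    by (rule annih_add[OF f])
  moreover have "(\<lambda>p. ?e p * 1 + ?o p * \<xi> (fst p)) = (\<lambda>p. (\<xi> (fst p))\<^sup>2 * f p)"
    by (auto simp: power2_eq_square field_simps)
  ultimately have h: "(\<lambda>p. (\<xi> (fst p))\<^sup>2 * f p) \<in> annih f" by simp
  have z: "f p = 0" if "fst p \<noteq> 0" for p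
  proof -
    let ?F = "\<lambda>p. f p * ((\<xi> (fst p))\<^sup>2 * f p)"
    let ?T = "\<rho> 0 p + 1"
    have "mom ?F 2 ?T 0 = 0" using h by (simp add: annih_def)
    moreover have "?F p \<ge> 0" for p by (simp add: mult.left_commute[of "f p"])
    ultimately have "?F p * tpow 2 (?T - \<rho> 0 p) = 0"
      by (intro mom_eq_0_imp) (auto intro!: continuous_intros f)
    then show ?thesis using that by (simp add: tpow_def)
  qed
  show ?thesis
  proof (cases "fst p = 0")
    case True
    let ?g = "\<lambda>s. f (s, snd p)"
    have "isCont ?g 0"
      using continuous_on_compose2[OF f, of UNIV "\<lambda>s. (s, snd p)"]
      by (auto simp: continuous_on_eq_continuous_at intro!: continuous_intros)
    then have "?g \<midarrow>0\<rightarrow> ?g 0" by (simp add: isCont_def)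
    moreover have "?g \<midarrow>0\<rightarrow> 0"
      by (rule tendsto_eventually) (auto simp: eventually_at_filter z)
    ultimately have "?g 0 = 0" by (rule LIM_unique)
    then show ?thesis using True by (cases p) auto
  qed (rule z)
qed

text \<open>\<open>A\<close> is chosen so that \<open>V - A\<close> has zero moment of order 2 on
  the unit ball about 0. Independence of the centre and the power law extend this to all balls, and
  \<open>mom_identity_even\<close> to all higher orders. As \<open>V - A\<close> need not be
  positive, facts that rest on positivity are applied to \<open>V\<close> and to the constant 1
  separately.\<close>

theorem positive_solution_const:
  assumes V: "solution V" and pos: "\<And>p. V p \<ge> 0"
  shows "V p = V q"
proof -
  have cV: "continuous_on UNIV V" using V by (simp add: solution_def)
  let ?I = "\<lambda>_ :: real \<times> real. 1 :: real"
  have cI: "continuous_on UNIV ?I" by (rule continuous_on_const)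
  have I0: "mom ?I 2 1 0 \<noteq> 0"
  proof
    assume "mom ?I 2 1 0 = 0"
    then have "?I (0, 0) * tpow 2 (1 - \<rho> 0 (0, 0)) = 0"
      by (intro mom_eq_0_imp cI) auto
    then show False by (simp add: tpow_def \<rho>_def)
  qed
  define A where "A = mom V 2 1 0 / mom ?I 2 1 0"
  let ?f = "\<lambda>p. V p - A"
  have sf: "solution ?f" by (rule solution_diff_const[OF V])
  have cf: "continuous_on UNIV ?f" using cV by (intro continuous_intros)
  have split: "mom (\<lambda>p. (V p - A) * g p) m T y0 = mom (\<lambda>p. V p * g p) m T y0 - A * mom (\<lambda>p. 1 * g p) m T y0"
    if g: "continuous_on UNIV g" and m: "m \<noteq> 0" for g m T y0
    unfolding mom_cmult[symmetric] left_diff_distrib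
    using mom_diff[of "\<lambda>p. V p * g p" "\<lambda>p. A * g p" m T y0] cV g m by (simp add: continuous_intros)
  have "mom ?f 2 1 y0 = 0" for y0
  proof -
    have "mom V 2 1 y0 = mom V 2 1 0" "mom ?I 2 1 y0 = mom ?I 2 1 0"
      using mom_center_le[OF V pos, of 2] mom_center_le[OF solution_const[of 1], of 2]
      by (auto intro: antisym)
    then show ?thesis using split[OF cI, of 2 1 y0] I0 by (simp add: A_def)
  qed
  then have z2: "mom ?f 2 T y0 = 0" if "T > 0" for T y0
    using mom_law_even[OF sf _ that, of 2 y0] by simp
  have zpos: "mom ?f m T y0 = 0" if "2 \<le> m" "T > 0" for m T y0
    using \<open>2 \<le> m\<close>
  proof (induction m rule: dec_induct)
    case base
    show ?case by (rule z2[OF that(2)])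
  next
    case (step m)
    have "4 * real (Suc m) + \<kappa> > 0" unfolding \<kappa>_def using c0_pos \<alpha> by (intro add_nonneg_pos) (auto intro: add_pos_pos)
    then show ?case
      using mom_identity_even[OF sf, of "Suc m" T y0] step by auto
  qed
  have zneg: "mom F m T y0 = 0" if "m \<noteq> 0" "T \<le> 0" for F m T y0
  proof -
    have "T - \<rho> y0 p \<le> 0" for p
      unfolding \<rho>_def using that(2) X_nonneg[of "fst p"] by (smt (verit) zero_le_power2)
    then show ?thesis unfolding mom_def using that(1) by (simp add: tpow_eq_0)
  qed
  have a1: "?I \<in> annih ?f"
    unfolding annih_def
  proof (intro CollectI conjI allI impI)
    fix m :: nat and T y0 assume "2 \<le> m"
    then show "mom (\<lambda>p. (V p - A) * 1) m T y0 = 0"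
      using zpos[of m T y0] zneg[of m T] by (cases "T > 0") auto
  qed (rule cI)
  have a2: "(\<lambda>p. \<xi> (fst p)) \<in> annih ?f"
    unfolding annih_def
  proof (intro CollectI conjI allI impI)
    show c\<xi>: "continuous_on UNIV (\<lambda>p :: real \<times> real. \<xi> (fst p))" by (intro continuous_intros)
    fix m :: nat and T y0 assume m: "2 \<le> m"
    show "mom (\<lambda>p. (V p - A) * \<xi> (fst p)) m T y0 = 0"
    proof (cases "T > 0")
      case True
      then show ?thesis
        using split[OF c\<xi>, of m T y0] mom_odd_eq_0[OF V pos m True] m
          mom_odd_eq_0[OF solution_const[of 1] _ m True, of y0] by simp
    qed (use zneg[of m T] m in auto)
  qed
  show ?thesis using annih_imp_zero[OF cf a1 a2, of p] annih_imp_zero[OF cf a1 a2, of q] by simp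
qed

end

subsection \<open>The Monge-Ampere equation in product coordinates\<close>

text \<open>Identifies the plane with a product, where iterated integration is available for
  Lebesgue measure.\<close>

definition vec2 :: "real \<times> real \<Rightarrow> real^2" where
  "vec2 p = (\<chi> i. if i = 1 then fst p else snd p)"

lemma vec2_nth [simp]: "vec2 p $ 1 = fst p" "vec2 p $ 2 = snd p"
  by (simp_all add: vec2_def)

lemma vec2_eta [simp]: "vec2 (x $ 1, x $ 2) = x"
  by (simp add: vec_eq_iff forall_2)

lemma inner_vec2: "vec2 p \<bullet> x = fst p * x $ 1 + snd p * x $ 2"
  by (simp add: inner_vec_def sum_2)

lemma continuous_on_vec2 [continuous_intros]:
  "continuous_on S f \<Longrightarrow> continuous_on S (\<lambda>x. vec2 (f x))"
  unfolding vec2_def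
proof (intro continuous_on_vec_lambda)
  show "continuous_on S f \<Longrightarrow> continuous_on S (\<lambda>x. if i = 1 then fst (f x) else snd (f x))" for i :: 2
    by (cases "i = 1") (auto intro!: continuous_intros)
qed

lemma vec2_measurable [measurable]: "vec2 \<in> borel_measurable borel"
  by (intro borel_measurable_continuous_onI continuous_intros)

lemma vec2_vimage_box: "vec2 -` box l u = box (l $ 1, l $ 2) (u $ 1, u $ 2)"
  by (auto simp: mem_box_cart forall_2 mem_box Basis_prod_def)

lemma lborel_vec2: "(lborel :: (real^2) measure) = distr lborel borel vec2"
proof (rule lborel_eqI)
  fix l u :: "real^2"
  assume le: "\<And>b. b \<in> Basis \<Longrightarrow> l \<bullet> b \<le> u \<bullet> b"
  have le: "l $ 1 \<le> u $ 1" "l $ 2 \<le> u $ 2"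
    using le[of "axis 1 1"] le[of "axis 2 1"] by (auto simp: inner_axis axis_in_Basis_iff)
  have "emeasure (distr lborel borel vec2) (box l u) = emeasure lborel (box (l $ 1, l $ 2) (u $ 1, u $ 2))"
    by (subst emeasure_distr) (auto simp: vec2_vimage_box)
  also have "\<dots> = ennreal ((u $ 1 - l $ 1) * (u $ 2 - l $ 2))"
    using le by (subst emeasure_lborel_box_eq) (auto simp: Basis_prod_def prod.union_disjoint ennreal_mult mult.commute)
  also have "(u $ 1 - l $ 1) * (u $ 2 - l $ 2) = (\<Prod>b\<in>Basis. (u - l) \<bullet> b)"
    by (simp add: Basis_vec_def UNIV_2 axis_eq_axis prod.insert_if inner_axis)
  finally show "emeasure (distr lborel borel vec2) (box l u) = ennreal (\<Prod>b\<in>Basis. (u - l) \<bullet> b)" .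
qed simp

lemma vec2_image_borel:
  assumes "B \<in> sets borel" shows "vec2 ` B \<in> sets borel"
proof -
  have "vec2 ` B = (\<lambda>x. (x $ 1, x $ 2)) -` B \<inter> space borel"
    by (auto simp: image_iff) (metis vec2_eta)
  also have "\<dots> \<in> sets borel"
    by (rule measurable_sets[OF _ assms]) (auto intro!: borel_measurable_continuous_onI continuous_intros)
  finally show ?thesis .
qed

lemma emeasure_vec2_image:
  assumes "B \<in> sets borel" shows "emeasure lborel (vec2 ` B) = emeasure lborel B"
proof -
  have "vec2 -` (vec2 ` B) = B"
    by (auto simp: vec_eq_iff forall_2 prod_eq_iff)
  then show ?thesis
    by (subst lborel_vec2, subst emeasure_distr) (auto simp: vec2_image_borel assms)
qed

definition subgrad :: "(real \<Rightarrow> real \<Rightarrow> real) \<Rightarrow> real \<Rightarrow> real \<Rightarrow> real \<times> real \<Rightarrow> bool" where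
  "subgrad U x t p \<longleftrightarrow> (\<forall>x' t'. U x t + fst p * (x' - x) + snd p * (t' - t) \<le> U x' t')"

lemma subdifferential_vec2:
  "vec2 p \<in> subdifferential UNIV u (vec2 (x, t)) \<longleftrightarrow> subgrad (\<lambda>x t. u (vec2 (x, t))) x t p"
proof -
  have "(\<forall>y. u (vec2 (x, t)) + vec2 p \<bullet> (y - vec2 (x, t)) \<le> u y) \<longleftrightarrow>
      (\<forall>x' t'. u (vec2 (x, t)) + vec2 p \<bullet> (vec2 (x', t') - vec2 (x, t)) \<le> u (vec2 (x', t')))"
    by (metis vec2_eta)
  then show ?thesis
    by (simp add: subdifferential_def subgrad_def inner_vec2 add.assoc)
qed

section \<open>Weighted mass of plane sets\<close>

context weight
begin

definition mass :: "(real \<times> real) set \<Rightarrow> ennreal" where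
  "mass A = (\<integral>\<^sup>+p. ennreal (\<bar>fst p\<bar> powr \<alpha>) * indicator A p \<partial>lborel)"

lemma weight_measurable [measurable]:
  "(\<lambda>p :: real \<times> real. ennreal (\<bar>fst p\<bar> powr \<alpha>)) \<in> borel_measurable borel"
proof -
  have [measurable]: "(fst :: real \<times> real \<Rightarrow> real) \<in> borel_measurable borel"
    by (intro borel_measurable_continuous_onI continuous_intros)
  show ?thesis by measurable
qed

lemma mass_vec2:
  assumes [measurable]: "A \<in> sets borel"
  shows "(\<integral>\<^sup>+x\<in>vec2 ` A. ennreal (\<bar>x $ 1\<bar> powr \<alpha>) \<partial>lborel) = mass A"
proof -
  have [measurable]: "vec2 ` A \<in> sets borel" by (rule vec2_image_borel[OF assms])
  have [measurable]: "(\<lambda>x::real^2. x $ 1) \<in> borel_measurable borel"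
    by (intro borel_measurable_continuous_onI continuous_intros)
  have i: "indicator (vec2 ` A) (vec2 p) = (indicator A p :: ennreal)" for p
    by (auto simp: indicator_def vec_eq_iff forall_2 image_iff prod_eq_iff)
  show ?thesis
    unfolding mass_def by (subst lborel_vec2, subst nn_integral_distr) (auto simp: i)
qed

text \<open>On a strip away from the axis the weight is comparable to 1; |\<alpha>| treats both
  signs of the exponent at once.\<close>

lemma weight_bounds:
  assumes "1 \<le> x" "x \<le> 2"
  shows "2 powr (- \<bar>\<alpha>\<bar>) \<le> \<bar>x\<bar> powr \<alpha>" "\<bar>x\<bar> powr \<alpha> \<le> 2 powr \<bar>\<alpha>\<bar>"
proof -
  have "\<bar>x\<bar> powr \<alpha> \<le> x powr \<bar>\<alpha>\<bar>" using assms by (auto intro: powr_mono)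
  also have "\<dots> \<le> 2 powr \<bar>\<alpha>\<bar>" using assms by (intro powr_mono2) auto
  finally show "\<bar>x\<bar> powr \<alpha> \<le> 2 powr \<bar>\<alpha>\<bar>" .
  have "2 powr (- \<bar>\<alpha>\<bar>) \<le> x powr (- \<bar>\<alpha>\<bar>)" using assms by (intro powr_mono2') auto
  also have "\<dots> \<le> \<bar>x\<bar> powr \<alpha>" using assms by (auto intro: powr_mono)
  finally show "2 powr (- \<bar>\<alpha>\<bar>) \<le> \<bar>x\<bar> powr \<alpha>" .
qed

lemma mass_bounds:
  assumes A [measurable]: "A \<in> sets borel" and "\<And>p. p \<in> A \<Longrightarrow> 1 \<le> fst p \<and> fst p \<le> 2"
  shows "ennreal (2 powr (- \<bar>\<alpha>\<bar>)) * emeasure lborel A \<le> mass A"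
    and "mass A \<le> ennreal (2 powr \<bar>\<alpha>\<bar>) * emeasure lborel A"
proof -
  have w: "2 powr (- \<bar>\<alpha>\<bar>) \<le> \<bar>fst p\<bar> powr \<alpha>" "\<bar>fst p\<bar> powr \<alpha> \<le> 2 powr \<bar>\<alpha>\<bar>" if "p \<in> A" for p
    using weight_bounds[of "fst p"] assms(2)[OF that] by blast+
  have "ennreal (2 powr (- \<bar>\<alpha>\<bar>)) * emeasure lborel A = (\<integral>\<^sup>+p. ennreal (2 powr (- \<bar>\<alpha>\<bar>)) * indicator A p \<partial>lborel)"
    by (subst nn_integral_cmult_indicator) auto
  also have "\<dots> \<le> mass A"
    unfolding mass_def by (intro nn_integral_mono) (auto simp: indicator_def intro!: ennreal_leI dest: w)
  finally show "ennreal (2 powr (- \<bar>\<alpha>\<bar>)) * emeasure lborel A \<le> mass A" .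
  have "mass A \<le> (\<integral>\<^sup>+p. ennreal (2 powr \<bar>\<alpha>\<bar>) * indicator A p \<partial>lborel)"
    unfolding mass_def by (intro nn_integral_mono) (auto simp: indicator_def intro!: ennreal_leI dest: w)
  also have "\<dots> = ennreal (2 powr \<bar>\<alpha>\<bar>) * emeasure lborel A"
    by (subst nn_integral_cmult_indicator) auto
  finally show "mass A \<le> ennreal (2 powr \<bar>\<alpha>\<bar>) * emeasure lborel A" .
qed

lemma mass_Un_le:
  assumes [measurable]: "A \<in> sets borel" "B \<in> sets borel"
  shows "mass (A \<union> B) \<le> mass A + mass B"
proof -
  have "mass (A \<union> B) \<le> (\<integral>\<^sup>+p. ennreal (\<bar>fst p\<bar> powr \<alpha>) * indicator A p + ennreal (\<bar>fst p\<bar> powr \<alpha>) * indicator B p \<partial>lborel)"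
    unfolding mass_def by (intro nn_integral_mono) (auto simp: indicator_def)
  also have "\<dots> = mass A + mass B"
    unfolding mass_def by (intro nn_integral_add) auto
  finally show ?thesis .
qed

lemma mass_mono: "A \<subseteq> B \<Longrightarrow> mass A \<le> mass B"
  unfolding mass_def by (intro nn_integral_mono) (auto simp: indicator_def)

end

lemma emeasure_lborel_rectangle:
  fixes a b c d :: real
  assumes "a \<le> b" "c \<le> d"
  shows "emeasure lborel (cbox (a, c) (b, d)) = ennreal ((b - a) * (d - c))"
  using assms by (subst emeasure_lborel_cbox_eq) (auto simp: Basis_prod_def prod.union_disjoint ennreal_mult mult.commute)

text \<open>The equation is kept as two inequalities against Borel sets that enclose, or are
  contained in, the gradient image. Measurability of the image itself then never enters the later
  arguments.\<close>

locale monge_ampere = weight +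
  fixes U :: "real \<Rightarrow> real \<Rightarrow> real"
  assumes convex: "convex_on UNIV (\<lambda>p. U (fst p) (snd p))"
    and mass_le: "\<And>A B. A \<in> sets borel \<Longrightarrow> B \<in> sets borel \<Longrightarrow>
      (\<And>x t p. (x, t) \<in> A \<Longrightarrow> subgrad U x t p \<Longrightarrow> p \<in> B) \<Longrightarrow> mass A \<le> emeasure lborel B"
    and mass_ge: "\<And>A B. A \<in> sets borel \<Longrightarrow> B \<in> sets borel \<Longrightarrow>
      (\<And>p. p \<in> B \<Longrightarrow> \<exists>x t. (x, t) \<in> A \<and> subgrad U x t p) \<Longrightarrow> emeasure lborel B \<le> mass A"

lemma (in weight) monge_ampere_vec2:
  assumes cu: "convex_on UNIV u" and sol: "generalized_MA_solution UNIV (\<lambda>x. \<bar>x $ 1\<bar> powr \<alpha>) u"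
  shows "monge_ampere \<alpha> (\<lambda>x t. u (vec2 (x, t)))"
proof
  let ?D = "\<lambda>A. \<Union>x\<in>vec2 ` A. subdifferential UNIV u x"
  have D: "emeasure lebesgue (?D A) = mass A" if "A \<in> sets borel" for A
    using sol vec2_image_borel[OF that] mass_vec2[OF that]
    by (auto simp: generalized_MA_solution_def monge_ampere_measure_def)
  show "convex_on UNIV (\<lambda>p. u (vec2 (fst p, snd p)))"
  proof (rule convex_onI)
    fix t :: real and p q :: "real \<times> real" assume t: "0 < t" "t < 1"
    have "vec2 ((1 - t) *\<^sub>R p + t *\<^sub>R q) = (1 - t) *\<^sub>R vec2 p + t *\<^sub>R vec2 q"
      by (simp add: vec_eq_iff forall_2)
    then show "u (vec2 (fst ((1 - t) *\<^sub>R p + t *\<^sub>R q), snd ((1 - t) *\<^sub>R p + t *\<^sub>R q)))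
        \<le> (1 - t) * u (vec2 (fst p, snd p)) + t * u (vec2 (fst q, snd q))"
      using convex_onD[OF cu, of t "vec2 p" "vec2 q"] t by (simp only: prod.collapse) simp
  qed simp
  fix A B :: "(real \<times> real) set" assume A: "A \<in> sets borel" and B: "B \<in> sets borel"
  {
    assume sub: "\<And>x t p. (x, t) \<in> A \<Longrightarrow> subgrad (\<lambda>x t. u (vec2 (x, t))) x t p \<Longrightarrow> p \<in> B"
    have "?D A \<subseteq> vec2 ` B"
    proof clarify
      fix x t q assume "(x, t) \<in> A" "q \<in> subdifferential UNIV u (vec2 (x, t))"
      then have "(q $ 1, q $ 2) \<in> B"
        using sub[of x t "(q $ 1, q $ 2)"] subdifferential_vec2[of "(q $ 1, q $ 2)"] by simp
      then show "q \<in> vec2 ` B" by (metis image_eqI vec2_eta)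
    qed
    then have "emeasure lebesgue (?D A) \<le> emeasure lebesgue (vec2 ` B)"
      using vec2_image_borel[OF B] by (intro emeasure_mono) auto
    then show "mass A \<le> emeasure lborel B"
      using D[OF A] emeasure_vec2_image[OF B] vec2_image_borel[OF B] by simp
  }
  {
    assume sub: "\<And>p. p \<in> B \<Longrightarrow> \<exists>x t. (x, t) \<in> A \<and> subgrad (\<lambda>x t. u (vec2 (x, t))) x t p"
    \<comment> \<open>\<open>?D A\<close> might be nonmeasurable and then have emeasure 0 by convention; adding a small box \<open>?F\<close> of positive
      mass makes the emeasure positive and hence the set measurable.\<close>
    have le: "emeasure lborel B \<le> mass A + ennreal (2 powr \<bar>\<alpha>\<bar> * \<epsilon>)" if \<epsilon>: "0 < \<epsilon>" "\<epsilon> < 1" for \<epsilon>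
    proof -
      let ?F = "cbox (1, 0) (1 + \<epsilon>, 1) :: (real \<times> real) set"
      have F: "1 \<le> fst p \<and> fst p \<le> 2" if "p \<in> ?F" for p
        using that \<epsilon> by (cases p) auto
      have eF: "emeasure lborel ?F = ennreal \<epsilon>"
        using \<epsilon> by (simp add: emeasure_lborel_rectangle)
      have "0 < ennreal (2 powr (- \<bar>\<alpha>\<bar>)) * emeasure lborel ?F"
        using \<epsilon> by (simp add: eF ennreal_zero_less_mult_iff)
      also have "\<dots> \<le> mass ?F" by (rule mass_bounds) (use F in auto)
      also have "\<dots> \<le> mass (A \<union> ?F)" by (rule mass_mono) auto
      finally have pos: "0 < mass (A \<union> ?F)" .
      have AF: "A \<union> ?F \<in> sets borel" using A by auto
      have m: "?D (A \<union> ?F) \<in> sets lebesgue"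
        using emeasure_notin_sets[of "?D (A \<union> ?F)" lebesgue] D[OF AF] pos by force
      have "vec2 ` B \<subseteq> ?D (A \<union> ?F)"
        using sub subdifferential_vec2[of _ u] by fast
      then have "emeasure lebesgue (vec2 ` B) \<le> emeasure lebesgue (?D (A \<union> ?F))"
        using m by (intro emeasure_mono)
      then have "emeasure lborel B \<le> mass (A \<union> ?F)"
        using D[OF AF] emeasure_vec2_image[OF B] vec2_image_borel[OF B] by simp
      also have "\<dots> \<le> mass A + mass ?F" using A by (intro mass_Un_le) auto
      also have "mass ?F \<le> ennreal (2 powr \<bar>\<alpha>\<bar>) * emeasure lborel ?F" by (rule mass_bounds) (use F in auto)
      finally show ?thesis using \<epsilon> by (simp add: eF ennreal_mult add_left_mono)
    qed
    show "emeasure lborel B \<le> mass A"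
    proof (rule ennreal_le_epsilon)
      fix e :: real assume e: "0 < e"
      define \<epsilon> where "\<epsilon> = min (1 / 2) (e / 2 powr \<bar>\<alpha>\<bar>)"
      have "0 < \<epsilon>" "\<epsilon> < 1" "2 powr \<bar>\<alpha>\<bar> * \<epsilon> \<le> e"
        using e by (auto simp: \<epsilon>_def min_def field_simps)
      then show "emeasure lborel B \<le> mass A + ennreal e"
        by (meson add_left_mono ennreal_leI le order_trans)
    qed
  }
qed

context monge_ampere
begin

subsection \<open>Superlinear growth\<close>

lemma U_convex:
  assumes "0 \<le> l" "l \<le> 1"
  shows "U ((1 - l) * x + l * x') ((1 - l) * t + l * t') \<le> (1 - l) * U x t + l * U x' t'"
  using convex_onD[OF convex, of l "(x, t)" "(x', t')"] assms by simp

lemma continuous_on_U: "continuous_on UNIV (\<lambda>p. U (fst p) (snd p))"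
  by (rule convex_on_continuous[OF open_UNIV convex])

lemma continuous_on_U' [continuous_intros]:
  "continuous_on S f \<Longrightarrow> continuous_on S g \<Longrightarrow> continuous_on S (\<lambda>x. U (f x) (g x))"
  using continuous_on_compose2[OF continuous_on_U, of S "\<lambda>x. (f x, g x)"]
  by (auto intro: continuous_intros)

lemma U_half: "U x t \<le> (U x1 t1 + U x2 t2) / 2" if "x = (x1 + x2) / 2" "t = (t1 + t2) / 2"
proof -
  have "(1 - 1/2) * x1 + 1/2 * x2 = x" "(1 - 1/2) * t1 + 1/2 * t2 = t"
    using that by (simp_all add: field_simps)
  then show ?thesis using U_convex[of "1/2" x1 x2 t1 t2] by (simp add: field_simps)
qed

text \<open>Difference quotients of a convex function taken from a fixed base point do not decrease
  along the ray.\<close>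

lemma ray_quotient_mono:
  assumes "0 < t1" "t1 \<le> t" and "U x (s * t1) \<ge> U x 0 + m * t1"
  shows "U x (s * t) \<ge> U x 0 + m * t"
proof -
  have "U x (s * t1) \<le> (1 - t1 / t) * U x 0 + t1 / t * U x (s * t)"
    using U_convex[of "t1 / t" x x 0 "s * t"] assms by (simp add: algebra_simps)
  then have "t1 / t * U x (s * t) \<ge> t1 / t * (U x 0 + m * t)"
    using assms by (simp add: algebra_simps)
  moreover have "t1 / t > 0" using assms by simp
  ultimately show ?thesis by (metis mult_le_cancel_left_pos)
qed

text \<open>An affine bound with any constant \<open>C\<close> already holds with the value at the
  origin of the ray: an excess \<delta> at \<open>t\<close> grows at least linearly, and at the
  chosen \<open>T\<close> it has reached \<delta> + |C - U x 0| + 1.\<close>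

lemma ray_bound:
  assumes "\<And>t. t \<ge> 0 \<Longrightarrow> U x (s * t) \<le> C + m * t" and "t \<ge> 0"
  shows "U x (s * t) \<le> U x 0 + m * t"
proof (rule ccontr)
  assume n: "\<not> U x (s * t) \<le> U x 0 + m * t"
  then have t: "t > 0" using assms(2) by (cases "t = 0") auto
  define \<delta> where "\<delta> = U x (s * t) - U x 0 - m * t"
  have \<delta>: "\<delta> > 0" using n by (simp add: \<delta>_def)
  define T where "T = t + t * (\<bar>C - U x 0\<bar> + 1) / \<delta>"
  have T: "T \<ge> t" using t \<delta> by (simp add: T_def)
  have "U x (s * t) \<ge> U x 0 + (m + \<delta> / t) * t" using t by (simp add: \<delta>_def field_simps)
  from ray_quotient_mono[OF t T this] have "U x 0 + (m + \<delta> / t) * T \<le> C + m * T"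
    using assms(1)[of T] t T by linarith
  then have "\<delta> / t * T \<le> C - U x 0" by (simp add: algebra_simps)
  moreover have "\<delta> / t * T = \<delta> + (\<bar>C - U x 0\<bar> + 1)" using t \<delta> by (simp add: T_def field_simps)
  ultimately show False using \<delta> by linarith
qed

text \<open>The asymptotic slope does not depend on \<open>x\<close>: the point at \<open>x'\<close>
  is the midpoint of one on the ray over \<open>x\<close>, twice as far out, and the base point over
  the reflection \<open>2 * x' - x\<close>.\<close>

lemma ray_transfer:
  assumes "\<And>t. t \<ge> 0 \<Longrightarrow> U x (s * t) \<le> C + m * t" and "t \<ge> 0"
  shows "U x' (s * t) \<le> U x' 0 + m * t"
proof (rule ray_bound[OF _ assms(2)])
  fix t :: real assume "t \<ge> 0"
  then show "U x' (s * t) \<le> (U (2 * x' - x) 0 + C) / 2 + m * t"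
    using U_half[of x' "2 * x' - x" x "s * t" 0 "s * (2 * t)"] assms(1)[of "2 * t"] by (simp add: field_simps)
qed

text \<open>If \<open>u\<close> had finite asymptotic slope \<open>m0\<close> in direction \<open>s e\<^sub>2\<close>, then over \<open>[1, 2] \<times> s [T, 2 T]\<close> the
  subgradients would fill a region of area at most \<open>256 \<epsilon>\<^sup>2 T\<close>, less than the mass, which is of order \<open>T\<close>.\<close>

lemma superlinear:
  assumes s: "s = 1 \<or> s = - 1"
  shows "\<exists>t\<ge>0. U x (s * t) > C + m * t"
proof (rule ccontr)
  assume "\<not> (\<exists>t\<ge>0. U x (s * t) > C + m * t)"
  then have bd: "\<And>t. t \<ge> 0 \<Longrightarrow> U x (s * t) \<le> C + m * t" by force
  define B where "B = {m. \<forall>t\<ge>0. U 0 (s * t) \<le> U 0 0 + m * t}"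
  have "m \<in> B" using ray_transfer[OF bd, where x' = 0] by (simp add: B_def)
  have Blow: "U 0 0 - U 0 (- s) \<le> m" if "m \<in> B" for m
  proof -
    have "U 0 s \<le> U 0 0 + m" using that by (auto simp: B_def dest: spec[of _ 1])
    then show ?thesis using U_half[of 0 0 0 0 s "- s"] by simp
  qed
  have bB: "bdd_below B" by (rule bdd_belowI) (rule Blow)
  define m0 where "m0 = Inf B"
  have up: "U x (s * t) \<le> U x 0 + m0 * t" if "t \<ge> 0" for x t
  proof (cases "t = 0")
    case False
    then have t: "t > 0" using that by simp
    have "(U x (s * t) - U x 0) / t \<le> m0"
      unfolding m0_def
    proof (rule cInf_greatest)
      fix m assume m: "m \<in> B"
      have "U x (s * t) \<le> U x 0 + m * t"
        by (rule ray_transfer[where x = 0 and C = "U 0 0", OF _ that]) (use m in \<open>simp add: B_def\<close>)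
      then show "(U x (s * t) - U x 0) / t \<le> m" using t by (simp add: field_simps)
    qed (use \<open>m \<in> B\<close> in auto)
    then show ?thesis using t by (simp add: field_simps)
  qed simp
  define \<kappa>0 where "\<kappa>0 = 2 powr (- \<bar>\<alpha>\<bar>)"
  have \<kappa>0: "\<kappa>0 > 0" by (simp add: \<kappa>0_def)
  \<comment> \<open>The rectangle \<open>Q\<close> below has sides 16 \<epsilon> T and 16
    \<epsilon>; with this choice 256 \<epsilon>^2 is half of \<open>\<kappa>0\<close>.\<close>
  define \<epsilon> where "\<epsilon> = sqrt (\<kappa>0 / 512)"
  have \<epsilon>: "\<epsilon> > 0" "256 * \<epsilon>\<^sup>2 < \<kappa>0" using \<kappa>0 by (simp_all add: \<epsilon>_def)
  have "m0 - \<epsilon> \<notin> B" using cInf_lower[OF _ bB] \<epsilon>(1) by (force simp: m0_def)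
  \<comment> \<open>A slope below \<open>m0\<close> fails over 0 and hence, by
    \<open>ray_transfer\<close>, also over 3/2, the fixed point of the reflection x -> 3 - x of
    [0, 3].\<close>
  then obtain t1 where t1: "t1 \<ge> 0" "U (3/2) (s * t1) > U (3/2) 0 + (m0 - \<epsilon>) * t1"
    using ray_transfer[of "3/2" s "U (3/2) 0" "m0 - \<epsilon>" _ 0] unfolding B_def by force
  then have "t1 > 0" by (cases "t1 = 0") auto
  have low: "U (3/2) (s * t) \<ge> U (3/2) 0 + (m0 - \<epsilon>) * t" if "t \<ge> t1" for t
    by (rule ray_quotient_mono[OF \<open>t1 > 0\<close> that]) (use t1 in simp)
  obtain K where K: "K > 0" "\<And>x. x \<in> {0..3} \<Longrightarrow> \<bar>U x 0\<bar> \<le> K"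
  proof -
    have "compact ((\<lambda>x. U x 0) ` {0..3})"
      by (intro compact_continuous_image continuous_intros) auto
    then obtain K where "\<And>x. x \<in> {0..3} \<Longrightarrow> \<bar>U x 0\<bar> \<le> K"
      using compact_imp_bounded bounded_iff by (metis image_eqI real_norm_def)
    then show ?thesis by (intro that[of "max K 1"]) (auto simp: le_max_iff_disj)
  qed
  define T where "T = max 1 (max t1 (K / \<epsilon>))"
  have "T \<ge> K / \<epsilon>" "T \<ge> 1" "T \<ge> t1" by (auto simp: T_def)
  then have T: "T \<ge> 1" "T \<ge> t1" "K \<le> \<epsilon> * T"
    using \<epsilon>(1) by (auto simp: pos_divide_le_eq mult.commute)
  define A :: "(real \<times> real) set" where "A = (if s = 1 then cbox (1, T) (2, 2 * T) else cbox (1, - 2 * T) (2, - T))"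
  define Q where "Q = cbox (- 8 * \<epsilon> * T, s * m0 - 8 * \<epsilon>) (8 * \<epsilon> * T, s * m0 + 8 * \<epsilon>)"
  \<comment> \<open>\<open>g\<close> removes the asymptotic slope. Above it is bounded by
    \<open>K\<close>; below, by midpoint convexity at 3/2 against the upper bound at 3 - x. Since
    \<open>K\<close> <= \<epsilon> T, its relevant differences are at most 8 \<epsilon> T. The
    comparison points 0 and 3 lie at distance at least 1 in x, and 0 and 2 t at distance t >= T in
    the second variable.\<close>
  define g where "g = (\<lambda>x t. U x (s * t) - m0 * t)"
  have gup: "g x t \<le> K" if "x \<in> {0..3}" "t \<ge> 0" for x t
    using up[OF that(2), of x] K(2)[OF that(1)] by (simp add: g_def)
  have glow: "g x t \<ge> - 3 * K - 2 * \<epsilon> * t" if "x \<in> {0..3}" "t \<ge> T" for x t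
  proof -
    have "g (3/2) t \<le> (g x t + g (3 - x) t) / 2"
      using U_half[of "3/2" x "3 - x" "s * t" "s * t" "s * t"] by (simp add: g_def)
    moreover have "g (3/2) t \<ge> - K - \<epsilon> * t"
      using low[of t] that T K(2)[of "3/2"] by (simp add: g_def algebra_simps)
    moreover have "g (3 - x) t \<le> K" using gup[of "3 - x" t] that T by auto
    ultimately show ?thesis by (simp add: algebra_simps)
  qed
  have sub: "p \<in> Q" if A: "(x, t') \<in> A" and sg: "subgrad U x t' p" for x t' p
  proof -
    define t where "t = s * t'"
    have ss: "s * s = 1" using s by auto
    have t': "t' = s * t" unfolding t_def using ss by (simp flip: mult.assoc)
    have x: "1 \<le> x" "x \<le> 2" and t: "T \<le> t" "t \<le> 2 * T"
      using A s by (auto simp: A_def t_def split: if_splits)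
    define r where "r = s * snd p - m0"
    have g: "g x t + fst p * (x' - x) + r * (\<tau> - t) \<le> g x' \<tau>" for x' \<tau>
    proof -
      have "snd p * (s * \<tau> - s * t) = s * snd p * (\<tau> - t)" by (simp add: algebra_simps)
      then show ?thesis
        using sg[unfolded subgrad_def, rule_format, of x' "s * \<tau>"]
        by (simp add: g_def r_def t' algebra_simps)
    qed
    have "\<epsilon> * t \<le> \<epsilon> * (2 * T)" using t(2) \<epsilon>(1) by (intro mult_left_mono) auto
    moreover have "g x t \<ge> - 3 * K - 2 * \<epsilon> * t" using x t by (intro glow) auto
    ultimately have gl: "g x t \<ge> - 7 * \<epsilon> * T" using T(3) by (simp add: algebra_simps)
    have K': "K \<le> \<epsilon> * T" by fact
    have "r * t \<le> 8 * \<epsilon> * T" using g[of x "2 * t"] gup[of x "2 * t"] gl x t T K' by simp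
    also have "\<dots> \<le> 8 * \<epsilon> * t" using t \<epsilon>(1) by simp
    finally have r1: "r \<le> 8 * \<epsilon>" using t T by (simp add: mult_le_cancel_right)
    have "- r * t \<le> 8 * \<epsilon> * T" using g[of x 0] gup[of x 0] gl x t T K' by (simp add: algebra_simps)
    also have "\<dots> \<le> 8 * \<epsilon> * t" using t \<epsilon>(1) by simp
    finally have r2: "- r \<le> 8 * \<epsilon>" using t T by (simp only: mult_le_cancel_right)
    have p3: "fst p * (3 - x) \<le> 8 * \<epsilon> * T" using g[of 3 t] gup[of 3 t] gl t T K' by simp
    have p0: "- fst p * x \<le> 8 * \<epsilon> * T" using g[of 0 t] gup[of 0 t] gl t T K' by simp
    have p1: "fst p \<le> 8 * \<epsilon> * T"
    proof (cases "fst p \<ge> 0")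
      case True
      then have "fst p * 1 \<le> fst p * (3 - x)" using x by (intro mult_left_mono) auto
      then show ?thesis using p3 by simp
    next
      case False
      then show ?thesis using \<epsilon> T by (smt (verit) mult_nonneg_nonneg)
    qed
    have p2: "- fst p \<le> 8 * \<epsilon> * T"
    proof (cases "fst p \<le> 0")
      case True
      then have "- fst p * 1 \<le> - fst p * x" using x by (intro mult_left_mono) auto
      then show ?thesis using p0 by simp
    next
      case False
      then show ?thesis using \<epsilon> T by (smt (verit) mult_nonneg_nonneg)
    qed
    have "snd p = s * (m0 + r)" unfolding r_def using ss by (simp flip: mult.assoc)
    then have "\<bar>snd p - s * m0\<bar> = \<bar>r\<bar>" using s by (auto simp: algebra_simps)
    then have "\<bar>snd p - s * m0\<bar> \<le> 8 * \<epsilon>" using r1 r2 by linarith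
    then show "p \<in> Q" using p1 p2 unfolding Q_def by (cases p) (auto simp: abs_le_iff)
  qed
  have "ennreal \<kappa>0 * emeasure lborel A \<le> mass A"
    unfolding \<kappa>0_def by (rule mass_bounds) (auto simp: A_def split: if_splits)
  also have "mass A \<le> emeasure lborel Q"
  proof (rule mass_le)
    show "A \<in> sets borel" "Q \<in> sets borel" by (auto simp: A_def Q_def)
  qed (rule sub)
  also have "emeasure lborel Q = ennreal (256 * \<epsilon>\<^sup>2 * T)"
    unfolding Q_def using \<epsilon>(1) T
    by (subst emeasure_lborel_rectangle) (auto simp: power2_eq_square algebra_simps intro: mult_nonneg_nonneg)
  also have "emeasure lborel A = ennreal T"
    using T by (auto simp: A_def emeasure_lborel_rectangle)
  finally have "\<kappa>0 * T \<le> 256 * \<epsilon>\<^sup>2 * T"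
    using \<kappa>0 T by (simp add: ennreal_mult[symmetric])
  then show False using \<epsilon>(2) T by (simp add: mult_le_cancel_right)
qed

subsection \<open>The partial Legendre transform\<close>

definition w :: "real \<Rightarrow> real \<Rightarrow> real" where
  "w x y = (SUP t. y * t - U x t)"

text \<open>Growth over 0 is carried to every \<open>x\<close> with |x| <= M by midpoint convexity
  with the base point over -x; this halves \<open>t\<close>, hence the doubled
  \<open>max T1 T2\<close> in \<open>R\<close>. Slope M + 1 beats |y| <= M and leaves |t| to absorb
  the constants. Uniformity of \<open>R\<close> confines all maximizers to one interval.\<close>

lemma coercive:
  obtains R where "R > 0"
    and "\<And>x y t. \<bar>x\<bar> \<le> M \<Longrightarrow> \<bar>y\<bar> \<le> M \<Longrightarrow> \<bar>t\<bar> > R \<Longrightarrow> y * t - U x t < - U x 0"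
proof -
  obtain K where K: "\<And>x. \<bar>x\<bar> \<le> M \<Longrightarrow> \<bar>U x 0\<bar> \<le> K"
  proof -
    have "compact ((\<lambda>x. U x 0) ` {- M..M})"
      by (intro compact_continuous_image continuous_intros) auto
    then obtain K where "\<And>x. x \<in> {- M..M} \<Longrightarrow> \<bar>U x 0\<bar> \<le> K"
      using compact_imp_bounded bounded_iff by (metis image_eqI real_norm_def)
    then show ?thesis by (intro that[of K]) (auto simp: abs_le_iff)
  qed
  have "\<exists>T\<ge>0. \<forall>t\<ge>T. U 0 (s * t) \<ge> U 0 0 + (M + 1) * t" if s: "s = 1 \<or> s = - 1" for s
  proof -
    obtain T where T: "T \<ge> 0" "U 0 (s * T) > U 0 0 + (M + 1) * T" using superlinear[OF s] by blast
    then have "T > 0" by (cases "T = 0") auto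
    then show ?thesis using T ray_quotient_mono[where x = 0 and s = s and m = "M + 1", OF \<open>T > 0\<close>] by (intro exI[of _ T]) auto
  qed
  then obtain T1 T2 where T: "\<And>t. t \<ge> T1 \<Longrightarrow> U 0 t \<ge> U 0 0 + (M + 1) * t"
      "\<And>t. t \<ge> T2 \<Longrightarrow> U 0 (- t) \<ge> U 0 0 + (M + 1) * t"
    by (metis mult_1 mult_minus1)
  have grow: "U 0 t \<ge> U 0 0 + (M + 1) * \<bar>t\<bar>" if "\<bar>t\<bar> \<ge> max T1 T2" for t
    using T(1)[of t] T(2)[of "- t"] that by (cases "t \<ge> 0") auto
  define R where "R = max 1 (max (2 * max T1 T2) (2 * \<bar>U 0 0\<bar> + 2 * K))"
  show ?thesis
  proof (rule that)
    show "R > 0" unfolding R_def by linarith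
    fix x y t assume x: "\<bar>x\<bar> \<le> M" and y: "\<bar>y\<bar> \<le> M" and t: "\<bar>t\<bar> > R"
    have K': "U (- x) 0 \<le> K" "U x 0 \<le> K" using K[of x] K[of "- x"] x by auto
    have "U 0 (t / 2) \<le> (U x t + U (- x) 0) / 2" by (rule U_half) auto
    moreover have "U 0 (t / 2) \<ge> U 0 0 + (M + 1) * \<bar>t / 2\<bar>"
      using t unfolding R_def by (intro grow) auto
    ultimately have 1: "U x t \<ge> 2 * U 0 0 + \<bar>t\<bar> + M * \<bar>t\<bar> - K"
      using K' by (simp add: field_simps)
    have "\<bar>t\<bar> > 2 * \<bar>U 0 0\<bar> + 2 * K" using t unfolding R_def by linarith
    then have 2: "2 * U 0 0 + \<bar>t\<bar> > 2 * K" by linarith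
    have "y * t \<le> M * \<bar>t\<bar>"
      using mult_right_mono[OF y, of "\<bar>t\<bar>"] by (metis abs_ge_self abs_ge_zero abs_mult order_trans)
    then show "y * t - U x t < - U x 0" using 1 2 K'(2) by linarith
  qed
qed

lemma maximizer: "\<exists>t. \<forall>t'. y * t' - U x t' \<le> y * t - U x t"
proof -
  obtain R where R: "R > 0"
      "\<And>x' y' t. \<bar>x'\<bar> \<le> max \<bar>x\<bar> \<bar>y\<bar> \<Longrightarrow> \<bar>y'\<bar> \<le> max \<bar>x\<bar> \<bar>y\<bar> \<Longrightarrow> \<bar>t\<bar> > R \<Longrightarrow> y' * t - U x' t < - U x' 0"
    using coercive[of "max \<bar>x\<bar> \<bar>y\<bar>"] by blast
  have "\<exists>t\<in>{- R..R}. \<forall>t'\<in>{- R..R}. y * t' - U x t' \<le> y * t - U x t"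
    using R(1) by (intro continuous_attains_sup continuous_intros) auto
  then obtain t where t: "t \<in> {- R..R}" "\<And>t'. t' \<in> {- R..R} \<Longrightarrow> y * t' - U x t' \<le> y * t - U x t" by blast
  have "y * t' - U x t' \<le> y * t - U x t" for t'
  proof (cases "t' \<in> {- R..R}")
    case False
    then have "\<bar>t'\<bar> > R" by auto
    then show ?thesis using R(2)[of x y t'] t(2)[of 0] R(1) by auto
  qed (rule t(2))
  then show ?thesis by blast
qed

lemma w_eqI: "(\<And>t'. y * t' - U x t' \<le> y * t - U x t) \<Longrightarrow> w x y = y * t - U x t"
  unfolding w_def by (intro cSup_eq_maximum) auto

lemma w_attained:
  obtains t where "w x y = y * t - U x t"
  using maximizer[of y x] w_eqI by blast

lemma w_ge: "y * t - U x t \<le> w x y"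
  using maximizer[of y x] w_eqI by metis

lemma w_convex:
  assumes "0 \<le> l" "l \<le> 1"
  shows "w x ((1 - l) * y + l * y') \<le> (1 - l) * w x y + l * w x y'"
proof -
  obtain t where "w x ((1 - l) * y + l * y') = ((1 - l) * y + l * y') * t - U x t" by (rule w_attained)
  also have "\<dots> = (1 - l) * (y * t - U x t) + l * (y' * t - U x t)" by (simp add: algebra_simps)
  also have "\<dots> \<le> (1 - l) * w x y + l * w x y'"
    using assms by (intro add_mono mult_left_mono w_ge) auto
  finally show ?thesis .
qed

text \<open>Joint convexity of \<open>U\<close> enters here: the combination of the maximizers for
  \<open>x\<close> and \<open>x'\<close> competes at the intermediate point.\<close>

lemma w_concave:
  assumes "0 \<le> l" "l \<le> 1"
  shows "(1 - l) * w x y + l * w x' y \<le> w ((1 - l) * x + l * x') y"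
proof -
  obtain t where t: "w x y = y * t - U x t" by (rule w_attained)
  obtain t' where t': "w x' y = y * t' - U x' t'" by (rule w_attained)
  have "y * ((1 - l) * t + l * t') - U ((1 - l) * x + l * x') ((1 - l) * t + l * t') \<le> w ((1 - l) * x + l * x') y"
    by (rule w_ge)
  then show ?thesis
    unfolding t t' using U_convex[OF assms, of x x' t t'] by (simp add: algebra_simps)
qed

text \<open>By \<open>coercive\<close> the maximizers for parameters in a box stay in a fixed
  compact interval, so uniform continuity of y t - U passes to the maximum.\<close>

lemma continuous_on_w: "continuous_on UNIV (\<lambda>p. w (fst p) (snd p))"
proof -
  have "isCont (\<lambda>p. w (fst p) (snd p)) p0" for p0
  proof -
    define M where "M = \<bar>fst p0\<bar> + \<bar>snd p0\<bar> + 1"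
    obtain R where R: "R > 0"
        "\<And>x y t. \<bar>x\<bar> \<le> M \<Longrightarrow> \<bar>y\<bar> \<le> M \<Longrightarrow> \<bar>t\<bar> > R \<Longrightarrow> y * t - U x t < - U x 0"
      using coercive[of M] by blast
    let ?Q = "cbox (- M, - M) (M, M)"
    let ?F = "\<lambda>z :: (real \<times> real) \<times> real. snd (fst z) * snd z - U (fst (fst z)) (snd z)"
    have uc: "uniformly_continuous_on (?Q \<times> {- R..R}) ?F"
      by (intro compact_uniformly_continuous continuous_intros compact_Times) auto
    have "continuous_on ?Q (\<lambda>p. w (fst p) (snd p))"
    proof (rule uniformly_continuous_imp_continuous, unfold uniformly_continuous_on_def, intro allI impI)
      fix e :: real assume e: "e > 0"
      then obtain d where d: "d > 0" "\<And>z z'. z \<in> ?Q \<times> {- R..R} \<Longrightarrow> z' \<in> ?Q \<times> {- R..R} \<Longrightarrow> dist z' z < d \<Longrightarrow> dist (?F z') (?F z) < e"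
        using uc unfolding uniformly_continuous_on_def by meson
      have one: "w (fst p) (snd p) < w (fst p') (snd p') + e"
        if pp: "p \<in> ?Q" "p' \<in> ?Q" "dist p' p < d" for p p'
      proof -
        obtain t where t: "w (fst p) (snd p) = snd p * t - U (fst p) t" by (rule w_attained)
        have "\<bar>fst p\<bar> \<le> M" "\<bar>snd p\<bar> \<le> M" using pp(1) by (cases p; auto simp: abs_le_iff)+
        then have "\<bar>t\<bar> \<le> R" using R(2)[of "fst p" "snd p" t] t w_ge[of "snd p" 0 "fst p"] by fastforce
        then have "t \<in> {- R..R}" by auto
        then have "dist (?F (p', t)) (?F (p, t)) < e" using pp by (intro d(2)) (auto simp: dist_Pair_Pair)
        then show ?thesis using t w_ge[of "snd p'" t "fst p'"] by (simp add: dist_real_def abs_less_iff)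
      qed
      show "\<exists>d>0. \<forall>p\<in>?Q. \<forall>p'\<in>?Q. dist p' p < d \<longrightarrow> dist (w (fst p') (snd p')) (w (fst p) (snd p)) < e"
      proof (intro exI[of _ d] conjI d(1) ballI impI)
        fix p p' assume "p \<in> ?Q" "p' \<in> ?Q" "dist p' p < d"
        then show "dist (w (fst p') (snd p')) (w (fst p) (snd p)) < e"
          using one[of p p'] one[of p' p] by (simp add: dist_real_def dist_commute abs_less_iff)
      qed
    qed
    moreover have "p0 \<in> interior ?Q"
      unfolding interior_cbox by (cases p0) (auto simp: mem_box Basis_prod_def M_def)
    ultimately show ?thesis by (rule continuous_on_interior)
  qed
  then show ?thesis by (simp add: continuous_at_imp_continuous_on)
qed

lemma continuous_on_w' [continuous_intros]:
  "continuous_on S f \<Longrightarrow> continuous_on S g \<Longrightarrow> continuous_on S (\<lambda>x. w (f x) (g x))"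
  using continuous_on_compose2[OF continuous_on_w, of S "\<lambda>x. (f x, g x)"]
  by (auto intro: continuous_intros)

text \<open>\<open>c\<close> and \<open>d\<close> are the mirror-image convex combinations of
  \<open>c - h\<close> and \<open>d + h\<close>, with weight \<open>?l\<close>; adding the two
  convexity inequalities gives the claim.\<close>

lemma w_slope_mono:
  assumes "c \<le> d" "h > 0"
  shows "w x c - w x (c - h) \<le> w x (d + h) - w x d"
proof -
  let ?l = "h / (d - c + 2 * h)"
  have l: "0 \<le> ?l" "?l \<le> 1" and n: "d - c + 2 * h > 0" using assms by (auto simp: field_simps)
  have c: "(1 - ?l) * (c - h) + ?l * (d + h) = c" and d: "(1 - ?l) * (d + h) + ?l * (c - h) = d"
    using n by (simp_all add: divide_simps) (simp_all add: algebra_simps)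
  have "w x c \<le> (1 - ?l) * w x (c - h) + ?l * w x (d + h)"
    using w_convex[OF l, of x "c - h" "d + h"] unfolding c .
  moreover have "w x d \<le> (1 - ?l) * w x (d + h) + ?l * w x (c - h)"
    using w_convex[OF l, of x "d + h" "c - h"] unfolding d .
  ultimately show ?thesis by (simp add: algebra_simps)
qed

lemma w_slope_antimono:
  assumes "a \<le> b" "k > 0"
  shows "w (b + k) y - w b y \<le> w a y - w (a - k) y"
proof -
  let ?l = "k / (b - a + 2 * k)"
  have l: "0 \<le> ?l" "?l \<le> 1" and n: "b - a + 2 * k > 0" using assms by (auto simp: field_simps)
  have c: "(1 - ?l) * (a - k) + ?l * (b + k) = a" and d: "(1 - ?l) * (b + k) + ?l * (a - k) = b"
    using n by (simp_all add: divide_simps) (simp_all add: algebra_simps)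
  have "w a y \<ge> (1 - ?l) * w (a - k) y + ?l * w (b + k) y"
    using w_concave[OF l, of "a - k" y "b + k"] unfolding c .
  moreover have "w b y \<ge> (1 - ?l) * w (b + k) y + ?l * w (a - k) y"
    using w_concave[OF l, of "b + k" y "a - k"] unfolding d .
  ultimately show ?thesis by (simp add: algebra_simps)
qed

end

text \<open>A convex function that has not risen from \<open>v\<close> to \<open>z\<close> cannot be
  lower on the other side of \<open>v\<close>. It lets an inequality between two values stand in for
  a sign condition on a one-sided derivative.\<close>

lemma convex_past_descent:
  fixes \<psi> :: "real \<Rightarrow> real"
  assumes conv: "\<And>l x x'. 0 \<le> l \<Longrightarrow> l \<le> 1 \<Longrightarrow> \<psi> ((1 - l) * x + l * x') \<le> (1 - l) * \<psi> x + l * \<psi> x'"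
    and le: "\<psi> z \<le> \<psi> v" and between: "x \<le> v \<and> v < z \<or> z < v \<and> v \<le> x"
  shows "\<psi> v \<le> \<psi> x"
proof -
  define l where "l = (v - x) / (z - x)"
  have l: "0 \<le> l" "l < 1" using between by (auto simp: l_def divide_simps)
  have "v = (1 - l) * x + l * z" using between by (auto simp: l_def divide_simps) (auto simp: algebra_simps)
  then have "\<psi> v \<le> (1 - l) * \<psi> x + l * \<psi> z" using conv[of l x z] l by simp
  also have "\<dots> \<le> (1 - l) * \<psi> x + l * \<psi> v" using le l by (intro add_left_mono mult_left_mono) auto
  finally have "(1 - l) * \<psi> v \<le> (1 - l) * \<psi> x" by (simp add: algebra_simps)
  then show ?thesis using l by simp
qed

section \<open>Weighted and plain areas between graphs\<close>

context weight
begin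

text \<open>The substitution s = \<sigma> x. The composite of \<sigma> with a primitive in s is
  continuous, so the point 0, where the weight may be unbounded, can be excepted in the fundamental
  theorem.\<close>

lemma weight_has_integral:
  assumes ab: "a \<le> b" and D: "continuous_on UNIV D"
  shows "((\<lambda>x. \<bar>x\<bar> powr \<alpha> * D x) has_integral integral {\<sigma> a..\<sigma> b} (\<lambda>s. D (\<xi> s))) {a..b}"
proof -
  let ?G = "\<lambda>t. integral {\<sigma> a..t} (\<lambda>s. D (\<xi> s))"
  have cD: "continuous_on {\<sigma> a..\<sigma> b} (\<lambda>s. D (\<xi> s))"
    by (rule continuous_on_compose2[OF D]) (auto intro!: continuous_intros)
  have dG: "(?G has_real_derivative D (\<xi> t)) (at t within {\<sigma> a..\<sigma> b})" if "t \<in> {\<sigma> a..\<sigma> b}" for t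
    using integral_has_real_derivative[OF cD that] .
  have cG: "continuous_on {\<sigma> a..\<sigma> b} ?G"
    using dG by (meson DERIV_continuous continuous_on_eq_continuous_within)
  have "((\<lambda>x. \<bar>x\<bar> powr \<alpha> * D x) has_integral ?G (\<sigma> b) - ?G (\<sigma> a)) {a..b}"
  proof (rule fundamental_theorem_of_calculus_interior_strong[where S = "{0}"])
    show "continuous_on {a..b} (\<lambda>x. ?G (\<sigma> x))"
      by (rule continuous_on_compose2[OF cG]) (auto intro!: continuous_intros \<sigma>_mono)
    fix x assume x: "x \<in> {a<..<b} - {0}"
    then have "\<sigma> x \<in> {\<sigma> a<..<\<sigma> b}" by (simp add: \<sigma>_strict_mono)
    then have "at (\<sigma> x) within {\<sigma> a..\<sigma> b} = at (\<sigma> x)" "\<sigma> x \<in> {\<sigma> a..\<sigma> b}"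
      by (auto intro!: at_within_interior)
    then have "(?G has_real_derivative D (\<xi> (\<sigma> x))) (at (\<sigma> x))"
      using dG[of "\<sigma> x"] by (simp only:)
    then have "((\<lambda>x. ?G (\<sigma> x)) has_real_derivative D (\<xi> (\<sigma> x)) * \<bar>x\<bar> powr \<alpha>) (at x)"
      by (rule DERIV_chain2[OF _ DERIV_\<sigma>]) (use x in auto)
    then show "((\<lambda>x. ?G (\<sigma> x)) has_vector_derivative \<bar>x\<bar> powr \<alpha> * D x) (at x)"
      unfolding has_real_derivative_iff_has_vector_derivative by (simp only: \<xi>_\<sigma> mult.commute)
  qed (use ab in auto)
  then show ?thesis by simp
qed

lemma mass_iterated:
  assumes S: "S \<in> sets borel"
  shows "mass S = (\<integral>\<^sup>+x. \<integral>\<^sup>+t. ennreal (\<bar>x\<bar> powr \<alpha>) * indicator S (x, t) \<partial>lborel \<partial>lborel)"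
proof -
  let ?F = "\<lambda>p :: real \<times> real. ennreal (\<bar>fst p\<bar> powr \<alpha>) * indicator S p"
  have "?F \<in> borel_measurable (lborel \<Otimes>\<^sub>M lborel)"
    unfolding lborel_prod using S by simp
  from lborel.nn_integral_fst[OF this] show ?thesis
    unfolding mass_def lborel_prod by simp
qed

lemma area_iterated:
  fixes S :: "(real \<times> real) set"
  assumes S: "S \<in> sets borel"
  shows "emeasure lborel S = (\<integral>\<^sup>+y. \<integral>\<^sup>+x. indicator S (x, y) \<partial>lborel \<partial>lborel)"
proof -
  have "indicator S \<in> borel_measurable (lborel \<Otimes>\<^sub>M lborel)"
    unfolding lborel_prod using S by simp
  from lborel_pair.nn_integral_snd[OF this] show ?thesis
    using S unfolding lborel_prod by simp
qed

lemma mass_le_graph: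
  assumes S: "S \<in> sets borel" and ab: "a \<le> b"
    and f: "continuous_on UNIV f" and g: "continuous_on UNIV g"
    and sub: "\<And>x t. (x, t) \<in> S \<Longrightarrow> a \<le> x \<and> x \<le> b \<and> f x \<le> t \<and> t \<le> g x"
    and fg: "\<And>x. a \<le> x \<Longrightarrow> x \<le> b \<Longrightarrow> f x \<le> g x"
  shows "mass S \<le> ennreal (integral {\<sigma> a..\<sigma> b} (\<lambda>s. g (\<xi> s) - f (\<xi> s)))"
proof -
  have "mass S \<le> (\<integral>\<^sup>+x. ennreal (\<bar>x\<bar> powr \<alpha> * (g x - f x)) * indicator {a..b} x \<partial>lborel)"
    unfolding mass_iterated[OF S]
  proof (rule nn_integral_mono)
    fix x
    have "(\<integral>\<^sup>+t. ennreal (\<bar>x\<bar> powr \<alpha>) * indicator S (x, t) \<partial>lborel) \<le>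
        (\<integral>\<^sup>+t. ennreal (\<bar>x\<bar> powr \<alpha>) * indicator {a..b} x * indicator {f x..g x} t \<partial>lborel)"
      by (intro nn_integral_mono) (auto simp: indicator_def dest: sub)
    also have "\<dots> = ennreal (\<bar>x\<bar> powr \<alpha>) * indicator {a..b} x * emeasure lborel {f x..g x}"
      by (rule nn_integral_cmult_indicator) simp
    also have "\<dots> = ennreal (\<bar>x\<bar> powr \<alpha> * (g x - f x)) * indicator {a..b} x"
      using fg[of x] by (auto simp: indicator_def ennreal_mult)
    finally show "(\<integral>\<^sup>+t. ennreal (\<bar>x\<bar> powr \<alpha>) * indicator S (x, t) \<partial>lborel) \<le>
        ennreal (\<bar>x\<bar> powr \<alpha> * (g x - f x)) * indicator {a..b} x" .
  qed
  also have "\<dots> = ennreal (integral {\<sigma> a..\<sigma> b} (\<lambda>s. g (\<xi> s) - f (\<xi> s)))"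
    by (rule nn_integral_has_integral_lebesgue'[OF _ weight_has_integral[OF ab]])
      (use fg f g in \<open>auto intro!: continuous_intros\<close>)
  finally show ?thesis .
qed

text \<open>The graphs may cross. Where \<open>g\<close> lies below \<open>f\<close> the integrand
  is negative, so passing to its positive part only enlarges the left side.\<close>

lemma mass_ge_graph:
  assumes S: "S \<in> sets borel" and ab: "a \<le> b"
    and f: "continuous_on UNIV f" and g: "continuous_on UNIV g"
    and sup: "\<And>x t. a \<le> x \<Longrightarrow> x \<le> b \<Longrightarrow> f x < t \<Longrightarrow> t < g x \<Longrightarrow> (x, t) \<in> S"
  shows "ennreal (integral {\<sigma> a..\<sigma> b} (\<lambda>s. g (\<xi> s) - f (\<xi> s))) \<le> mass S"
proof -
  let ?D = "\<lambda>x. max 0 (g x - f x)"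
  have cD: "continuous_on UNIV ?D" using f g by (intro continuous_intros)
  have c\<xi>: "continuous_on {\<sigma> a..\<sigma> b} (\<lambda>s. h (\<xi> s))" if "continuous_on UNIV h" for h :: "real \<Rightarrow> real"
    by (rule continuous_on_compose2[OF that]) (auto intro!: continuous_intros)
  have "integral {\<sigma> a..\<sigma> b} (\<lambda>s. g (\<xi> s) - f (\<xi> s)) \<le> integral {\<sigma> a..\<sigma> b} (\<lambda>s. ?D (\<xi> s))"
    by (intro integral_le integrable_continuous_interval continuous_intros c\<xi> f g) auto
  then have "ennreal (integral {\<sigma> a..\<sigma> b} (\<lambda>s. g (\<xi> s) - f (\<xi> s))) \<le> ennreal (integral {\<sigma> a..\<sigma> b} (\<lambda>s. ?D (\<xi> s)))"
    by (rule ennreal_leI)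
  also have "\<dots> = (\<integral>\<^sup>+x. ennreal (\<bar>x\<bar> powr \<alpha> * ?D x) * indicator {a..b} x \<partial>lborel)"
    by (rule nn_integral_has_integral_lebesgue'[OF _ weight_has_integral[OF ab cD], symmetric]) auto
  also have "\<dots> \<le> mass S"
    unfolding mass_iterated[OF S]
  proof (rule nn_integral_mono)
    fix x
    have "ennreal (\<bar>x\<bar> powr \<alpha> * ?D x) * indicator {a..b} x =
        ennreal (\<bar>x\<bar> powr \<alpha>) * indicator {a..b} x * emeasure lborel {f x<..<g x}"
      by (cases "f x \<le> g x") (auto simp: indicator_def ennreal_mult)
    also have "\<dots> = (\<integral>\<^sup>+t. ennreal (\<bar>x\<bar> powr \<alpha>) * indicator {a..b} x * indicator {f x<..<g x} t \<partial>lborel)"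
      by (rule nn_integral_cmult_indicator[symmetric]) simp
    also have "\<dots> \<le> (\<integral>\<^sup>+t. ennreal (\<bar>x\<bar> powr \<alpha>) * indicator S (x, t) \<partial>lborel)"
      by (intro nn_integral_mono) (auto simp: indicator_def dest: sup)
    finally show "ennreal (\<bar>x\<bar> powr \<alpha> * ?D x) * indicator {a..b} x \<le>
        (\<integral>\<^sup>+t. ennreal (\<bar>x\<bar> powr \<alpha>) * indicator S (x, t) \<partial>lborel)" .
  qed
  finally show ?thesis .
qed

lemma area_le_graph:
  fixes f g :: "real \<Rightarrow> real"
  assumes S: "S \<in> sets borel"
    and f: "continuous_on UNIV f" and g: "continuous_on UNIV g"
    and sub: "\<And>x y. (x, y) \<in> S \<Longrightarrow> c \<le> y \<and> y \<le> d \<and> f y \<le> x \<and> x \<le> g y"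
    and fg: "\<And>y. c \<le> y \<Longrightarrow> y \<le> d \<Longrightarrow> f y \<le> g y"
  shows "emeasure lborel S \<le> ennreal (integral {c..d} (\<lambda>y. g y - f y))"
proof -
  have "emeasure lborel S \<le> (\<integral>\<^sup>+y. ennreal (g y - f y) * indicator {c..d} y \<partial>lborel)"
    unfolding area_iterated[OF S]
  proof (rule nn_integral_mono)
    fix y
    have "(\<integral>\<^sup>+x. indicator S (x, y) \<partial>lborel) \<le> (\<integral>\<^sup>+x. indicator {c..d} y * indicator {f y..g y} x \<partial>lborel)"
      by (intro nn_integral_mono) (auto simp: indicator_def dest: sub)
    also have "\<dots> = indicator {c..d} y * emeasure lborel {f y..g y}"
      by (rule nn_integral_cmult_indicator) simp
    also have "\<dots> = ennreal (g y - f y) * indicator {c..d} y"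
      using fg[of y] by (auto simp: indicator_def)
    finally show "(\<integral>\<^sup>+x. indicator S (x, y) \<partial>lborel) \<le> ennreal (g y - f y) * indicator {c..d} y" .
  qed
  also have "\<dots> = ennreal (integral {c..d} (\<lambda>y. g y - f y))"
    by (rule nn_integral_has_integral_lebesgue'[OF _ integrable_integral])
      (use fg in \<open>auto intro!: integrable_continuous_interval continuous_intros continuous_on_subset[OF f] continuous_on_subset[OF g]\<close>)
  finally show ?thesis .
qed

lemma area_ge_graph:
  fixes f g :: "real \<Rightarrow> real"
  assumes S: "S \<in> sets borel"
    and f: "continuous_on UNIV f" and g: "continuous_on UNIV g"
    and sup: "\<And>x y. c \<le> y \<Longrightarrow> y \<le> d \<Longrightarrow> f y < x \<Longrightarrow> x < g y \<Longrightarrow> (x, y) \<in> S"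
  shows "ennreal (integral {c..d} (\<lambda>y. g y - f y)) \<le> emeasure lborel S"
proof -
  let ?D = "\<lambda>x. max 0 (g x - f x)"
  have i: "?D integrable_on {c..d}" "(\<lambda>y. g y - f y) integrable_on {c..d}"
    by (intro integrable_continuous_interval continuous_intros continuous_on_subset[OF f]
        continuous_on_subset[OF g]; simp)+
  have "integral {c..d} (\<lambda>y. g y - f y) \<le> integral {c..d} ?D"
    by (intro integral_le i) auto
  then have "ennreal (integral {c..d} (\<lambda>y. g y - f y)) \<le> ennreal (integral {c..d} ?D)"
    by (rule ennreal_leI)
  also have "\<dots> = (\<integral>\<^sup>+y. ennreal (?D y) * indicator {c..d} y \<partial>lborel)"
    by (rule nn_integral_has_integral_lebesgue'[OF _ integrable_integral[OF i(1)], symmetric]) auto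
  also have "\<dots> \<le> emeasure lborel S"
    unfolding area_iterated[OF S]
  proof (rule nn_integral_mono)
    fix y
    have "ennreal (?D y) * indicator {c..d} y = indicator {c..d} y * emeasure lborel {f y<..<g y}"
      by (cases "f y \<le> g y") (auto simp: indicator_def)
    also have "\<dots> = (\<integral>\<^sup>+x. indicator {c..d} y * indicator {f y<..<g y} x \<partial>lborel)"
      by (rule nn_integral_cmult_indicator[symmetric]) simp
    also have "\<dots> \<le> (\<integral>\<^sup>+x. indicator S (x, y) \<partial>lborel)"
      by (intro nn_integral_mono) (auto simp: indicator_def dest: sup)
    finally show "ennreal (?D y) * indicator {c..d} y \<le> (\<integral>\<^sup>+x. indicator S (x, y) \<partial>lborel)" .
  qed
  finally show ?thesis .
qed

end

context monge_ampere
begin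

subsection \<open>The linear equation for the partial Legendre transform\<close>

lemma minus_w_convex:
  assumes "0 \<le> l" "l \<le> 1"
  shows "- w ((1 - l) * x + l * x') y - p * ((1 - l) * x + l * x') \<le>
    (1 - l) * (- w x y - p * x) + l * (- w x' y - p * x')"
  using w_concave[OF assms, of x y x'] by (simp add: algebra_simps)

text \<open>The set \<open>E\<close> of points over \<open>[a, b]\<close> having a subgradient in \<open>t\<close> between \<open>c\<close> and \<open>d\<close> is mapped by the
  subdifferential onto at least the slopes \<open>p\<close> with \<open>snd p \<in> [c, d]\<close> for which \<open>- w x (snd p) - fst p * x\<close> is
  minimized in \<open>[a, b]\<close>. Difference quotients replace the one-sided derivatives.\<close>

lemma rectangle_upper:
  assumes ab: "a \<le> b" and cd: "c \<le> d" and h: "h > 0" and k: "k > 0"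
  shows "integral {c..d} (\<lambda>y. (w (b - k) y - w b y) / k - (w a y - w (a + k) y) / k) \<le>
    integral {\<sigma> a..\<sigma> b} (\<lambda>s. (w (\<xi> s) (d + h) - w (\<xi> s) d) / h - (w (\<xi> s) c - w (\<xi> s) (c - h)) / h)"
    (is "?L \<le> ?R")
proof -
  let ?E = "{z. a \<le> fst z \<and> fst z \<le> b \<and>
      (\<forall>r. r > 0 \<longrightarrow> U (fst z) (snd z) + c * r \<le> U (fst z) (snd z + r)) \<and>
      (\<forall>r. r > 0 \<longrightarrow> U (fst z) (snd z) - d * r \<le> U (fst z) (snd z - r))}"
  let ?S = "{p. c \<le> snd p \<and> snd p \<le> d \<and> (w a (snd p) - w (a + k) (snd p)) / k \<le> fst p \<and>
      fst p \<le> (w (b - k) (snd p) - w b (snd p)) / k}"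
  have E: "?E \<in> sets borel"
    by (intro borel_closed closed_Collect_conj closed_Collect_all closed_Collect_imp closed_Collect_le
        open_Collect_const continuous_intros)
  have S: "?S \<in> sets borel"
    by (intro borel_closed closed_Collect_conj closed_Collect_le continuous_intros) (use k in auto)
  have "ennreal ?L \<le> emeasure lborel ?S"
    by (rule area_ge_graph[OF S]) (use k in \<open>auto intro!: continuous_intros\<close>)
  also have "\<dots> \<le> mass ?E"
  proof (rule mass_ge[OF E S])
    fix p assume p: "p \<in> ?S"
    let ?y = "snd p"
    let ?\<psi> = "\<lambda>x. - w x ?y - fst p * x"
    have conv: "0 \<le> l \<Longrightarrow> l \<le> 1 \<Longrightarrow> ?\<psi> ((1 - l) * x + l * x') \<le> (1 - l) * ?\<psi> x + l * ?\<psi> x'" for l x x'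
      by (rule minus_w_convex)
    have "\<exists>x\<in>{a..b}. \<forall>x'\<in>{a..b}. ?\<psi> x \<le> ?\<psi> x'"
      using ab by (intro continuous_attains_inf continuous_intros) auto
    then obtain x where x: "x \<in> {a..b}" "\<And>x'. x' \<in> {a..b} \<Longrightarrow> ?\<psi> x \<le> ?\<psi> x'" by blast
    have pa: "?\<psi> (a + k) \<le> ?\<psi> a" and pb: "?\<psi> (b - k) \<le> ?\<psi> b"
      using p k by (auto simp: field_simps)
    have min: "?\<psi> x \<le> ?\<psi> x'" for x'
    proof -
      consider "x' < a" | "x' \<in> {a..b}" | "x' > b" by force
      then show ?thesis
      proof cases
        case 1
        have "?\<psi> a \<le> ?\<psi> x'"
          by (rule convex_past_descent[OF conv pa]) (use 1 k in auto)
        then show ?thesis using x(2)[of a] ab by simp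
      next
        case 3
        have "?\<psi> b \<le> ?\<psi> x'"
          by (rule convex_past_descent[OF conv pb]) (use 3 k in auto)
        then show ?thesis using x(2)[of b] ab by simp
      qed (rule x(2))
    qed
    obtain t where t: "w x ?y = ?y * t - U x t" by (rule w_attained)
    have "subgrad U x t p"
      unfolding subgrad_def
    proof (intro allI)
      fix x' t'
      show "U x t + fst p * (x' - x) + ?y * (t' - t) \<le> U x' t'"
        using min[of x'] w_ge[of ?y t' x'] t by (simp add: algebra_simps)
    qed
    moreover have "(x, t) \<in> ?E"
    proof -
      have "U x t + c * r \<le> U x (t + r) \<and> U x t - d * r \<le> U x (t - r)" if r: "r > 0" for r
      proof -
        have "c * r \<le> ?y * r" "?y * r \<le> d * r" using p r by auto
        then show ?thesis
          using w_ge[of ?y "t + r" x] w_ge[of ?y "t - r" x] t by (simp add: algebra_simps)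
      qed
      then show ?thesis using x(1) by auto
    qed
    ultimately show "\<exists>x t. (x, t) \<in> ?E \<and> subgrad U x t p" by blast
  qed
  also have "\<dots> \<le> ennreal ?R"
  proof (rule mass_le_graph[OF E ab])
    show "continuous_on UNIV (\<lambda>x. (w x (d + h) - w x d) / h)" "continuous_on UNIV (\<lambda>x. (w x c - w x (c - h)) / h)"
      using h by (auto intro!: continuous_intros)
    show "(w x c - w x (c - h)) / h \<le> (w x (d + h) - w x d) / h" for x
      using w_slope_mono[OF cd h, of x] h by (simp add: divide_right_mono)
    fix x t assume z: "(x, t) \<in> ?E"
    \<comment> \<open>If the maximizer \<open>t0\<close> for slope \<open>c\<close> lies to the
      right of \<open>t\<close>, membership in \<open>?E\<close> makes \<open>t\<close> a maximizer
      too; otherwise \<open>t0\<close> is compared with \<open>t\<close> directly.\<close>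
    have "w x c \<le> w x (c - h) + h * t"
    proof -
      obtain t0 where t0: "w x c = c * t0 - U x t0" by (rule w_attained)
      show ?thesis
      proof (cases "t0 \<le> t")
        case True
        then have "h * t0 \<le> h * t" using h by simp
        then show ?thesis using w_ge[of "c - h" t0 x] t0 by (simp add: algebra_simps)
      next
        case False
        then have "U x t + c * (t0 - t) \<le> U x (t + (t0 - t))"
          using z by (auto simp del: add_diff_cancel_left' add_diff_eq dest: spec[of _ "t0 - t"])
        then show ?thesis using w_ge[of "c - h" t x] t0 by (simp add: algebra_simps)
      qed
    qed
    moreover have "w x d + h * t \<le> w x (d + h)"
    proof -
      obtain t0 where t0: "w x d = d * t0 - U x t0" by (rule w_attained)
      show ?thesis
      proof (cases "t \<le> t0")
        case True
        then have "h * t \<le> h * t0" using h by simp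
        then show ?thesis using w_ge[of "d + h" t0 x] t0 by (simp add: algebra_simps)
      next
        case False
        then have "U x t - d * (t - t0) \<le> U x (t - (t - t0))"
          using z by (auto dest: spec[of _ "t - t0"])
        then show ?thesis using w_ge[of "d + h" t x] t0 by (simp add: algebra_simps)
      qed
    qed
    ultimately show "a \<le> x \<and> x \<le> b \<and> (w x c - w x (c - h)) / h \<le> t \<and> t \<le> (w x (d + h) - w x d) / h"
      using z h by (auto simp: field_simps)
  qed
  finally have "ennreal ?L \<le> ennreal ?R" .
  moreover have "?R \<ge> 0"
    by (rule integral_nonneg)
      (use w_slope_mono[OF cd h] h in \<open>auto intro!: integrable_continuous_interval continuous_intros simp: divide_right_mono\<close>)
  ultimately show ?thesis by (auto simp: ennreal_le_iff2)
qed

text \<open>Counterpart of \<open>rectangle_upper\<close> with strict conditions: a left quotient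
  above \<open>c\<close> and a right quotient below \<open>d\<close> force every subgradient at a
  point of \<open>?E\<close> to have second component strictly between them, so all of them lie in
  \<open>?S\<close>. The y quotients now look into [c, d] and the x quotients out of [a, b].\<close>

lemma rectangle_lower:
  assumes ab: "a \<le> b" and cd: "c \<le> d" and h: "h > 0" and k: "k > 0"
  shows "integral {\<sigma> a..\<sigma> b} (\<lambda>s. (w (\<xi> s) d - w (\<xi> s) (d - h)) / h - (w (\<xi> s) (c + h) - w (\<xi> s) c) / h) \<le>
    integral {c..d} (\<lambda>y. (w b y - w (b + k) y) / k - (w (a - k) y - w a y) / k)"
    (is "?L \<le> ?R")
proof -
  let ?E = "{z. a \<le> fst z \<and> fst z \<le> b} \<inter>
      {z. (\<exists>r. r > 0 \<and> U (fst z) (snd z) > U (fst z) (snd z - r) + c * r) \<and>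
      (\<exists>r. r > 0 \<and> U (fst z) (snd z + r) < U (fst z) (snd z) + d * r)}"
  let ?S = "{p. c \<le> snd p \<and> snd p \<le> d \<and> (w (a - k) (snd p) - w a (snd p)) / k \<le> fst p \<and>
      fst p \<le> (w b (snd p) - w (b + k) (snd p)) / k}"
  have E: "?E \<in> sets borel"
    by (intro sets.Int borel_closed borel_open closed_Collect_conj open_Collect_conj open_Collect_ex
        open_Collect_less closed_Collect_le open_Collect_const continuous_intros)
  have S: "?S \<in> sets borel"
    by (intro borel_closed closed_Collect_conj closed_Collect_le continuous_intros) (use k in auto)
  have "ennreal ?L \<le> mass ?E"
  proof (rule mass_ge_graph[OF E ab])
    show "continuous_on UNIV (\<lambda>x. (w x d - w x (d - h)) / h)" "continuous_on UNIV (\<lambda>x. (w x (c + h) - w x c) / h)"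
      using h by (auto intro!: continuous_intros)
    fix x t assume x: "a \<le> x" "x \<le> b" and t: "(w x (c + h) - w x c) / h < t" "t < (w x d - w x (d - h)) / h"
    have t: "w x (c + h) - w x c < h * t" "h * t < w x d - w x (d - h)"
      using t h by (auto simp: field_simps)
    have "\<exists>r. r > 0 \<and> U x t > U x (t - r) + c * r"
    proof -
      obtain t0 where t0: "w x c = c * t0 - U x t0" by (rule w_attained)
      have "h * t0 < h * t" using w_ge[of "c + h" t0 x] t0 t by (simp add: algebra_simps)
      then have "t0 < t" using h by simp
      moreover have "c * t - U x t < w x c" using w_ge[of "c + h" t x] t by (simp add: algebra_simps)
      ultimately show ?thesis using t0 by (intro exI[of _ "t - t0"]) (simp add: algebra_simps)
    qed
    moreover have "\<exists>r. r > 0 \<and> U x (t + r) < U x t + d * r"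
    proof -
      obtain t0 where t0: "w x d = d * t0 - U x t0" by (rule w_attained)
      have "h * t < h * t0" using w_ge[of "d - h" t0 x] t0 t by (simp add: algebra_simps)
      then have "t < t0" using h by simp
      moreover have "d * t - U x t < w x d" using w_ge[of "d - h" t x] t by (simp add: algebra_simps)
      ultimately show ?thesis using t0 by (intro exI[of _ "t0 - t"]) (simp add: algebra_simps)
    qed
    ultimately show "(x, t) \<in> ?E" using x by simp
  qed
  also have "\<dots> \<le> emeasure lborel ?S"
  proof (rule mass_le[OF E S])
    fix x t p assume E: "(x, t) \<in> ?E" and sg: "subgrad U x t p"
    let ?y = "snd p"
    let ?\<psi> = "\<lambda>x. - w x ?y - fst p * x"
    have sg: "U x t + fst p * (x' - x) + ?y * (t' - t) \<le> U x' t'" for x' t'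
      using sg by (simp add: subgrad_def)
    obtain r1 r2 where r: "r1 > 0" "U x t > U x (t - r1) + c * r1" "r2 > 0" "U x (t + r2) < U x t + d * r2"
      using E by auto
    have "U x t - ?y * r1 \<le> U x (t - r1)" "U x t + ?y * r2 \<le> U x (t + r2)"
      using sg[of x "t - r1"] sg[of x "t + r2"] by auto
    then have "c * r1 < ?y * r1" "?y * r2 < d * r2" using r by linarith+
    then have "c < ?y" "?y < d" using r by simp_all
    have wx: "w x ?y = ?y * t - U x t"
      by (rule w_eqI) (use sg[of x] in \<open>simp add: algebra_simps\<close>)
    have min: "?\<psi> x \<le> ?\<psi> x'" for x'
    proof -
      obtain t' where "w x' ?y = ?y * t' - U x' t'" by (rule w_attained)
      then show ?thesis using wx sg[of x' t'] by (simp add: algebra_simps)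
    qed
    have conv: "0 \<le> l \<Longrightarrow> l \<le> 1 \<Longrightarrow> ?\<psi> ((1 - l) * x + l * x') \<le> (1 - l) * ?\<psi> x + l * ?\<psi> x'" for l x x'
      by (rule minus_w_convex)
    have "?\<psi> a \<le> ?\<psi> (a - k)"
    proof (cases "a = x")
      case False
      show ?thesis by (rule convex_past_descent[OF conv min]) (use False E k in auto)
    qed (use min in simp)
    moreover have "?\<psi> b \<le> ?\<psi> (b + k)"
    proof (cases "b = x")
      case False
      show ?thesis by (rule convex_past_descent[OF conv min]) (use False E k in auto)
    qed (use min in simp)
    ultimately show "p \<in> ?S"
      using \<open>c < ?y\<close> \<open>?y < d\<close> k by (auto simp: field_simps)
  qed
  also have "\<dots> \<le> ennreal ?R"
  proof (rule area_le_graph[OF S])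
    show "(w (a - k) y - w a y) / k \<le> (w b y - w (b + k) y) / k" for y
      using w_slope_antimono[OF ab k, of y] k by (simp add: divide_right_mono)
  qed (use k in \<open>auto intro!: continuous_intros\<close>)
  finally have "ennreal ?L \<le> ennreal ?R" .
  moreover have "?R \<ge> 0"
  proof (rule integral_nonneg)
    show "0 \<le> (w b y - w (b + k) y) / k - (w (a - k) y - w a y) / k" for y
      using w_slope_antimono[OF ab k, of y] k by (simp add: divide_right_mono)
  qed (use k in \<open>auto intro!: integrable_continuous_interval continuous_intros\<close>)
  ultimately show ?thesis by (auto simp: ennreal_le_iff2)
qed

end

subsection \<open>Second differences and averages\<close>

lemma antiderivative_UNIV:
  fixes f :: "real \<Rightarrow> real"
  assumes f: "continuous_on UNIV f"
  obtains F where "\<And>x. (F has_real_derivative f x) (at x)"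
proof
  fix x :: real
  \<comment> \<open>The oriented integral from 0 to y: one of the two intervals is empty or a single
    point, and the other carries the sign.\<close>
  let ?F = "\<lambda>y. integral {0..y} f - integral {y..0} f"
  define B where "B = \<bar>x\<bar> + 1"
  have c: "continuous_on S f" for S using f continuous_on_subset by blast
  have "((\<lambda>y. integral {- B..y} f) has_real_derivative f x) (at x within {- B..B})"
    by (rule integral_has_real_derivative[OF c]) (auto simp: B_def)
  moreover have "at x within {- B..B} = at x"
    by (rule at_within_interior) (auto simp: B_def)
  ultimately have "((\<lambda>y. integral {- B..y} f - integral {- B..0} f) has_real_derivative f x) (at x)"
    by (auto intro!: derivative_eq_intros)
  then show "(?F has_real_derivative f x) (at x)"
  proof (rule has_field_derivative_transform_within_open[where S = "{- B<..<B}"])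
    fix y assume y: "y \<in> {- B<..<B}"
    show "integral {- B..y} f - integral {- B..0} f = ?F y"
    proof (cases "y \<ge> 0")
      case True
      have "integral {- B..0} f + integral {0..y} f = integral {- B..y} f"
        using True by (intro Henstock_Kurzweil_Integration.integral_combine integrable_continuous_interval c) (auto simp: B_def)
      moreover have "integral {y..0} f = 0" using True by (cases "y = 0") auto
      ultimately show ?thesis by simp
    next
      case False
      have "integral {- B..y} f + integral {y..0} f = integral {- B..0} f"
        using False y by (intro Henstock_Kurzweil_Integration.integral_combine integrable_continuous_interval c) auto
      then show ?thesis using False by simp
    qed
  qed (auto simp: B_def)
qed

lemma integral_antiderivative:
  fixes F f :: "real \<Rightarrow> real"
  assumes "\<And>x. (F has_real_derivative f x) (at x)" "a \<le> b"
  shows "integral {a..b} f = F b - F a" and "f integrable_on {a..b}"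
proof -
  have "(f has_integral F b - F a) {a..b}"
    by (rule fundamental_theorem_of_calculus[OF assms(2)])
      (auto intro!: has_field_derivative_at_within assms(1) simp flip: has_real_derivative_iff_has_vector_derivative)
  then show "integral {a..b} f = F b - F a" "f integrable_on {a..b}"
    by (auto simp: integral_unique)
qed

lemma DERIV_shift_arg:
  fixes F :: "real \<Rightarrow> real"
  assumes "(F has_real_derivative D) (at (c + x))"
  shows "((\<lambda>x. F (c + x)) has_real_derivative D) (at x)"
proof -
  have "((\<lambda>x. c + x) has_real_derivative 1) (at x)" by (auto intro!: derivative_eq_intros)
  from DERIV_chain2[OF assms this] show ?thesis by simp
qed

definition diff2 :: "real \<Rightarrow> (real \<Rightarrow> real) \<Rightarrow> real \<Rightarrow> real" where
  "diff2 h f y = f (y + 2 * h) - 2 * f (y + h) + f y"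

lemma DERIV_diff2:
  assumes "\<And>y. (f has_real_derivative f' y) (at y)"
  shows "(diff2 h f has_real_derivative diff2 h f' y) (at y)"
proof -
  have d: "((\<lambda>y. f (c + y)) has_real_derivative f' (c + y)) (at y)" for c
    by (rule DERIV_shift_arg) (rule assms)
  have "((\<lambda>y. f (2 * h + y) - 2 * f (h + y) + f y) has_real_derivative
      f' (2 * h + y) - 2 * f' (h + y) + f' y) (at y)"
    by (intro DERIV_add DERIV_diff DERIV_cmult d assms)
  then show ?thesis by (simp add: diff2_def[abs_def] add.commute)
qed

text \<open>Each integration over a window of length \<open>H\<close> replaces a function by a
  difference of its primitive; two of them give a second difference of the second primitive.\<close>

lemma average_eq_diff2:
  assumes Q: "\<And>x. (Q has_real_derivative P x) (at x)" and P: "\<And>x. (P has_real_derivative f x) (at x)" and H: "H \<ge> 0"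
  shows "integral {0..H} (\<lambda>\<tau>. integral {0..H} (\<lambda>r. f (c + \<tau> + r))) = diff2 H Q c"
    and "integral {0..H} (\<lambda>\<tau>. integral {c + \<tau>..c + H + \<tau>} f) = diff2 H Q c"
proof -
  have 1: "integral {0..H} (\<lambda>r. f (c + \<tau> + r)) = P (c + H + \<tau>) - P (c + \<tau>)" for \<tau>
    using integral_antiderivative(1)[OF DERIV_shift_arg[OF P], of 0 H "c + \<tau>"] H by (simp add: algebra_simps)
  have 2: "integral {c + \<tau>..c + H + \<tau>} f = P (c + H + \<tau>) - P (c + \<tau>)" for \<tau>
    using integral_antiderivative(1)[OF P, of "c + \<tau>" "c + H + \<tau>"] H by simp
  have 3: "integral {0..H} (\<lambda>\<tau>. P (c + H + \<tau>) - P (c + \<tau>)) = diff2 H Q c"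
  proof -
    have d: "((\<lambda>\<tau>. Q (e + \<tau>)) has_real_derivative P (e + \<tau>)) (at \<tau>)" for e \<tau>
      by (rule DERIV_shift_arg) (rule Q)
    have "((\<lambda>\<tau>. Q (c + H + \<tau>) - Q (c + \<tau>)) has_real_derivative P (c + H + \<tau>) - P (c + \<tau>)) (at \<tau>)" for \<tau>
      by (intro DERIV_diff d)
    from integral_antiderivative(1)[OF this H] show ?thesis
      by (simp add: diff2_def algebra_simps)
  qed
  show "integral {0..H} (\<lambda>\<tau>. integral {0..H} (\<lambda>r. f (c + \<tau> + r))) = diff2 H Q c" unfolding 1 3 ..
  show "integral {0..H} (\<lambda>\<tau>. integral {c + \<tau>..c + H + \<tau>} f) = diff2 H Q c" unfolding 2 3 ..
qed

text \<open>Averaging over an interval removes the division by \<open>h\<close>: both sides are the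
  same second-order difference of the primitive over \<open>h\<close>, but the right side makes
  sense and is continuous at \<open>h = 0\<close>. Limits can thus be taken without differentiating
  \<open>f\<close>.\<close>

lemma integral_difference_quotient:
  assumes P: "\<And>x. (P has_real_derivative f x) (at x)" and H: "H \<ge> 0" and h: "h \<noteq> 0"
  shows "integral {0..H} (\<lambda>\<tau>. (f (c + \<tau> + h) - f (c + \<tau>)) / h) =
    integral {0..1} (\<lambda>\<theta>. f (c + H + h * \<theta>) - f (c + h * \<theta>))"
proof -
  have d: "((\<lambda>\<tau>. P (e + \<tau>)) has_real_derivative f (e + \<tau>)) (at \<tau>)" for e \<tau>
    by (rule DERIV_shift_arg) (rule P)
  have "((\<lambda>\<tau>. (P (c + h + \<tau>) - P (c + \<tau>)) / h) has_real_derivative (f (c + h + \<tau>) - f (c + \<tau>)) / h) (at \<tau>)" for \<tau>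
    by (intro DERIV_cdivide DERIV_diff d)
  from integral_antiderivative(1)[OF this H]
  have 1: "integral {0..H} (\<lambda>\<tau>. (f (c + \<tau> + h) - f (c + \<tau>)) / h) =
      (P (c + h + H) - P (c + H)) / h - (P (c + h) - P c) / h"
    by (simp add: algebra_simps)
  have d: "((\<lambda>\<theta>. P (e + h * \<theta>) / h) has_real_derivative f (e + h * \<theta>)) (at \<theta>)" for e \<theta>
  proof -
    have "((\<lambda>\<theta>. P (e + h * \<theta>)) has_real_derivative f (e + h * \<theta>) * h) (at \<theta>)"
      by (rule DERIV_chain2[OF P]) (auto intro!: derivative_eq_intros)
    from DERIV_cdivide[OF this, of h] show ?thesis using h by simp
  qed
  from integral_antiderivative(1)[OF DERIV_diff[OF d d], of 0 1 "c + H" c]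
  have "integral {0..1} (\<lambda>\<theta>. f (c + H + h * \<theta>) - f (c + h * \<theta>)) =
      (P (c + H + h) / h - P (c + h) / h) - (P (c + H) / h - P c / h)"
    by simp
  then show ?thesis unfolding 1 by (simp add: diff_divide_distrib algebra_simps)
qed

lemma isCont_lower_bound:
  fixes \<phi> :: "real \<Rightarrow> real"
  assumes "isCont \<phi> 0" "\<epsilon> > 0" "\<And>k. 0 < k \<Longrightarrow> k < \<epsilon> \<Longrightarrow> C \<le> \<phi> k"
  shows "C \<le> \<phi> 0"
proof (rule tendsto_lowerbound)
  show "(\<phi> \<longlongrightarrow> \<phi> 0) (at_right 0)"
    using assms(1) by (simp add: isCont_def filterlim_at_split)
  show "\<forall>\<^sub>F k in at_right 0. C \<le> \<phi> k"
    using assms(2,3) by (auto simp: eventually_at_right_field intro: exI[of _ \<epsilon>])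
qed simp

text \<open>The left and right difference quotients of \<open>Z\<close> at \<open>x\<close> with step \<open>k\<close> differ by at most
  \<open>g (x + k) - g (x - 2 k)\<close>.\<close>

lemma convex_derivative_from_increments:
  fixes Z g :: "real \<Rightarrow> real"
  assumes conv: "convex_on UNIV Z" and g: "continuous_on UNIV g"
    and A: "\<And>a b k. a \<le> b \<Longrightarrow> k > 0 \<Longrightarrow> (Z b - Z (b - k)) / k - (Z (a + k) - Z a) / k \<le> g b - g a"
    and B: "\<And>a b k. a \<le> b \<Longrightarrow> k > 0 \<Longrightarrow> g b - g a \<le> (Z (b + k) - Z b) / k - (Z a - Z (a - k)) / k"
  obtains m where "\<And>x. (Z has_real_derivative g x + m) (at x)"
proof -
  have slope: "(Z x - Z (x - k')) / k' \<le> (Z (x + k) - Z x) / k" if "k > 0" "k' > 0" for x k k'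
  proof -
    define l where "l = k' / (k + k')"
    have l: "l * (k + k') = k'" "0 \<le> l" "l \<le> 1" using that by (auto simp: l_def)
    have "(1 - l) * (x - k') + l * (x + k) = x + (l * (k + k') - k')" by (simp add: algebra_simps)
    then have "Z x \<le> (1 - l) * Z (x - k') + l * Z (x + k)"
      using convex_onD[OF conv l(2,3), of "x - k'" "x + k"] l(1) by simp
    then have "(k + k') * Z x \<le> (k + k') * ((1 - l) * Z (x - k') + l * Z (x + k))"
      using that by (intro mult_left_mono) auto
    also have "\<dots> = ((k + k') - l * (k + k')) * Z (x - k') + l * (k + k') * Z (x + k)"
      by (simp add: algebra_simps)
    also have "\<dots> = k * Z (x - k') + k' * Z (x + k)"
      unfolding l(1) by simp
    finally show ?thesis using that by (simp add: field_simps)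
  qed
  define z where "z x = (INF k\<in>{0<..}. (Z (x + k) - Z x) / k)" for x
  have zup: "z x \<le> (Z (x + k) - Z x) / k" if "k > 0" for x k
    unfolding z_def using slope[of _ 1 x] that by (intro cINF_lower bdd_belowI2[where m = "Z x - Z (x - 1)"]) auto
  have zlow: "(Z x - Z (x - k)) / k \<le> z x" if "k > 0" for x k
    unfolding z_def using slope[OF _ that] by (intro cINF_greatest) auto
  have close: "(Z (x + k) - Z x) / k - (Z x - Z (x - k)) / k \<le> g (x + k) - g (x - 2 * k)" if "k > 0" for x k
    using A[of "x - 2 * k" "x + k" k] slope[of k k "x - k"] that by (simp add: algebra_simps)
  have ct: "isCont g x" for x using g by (simp add: continuous_on_eq_continuous_at)
  have der: "(Z has_real_derivative z x) (at x)" for x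
    unfolding DERIV_def
  proof (rule LIM_zero_cancel, rule Lim_null_comparison)
    have "isCont (\<lambda>h. g (x + \<bar>h\<bar>) - g (x - 2 * \<bar>h\<bar>)) 0"
      by (intro continuous_intros continuous_at_compose[of 0 _ g, unfolded o_def] ct)
    then show "(\<lambda>h. g (x + \<bar>h\<bar>) - g (x - 2 * \<bar>h\<bar>)) \<midarrow>0\<rightarrow> 0" by (simp add: isCont_def)
    have "\<bar>(Z (x + h) - Z x) / h - z x\<bar> \<le> g (x + \<bar>h\<bar>) - g (x - 2 * \<bar>h\<bar>)" if "h \<noteq> 0" for h
    proof -
      have k: "\<bar>h\<bar> > 0" using that by simp
      have "(Z (x + h) - Z x) / h = (Z (x + \<bar>h\<bar>) - Z x) / \<bar>h\<bar> \<or> (Z (x + h) - Z x) / h = (Z x - Z (x - \<bar>h\<bar>)) / \<bar>h\<bar>"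
        using that by (cases "h > 0") (auto simp: field_simps)
      then show ?thesis using zup[OF k, of x] zlow[OF k, of x] close[OF k, of x] by linarith
    qed
    then show "\<forall>\<^sub>F h in at 0. norm ((Z (x + h) - Z x) / h - z x) \<le> g (x + \<bar>h\<bar>) - g (x - 2 * \<bar>h\<bar>)"
      by (auto simp: eventually_at_filter)
  qed
  have z: "z y - z x = g y - g x" if "x < y" for x y
  proof (rule antisym)
    have "z y - z x \<le> g (y + k) - g (x - k)" if k: "k > 0" for k
      using A[of "x - k" "y + k" k] zup[OF k, of y] zlow[OF k, of x] k \<open>x < y\<close> by simp
    then have "z y - z x \<le> g (y + 0) - g (x - 0)"
      by (intro isCont_lower_bound[where \<epsilon> = 1 and \<phi> = "\<lambda>k. g (y + k) - g (x - k)"] continuous_intros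
          continuous_at_compose[of 0 _ g, unfolded o_def] ct) auto
    then show "z y - z x \<le> g y - g x" by simp
    have "z x - z y \<le> g (x + k) - g (y - k)" if k: "0 < k" "k < (y - x) / 2" for k
      using B[of "x + k" "y - k" k] zlow[OF k(1), of y] zup[OF k(1), of x] k by simp
    then have "z x - z y \<le> g (x + 0) - g (y - 0)"
      using \<open>x < y\<close>
      by (intro isCont_lower_bound[where \<epsilon> = "(y - x) / 2" and \<phi> = "\<lambda>k. g (x + k) - g (y - k)"] continuous_intros
          continuous_at_compose[of 0 _ g, unfolded o_def] ct) auto
    then show "g y - g x \<le> z y - z x" by simp
  qed
  have "z x = g x + (z 0 - g 0)" for x
    using z[of x 0] z[of 0 x] by (cases x "0::real" rule: linorder_cases) auto
  then show ?thesis using der by (intro that[of "z 0 - g 0"]) metis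
qed

lemma integral_concave:
  fixes f g h :: "real \<Rightarrow> real"
  assumes c: "continuous_on {a..b} f" "continuous_on {a..b} g" "continuous_on {a..b} h"
    and le: "\<And>r. (1 - t) * f r + t * g r \<le> h r"
  shows "(1 - t) * integral {a..b} f + t * integral {a..b} g \<le> integral {a..b} h"
proof -
  have i: "f integrable_on {a..b}" "g integrable_on {a..b}" "h integrable_on {a..b}"
    using c by (auto intro: integrable_continuous_interval)
  have "((\<lambda>r. (1 - t) * f r + t * g r) has_integral (1 - t) * integral {a..b} f + t * integral {a..b} g) {a..b}"
    by (intro has_integral_add has_integral_mult_right integrable_integral i)
  from has_integral_le[OF this integrable_integral[OF i(3)]] le show ?thesis by simp
qed

lemma diff2_nonneg:
  assumes "convex_on UNIV f" shows "0 \<le> diff2 h f y"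
proof -
  have "(1 - 1 / 2) *\<^sub>R (y + 2 * h) + (1 / 2) *\<^sub>R y = y + h" by (simp add: field_simps)
  then show ?thesis
    using convex_onD[OF assms, of "1/2" "y + 2 * h" y] by (simp add: diff2_def)
qed

section \<open>The averaged transform as a classical solution\<close>

context monge_ampere
begin

text \<open>The two averages make \<open>W\<close> twice differentiable in y, with second derivative
  \<open>diff2 H (w x)\<close>, which involves only values of \<open>w\<close>.\<close>

definition W :: "real \<Rightarrow> real \<Rightarrow> real \<Rightarrow> real" where
  "W H x c = integral {0..H} (\<lambda>\<tau>. integral {0..H} (\<lambda>r. w x (c + \<tau> + r)))"

lemma continuous_on_W_inner:
  "continuous_on UNIV (\<lambda>z :: (real \<times> real) \<times> real. integral {0..H} (\<lambda>r. w (fst (fst z)) (snd (fst z) + snd z + r)))"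
proof -
  have "continuous_on (UNIV \<times> cbox 0 H) (\<lambda>(z :: (real \<times> real) \<times> real, r). w (fst (fst z)) (snd (fst z) + snd z + r))"
    unfolding case_prod_beta by (intro continuous_intros)
  from integral_continuous_on_param[OF this] show ?thesis by simp
qed

lemma continuous_on_W: "continuous_on UNIV (\<lambda>p. W H (fst p) (snd p))"
proof -
  have "continuous_on (UNIV \<times> cbox 0 H) (\<lambda>(p :: real \<times> real, \<tau>). integral {0..H} (\<lambda>r. w (fst p) (snd p + \<tau> + r)))"
    using continuous_on_subset[OF continuous_on_W_inner subset_UNIV] by (simp add: case_prod_beta)
  from integral_continuous_on_param[OF this] show ?thesis unfolding W_def by simp
qed

lemma continuous_on_W' [continuous_intros]:
  "continuous_on S f \<Longrightarrow> continuous_on S g \<Longrightarrow> continuous_on S (\<lambda>x. W H (f x) (g x))"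
  using continuous_on_compose2[OF continuous_on_W, of S "\<lambda>x. (f x, g x)"]
  by (auto intro: continuous_intros)

lemma minus_W_convex: "convex_on UNIV (\<lambda>x. - W H x c)"
proof (rule convex_onI)
  fix t x x' :: real assume t: "0 < t" "t < 1"
  have c: "continuous_on S (\<lambda>\<tau>. integral {0..H} (\<lambda>r. w x (c + \<tau> + r)))" for S x
    by (rule continuous_on_compose2[OF continuous_on_W_inner, of S "\<lambda>\<tau>. ((x, c), \<tau>)" H, unfolded fst_conv snd_conv])
      (auto intro!: continuous_intros)
  have "(1 - t) * W H x c + t * W H x' c \<le> W H ((1 - t) * x + t * x') c"
    unfolding W_def
    by (intro integral_concave c continuous_intros w_concave) (use t in auto)
  then show "- W H ((1 - t) *\<^sub>R x + t *\<^sub>R x') c \<le> (1 - t) * - W H x c + t * - W H x' c"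
    by (simp add: algebra_simps)
qed simp

lemma w_primitives:
  obtains P Q where "\<And>x y. (Q x has_real_derivative P x y) (at y)"
    and "\<And>x y. (P x has_real_derivative w x y) (at y)"
proof -
  have "\<exists>P Q. (\<forall>y. (Q has_real_derivative P y) (at y)) \<and> (\<forall>y. (P has_real_derivative w x y) (at y))" for x
  proof -
    obtain P where P: "\<And>y. (P has_real_derivative w x y) (at y)"
      using antiderivative_UNIV[of "w x"] continuous_on_w'[OF continuous_on_const continuous_on_id] by auto
    then have "continuous_on UNIV P" by (meson DERIV_continuous continuous_at_imp_continuous_on)
    then obtain Q where "\<And>y. (Q has_real_derivative P y) (at y)"
      using antiderivative_UNIV[of P] by blast
    then show ?thesis using P by blast
  qed
  then have "\<exists>P Q. (\<forall>x y. (Q x has_real_derivative P x y) (at y)) \<and> (\<forall>x y. (P x has_real_derivative w x y) (at y))"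
    by metis
  then show ?thesis using that by blast
qed

lemma W_y_derivatives:
  assumes H: "H \<ge> 0"
  obtains W1 where "\<And>x y. (W H x has_real_derivative W1 x y) (at y)"
    and "\<And>x y. (W1 x has_real_derivative diff2 H (w x) y) (at y)"
proof -
  obtain P Q where PQ: "\<And>x y. (Q x has_real_derivative P x y) (at y)" "\<And>x y. (P x has_real_derivative w x y) (at y)"
    by (rule w_primitives) (rule that)
  have W: "W H x = diff2 H (Q x)" for x
    unfolding W_def using average_eq_diff2(1)[OF PQ H] by blast
  show ?thesis
  proof (rule that)
    show "(W H x has_real_derivative diff2 H (P x) y) (at y)" for x y
      unfolding W by (rule DERIV_diff2[OF PQ(1)])
    show "(diff2 H (P x) has_real_derivative diff2 H (w x) y) (at y)" for x y
      by (rule DERIV_diff2[OF PQ(2)])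
  qed
qed

lemma W_convex:
  assumes "H \<ge> 0" shows "convex_on UNIV (W H x)"
proof -
  obtain W1 where W1: "\<And>x y. (W H x has_real_derivative W1 x y) (at y)"
    "\<And>x y. (W1 x has_real_derivative diff2 H (w x) y) (at y)"
    by (rule W_y_derivatives[OF assms]) (rule that)
  have "convex_on UNIV (w x)"
    by (rule convex_onI) (auto intro: w_convex)
  then have "diff2 H (w x) y \<ge> 0" for y by (rule diff2_nonneg)
  then show ?thesis
    using f''_ge0_imp_convex[of UNIV "W H x" "W1 x" "diff2 H (w x)"] W1 by simp
qed

text \<open>The y integral in the rectangle inequalities, taken over the sliding window from c +
  \<tau> to c + H + \<tau> and averaged over \<tau>, becomes a difference of quotients of
  \<open>W\<close> in x.\<close>

lemma average_combination:
  fixes x1 x2 x3 x4 k c :: real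
  assumes H: "H \<ge> 0"
  defines "N \<equiv> \<lambda>y. (w x1 y - w x2 y) / k - (w x3 y - w x4 y) / k"
  shows "integral {0..H} (\<lambda>\<tau>. integral {c + \<tau>..c + H + \<tau>} N) =
      (W H x1 c - W H x2 c) / k - (W H x3 c - W H x4 c) / k"
    and "(\<lambda>\<tau>. integral {c + \<tau>..c + H + \<tau>} N) integrable_on {0..H}"
proof -
  obtain P Q where PQ: "\<And>x y. (Q x has_real_derivative P x y) (at y)" "\<And>x y. (P x has_real_derivative w x y) (at y)"
    by (rule w_primitives) (rule that)
  have W: "W H x c = diff2 H (Q x) c" for x
    unfolding W_def using average_eq_diff2(1)[OF PQ H] by blast
  let ?P = "\<lambda>y. (P x1 y - P x2 y) / k - (P x3 y - P x4 y) / k"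
  let ?Q = "\<lambda>y. (Q x1 y - Q x2 y) / k - (Q x3 y - Q x4 y) / k"
  have Q: "(?Q has_real_derivative ?P y) (at y)" for y
    by (intro DERIV_diff DERIV_cdivide PQ)
  have P: "(?P has_real_derivative N y) (at y)" for y
    unfolding N_def by (intro DERIV_diff DERIV_cdivide PQ)
  show "integral {0..H} (\<lambda>\<tau>. integral {c + \<tau>..c + H + \<tau>} N) =
      (W H x1 c - W H x2 c) / k - (W H x3 c - W H x4 c) / k"
    unfolding average_eq_diff2(2)[OF Q P H] W by (simp add: diff2_def diff_divide_distrib add_divide_distrib)
  have cP: "continuous_on UNIV ?P" using P by (meson DERIV_continuous continuous_at_imp_continuous_on)
  have "integral {c + \<tau>..c + H + \<tau>} N = ?P (c + H + \<tau>) - ?P (c + \<tau>)" for \<tau>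
    using integral_antiderivative(1)[OF P, of "c + \<tau>" "c + H + \<tau>"] H by simp
  moreover have "(\<lambda>\<tau>. ?P (c + H + \<tau>) - ?P (c + \<tau>)) integrable_on {0..H}"
    by (rule integrable_continuous_interval, rule continuous_on_diff; rule continuous_on_compose2[OF cP])
      (auto intro!: continuous_intros)
  ultimately show "(\<lambda>\<tau>. integral {c + \<tau>..c + H + \<tau>} N) integrable_on {0..H}" by simp
qed

text \<open>The \<tau> average of the weighted side of the rectangle inequalities with step
  \<open>h\<close>, rewritten by \<open>integral_difference_quotient\<close> so that
  \<open>h = 0\<close> is allowed. Positive \<open>h\<close> belongs to
  \<open>rectangle_upper\<close>, negative \<open>h\<close> to
  \<open>rectangle_lower\<close>.\<close>

definition slab :: "real \<Rightarrow> real \<Rightarrow> real \<Rightarrow> real \<Rightarrow> real \<Rightarrow> real" where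
  "slab a b H c h = integral {\<sigma> a..\<sigma> b} (\<lambda>s. integral {0..1} (\<lambda>\<theta>.
     (w (\<xi> s) (c + H + H + h * \<theta>) - w (\<xi> s) (c + H + h * \<theta>)) -
     (w (\<xi> s) (c - h + H + h * \<theta>) - w (\<xi> s) (c - h + h * \<theta>))))"

lemma slab_0: "slab a b H c 0 = integral {\<sigma> a..\<sigma> b} (\<lambda>s. diff2 H (w (\<xi> s)) c)"
  by (simp add: slab_def diff2_def algebra_simps)

lemma isCont_slab: "isCont (slab a b H c) 0"
proof -
  have "continuous_on (UNIV \<times> cbox 0 1) (\<lambda>(z :: real \<times> real, \<theta> :: real).
     (w (\<xi> (snd z)) (c + H + H + fst z * \<theta>) - w (\<xi> (snd z)) (c + H + fst z * \<theta>)) -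
     (w (\<xi> (snd z)) (c - fst z + H + fst z * \<theta>) - w (\<xi> (snd z)) (c - fst z + fst z * \<theta>)))"
    unfolding case_prod_beta by (intro continuous_intros)
  from integral_continuous_on_param[OF this]
  have "continuous_on UNIV (\<lambda>z :: real \<times> real. integral {0..1} (\<lambda>\<theta>.
     (w (\<xi> (snd z)) (c + H + H + fst z * \<theta>) - w (\<xi> (snd z)) (c + H + fst z * \<theta>)) -
     (w (\<xi> (snd z)) (c - fst z + H + fst z * \<theta>) - w (\<xi> (snd z)) (c - fst z + fst z * \<theta>))))" by simp
  from continuous_on_subset[OF this subset_UNIV]
  have "continuous_on (UNIV \<times> cbox (\<sigma> a) (\<sigma> b)) (\<lambda>(h, s). integral {0..1} (\<lambda>\<theta>.
     (w (\<xi> s) (c + H + H + h * \<theta>) - w (\<xi> s) (c + H + h * \<theta>)) -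
     (w (\<xi> s) (c - h + H + h * \<theta>) - w (\<xi> s) (c - h + h * \<theta>))))"
    by (simp add: case_prod_beta)
  from integral_continuous_on_param[OF this] show ?thesis
    unfolding slab_def[abs_def] by (simp add: continuous_on_eq_continuous_at)
qed

lemma average_slab:
  fixes a b c h :: real
  assumes H: "H \<ge> 0" and h: "h \<noteq> 0"
  defines "F \<equiv> \<lambda>\<tau> s. (w (\<xi> s) (c + H + \<tau> + h) - w (\<xi> s) (c + H + \<tau>)) / h -
      (w (\<xi> s) (c + \<tau>) - w (\<xi> s) (c + \<tau> - h)) / h"
  shows "integral {0..H} (\<lambda>\<tau>. integral {\<sigma> a..\<sigma> b} (F \<tau>)) = slab a b H c h"
    and "(\<lambda>\<tau>. integral {\<sigma> a..\<sigma> b} (F \<tau>)) integrable_on {0..H}"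
proof -
  have c: "continuous_on S (\<lambda>(\<tau>, s). F \<tau> s)" for S
    unfolding F_def case_prod_beta using h by (intro continuous_intros) auto
  have "continuous_on {0..H} (\<lambda>\<tau>. integral {\<sigma> a..\<sigma> b} (F \<tau>))"
    using integral_continuous_on_param[OF c] by simp
  then show "(\<lambda>\<tau>. integral {\<sigma> a..\<sigma> b} (F \<tau>)) integrable_on {0..H}"
    by (rule integrable_continuous_interval)
  have inner: "integral {0..H} (\<lambda>\<tau>. F \<tau> s) = integral {0..1} (\<lambda>\<theta>.
     (w (\<xi> s) (c + H + H + h * \<theta>) - w (\<xi> s) (c + H + h * \<theta>)) -
     (w (\<xi> s) (c - h + H + h * \<theta>) - w (\<xi> s) (c - h + h * \<theta>)))" for s
  proof -
    obtain P Q where PQ: "\<And>x y. (Q x has_real_derivative P x y) (at y)" "\<And>x y. (P x has_real_derivative w x y) (at y)"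
      by (rule w_primitives) (rule that)
    have "integral {0..H} (\<lambda>\<tau>. F \<tau> s) =
        integral {0..H} (\<lambda>\<tau>. (w (\<xi> s) (c + H + \<tau> + h) - w (\<xi> s) (c + H + \<tau>)) / h) -
        integral {0..H} (\<lambda>\<tau>. (w (\<xi> s) (c - h + \<tau> + h) - w (\<xi> s) (c - h + \<tau>)) / h)"
      unfolding F_def using h
      by (subst integral_diff[symmetric])
        (auto intro!: integrable_continuous_interval continuous_intros simp: algebra_simps)
    also have "\<dots> = integral {0..1} (\<lambda>\<theta>. w (\<xi> s) (c + H + H + h * \<theta>) - w (\<xi> s) (c + H + h * \<theta>)) -
        integral {0..1} (\<lambda>\<theta>. w (\<xi> s) (c - h + H + h * \<theta>) - w (\<xi> s) (c - h + h * \<theta>))"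
      unfolding integral_difference_quotient[OF PQ(2) H h] ..
    also have "\<dots> = integral {0..1} (\<lambda>\<theta>.
       (w (\<xi> s) (c + H + H + h * \<theta>) - w (\<xi> s) (c + H + h * \<theta>)) -
       (w (\<xi> s) (c - h + H + h * \<theta>) - w (\<xi> s) (c - h + h * \<theta>)))"
      by (rule integral_diff[symmetric]) (intro integrable_continuous_interval continuous_intros)+
    finally show ?thesis .
  qed
  have "integral {0..H} (\<lambda>\<tau>. integral {\<sigma> a..\<sigma> b} (F \<tau>)) = integral {\<sigma> a..\<sigma> b} (\<lambda>s. integral {0..H} (\<lambda>\<tau>. F \<tau> s))"
    using integral_swap_continuous[OF c, of 0 H "\<sigma> a" "\<sigma> b"] by simp
  then show "integral {0..H} (\<lambda>\<tau>. integral {\<sigma> a..\<sigma> b} (F \<tau>)) = slab a b H c h"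
    unfolding slab_def inner .
qed

lemma W_upper:
  assumes ab: "a \<le> b" and H: "H \<ge> 0" and k: "k > 0"
  shows "(W H (b - k) c - W H b c) / k - (W H a c - W H (a + k) c) / k \<le>
    integral {\<sigma> a..\<sigma> b} (\<lambda>s. diff2 H (w (\<xi> s)) c)" (is "?L \<le> _")
proof -
  have "?L \<le> slab a b H c h" if h: "h > 0" for h
    unfolding average_combination(1)[OF H, symmetric] average_slab(1)[OF H less_imp_neq[OF h, symmetric], symmetric]
    using rectangle_upper[OF ab _ h k, of "c + _" "c + H + _"] H h
    by (intro integral_le average_combination(2) average_slab(2)) auto
  then show ?thesis
    unfolding slab_0[symmetric] using isCont_lower_bound[OF isCont_slab, of 1 ?L] by simp
qed

lemma W_lower:
  assumes ab: "a \<le> b" and H: "H \<ge> 0" and k: "k > 0"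
  shows "integral {\<sigma> a..\<sigma> b} (\<lambda>s. diff2 H (w (\<xi> s)) c) \<le>
    (W H b c - W H (b + k) c) / k - (W H (a - k) c - W H a c) / k" (is "_ \<le> ?R")
proof -
  \<comment> \<open>A negative step turns the outward y quotients into the inward ones of
    \<open>rectangle_lower\<close>.\<close>
  have "slab a b H c (- h) \<le> ?R" if h: "h > 0" for h
  proof -
    have h': "- h \<noteq> 0" using h by simp
    have q: "(p - r) / - h - (t - v) / - h = (r - p) / h - (v - t) / h" for p r t v
      using h by (simp add: field_simps)
    show ?thesis
      unfolding average_combination(1)[OF H, symmetric] average_slab(1)[OF H h', symmetric]
    proof (rule integral_le[OF average_slab(2)[OF H h'] average_combination(2)[OF H]])
      fix \<tau>
      show "integral {\<sigma> a..\<sigma> b} (\<lambda>s. (w (\<xi> s) (c + H + \<tau> + - h) - w (\<xi> s) (c + H + \<tau>)) / - h -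
          (w (\<xi> s) (c + \<tau>) - w (\<xi> s) (c + \<tau> - - h)) / - h) \<le>
        integral {c + \<tau>..c + H + \<tau>} (\<lambda>y. (w b y - w (b + k) y) / k - (w (a - k) y - w a y) / k)"
        unfolding q using rectangle_lower[OF ab _ h k, of "c + \<tau>" "c + H + \<tau>"] H by simp
    qed
  qed
  moreover have "isCont (\<lambda>h. - slab a b H c (- h)) 0"
    using isCont_slab by (intro continuous_intros continuous_at_compose[of 0 uminus "slab a b H c", unfolded o_def]) auto
  ultimately have "- ?R \<le> - slab a b H c (- 0)"
    by (intro isCont_lower_bound[of "\<lambda>h. - slab a b H c (- h)" 1 "- ?R"]) (simp_all only: zero_less_one neg_le_iff_le)
  then show ?thesis unfolding slab_0[symmetric] by simp
qed

text \<open>\<open>W_upper\<close> and \<open>W_lower\<close> squeeze the increments of the x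
  derivative of -W between those of \<Gamma> \<circ> \<sigma>, where \<Gamma> is a primitive in s of
  the y second derivative. Differentiating in s gives the equation even at the axis, where the
  second x derivative itself may be singular.\<close>

lemma W_x_derivative:
  assumes H: "H \<ge> 0"
  obtains z where "\<And>x y. ((\<lambda>x. W H x y) has_real_derivative z x y) (at x)"
    and "\<And>s y. ((\<lambda>s. z (\<xi> s) y) has_real_derivative - diff2 H (w (\<xi> s)) y) (at s)"
proof -
  have "\<exists>z. (\<forall>x. ((\<lambda>x. W H x y) has_real_derivative z x) (at x)) \<and>
      (\<forall>s. ((\<lambda>s. z (\<xi> s)) has_real_derivative - diff2 H (w (\<xi> s)) y) (at s))" for y
  proof -
    have "continuous_on UNIV (\<lambda>s. diff2 H (w (\<xi> s)) y)"
      unfolding diff2_def by (intro continuous_intros)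
    then obtain \<Gamma> where \<Gamma>: "\<And>s. (\<Gamma> has_real_derivative diff2 H (w (\<xi> s)) y) (at s)"
      using antiderivative_UNIV by blast
    then have c\<Gamma>: "continuous_on UNIV \<Gamma>" by (meson DERIV_continuous continuous_at_imp_continuous_on)
    have g: "integral {\<sigma> a..\<sigma> b} (\<lambda>s. diff2 H (w (\<xi> s)) y) = \<Gamma> (\<sigma> b) - \<Gamma> (\<sigma> a)" if "a \<le> b" for a b
      by (rule integral_antiderivative(1)[OF \<Gamma> \<sigma>_mono[OF that]])
    obtain m where m: "\<And>x. ((\<lambda>x. - W H x y) has_real_derivative \<Gamma> (\<sigma> x) + m) (at x)"
    proof (rule convex_derivative_from_increments[OF minus_W_convex, of "\<lambda>x. \<Gamma> (\<sigma> x)" H y])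
      show "continuous_on UNIV (\<lambda>x. \<Gamma> (\<sigma> x))"
        by (rule continuous_on_compose2[OF c\<Gamma>]) (auto intro!: continuous_intros)
      show "(- W H b y - - W H (b - k) y) / k - (- W H (a + k) y - - W H a y) / k \<le> \<Gamma> (\<sigma> b) - \<Gamma> (\<sigma> a)"
        if "a \<le> b" "k > 0" for a b k
        using W_upper[OF that(1) H that(2), of y] g[OF that(1)] by simp
      show "\<Gamma> (\<sigma> b) - \<Gamma> (\<sigma> a) \<le> (- W H (b + k) y - - W H b y) / k - (- W H a y - - W H (a - k) y) / k"
        if "a \<le> b" "k > 0" for a b k
        using W_lower[OF that(1) H that(2), of y] g[OF that(1)] by simp
    qed (rule that)
    show ?thesis
    proof (intro exI[of _ "\<lambda>x. - (\<Gamma> (\<sigma> x) + m)"] conjI allI)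
      show "((\<lambda>x. W H x y) has_real_derivative - (\<Gamma> (\<sigma> x) + m)) (at x)" for x
        using DERIV_minus[OF m[of x]] by simp
      show "((\<lambda>s. - (\<Gamma> (\<sigma> (\<xi> s)) + m)) has_real_derivative - diff2 H (w (\<xi> s)) y) (at s)" for s
        using \<Gamma>[of s] by (auto intro!: derivative_eq_intros)
    qed
  qed
  then obtain z where "\<And>y x. ((\<lambda>x. W H x y) has_real_derivative z y x) (at x)"
      "\<And>y s. ((\<lambda>s. z y (\<xi> s)) has_real_derivative - diff2 H (w (\<xi> s)) y) (at s)"
    by metis
  then show ?thesis using that[of "\<lambda>x y. z y x"] by simp
qed

lemma solution_diff2_W:
  assumes H: "H \<ge> 0"
  shows "solution (\<lambda>p. diff2 k (W H (\<xi> (fst p))) (snd p))"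
proof -
  obtain W1 where W1: "\<And>x y. (W H x has_real_derivative W1 x y) (at y)"
    "\<And>x y. (W1 x has_real_derivative diff2 H (w x) y) (at y)"
    by (rule W_y_derivatives[OF H]) (rule that)
  obtain z where z: "\<And>x y. ((\<lambda>x. W H x y) has_real_derivative z x y) (at x)"
    "\<And>s y. ((\<lambda>s. z (\<xi> s) y) has_real_derivative - diff2 H (w (\<xi> s)) y) (at s)"
    by (rule W_x_derivative[OF H]) (rule that)
  show ?thesis
    unfolding solution_def fst_conv snd_conv
  proof (intro conjI exI allI impI)
    show "continuous_on UNIV (\<lambda>p. diff2 k (W H (\<xi> (fst p))) (snd p))"
      unfolding diff2_def by (intro continuous_intros)
    show "continuous_on UNIV (\<lambda>p. diff2 k (diff2 H (w (\<xi> (fst p)))) (snd p))"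
      unfolding diff2_def by (intro continuous_intros)
    show "((\<lambda>y. diff2 k (W H (\<xi> s)) y) has_real_derivative (\<lambda>p. diff2 k (W1 (\<xi> (fst p))) (snd p)) (s, y)) (at y)" for s y
      using DERIV_diff2[OF W1(1)] by simp
    show "((\<lambda>y. (\<lambda>p. diff2 k (W1 (\<xi> (fst p))) (snd p)) (s, y)) has_real_derivative
        (\<lambda>p. diff2 k (diff2 H (w (\<xi> (fst p)))) (snd p)) (s, y)) (at y)" for s y
      using DERIV_diff2[OF W1(2)] by simp
    show "((\<lambda>s. diff2 k (W H (\<xi> s)) y) has_real_derivative
        \<xi>' s * (\<lambda>p. diff2 k (z (\<xi> (fst p))) (snd p)) (s, y)) (at s)" if "s \<noteq> 0" for s y
    proof -
      have d: "((\<lambda>s. W H (\<xi> s) y) has_real_derivative z (\<xi> s) y * \<xi>' s) (at s)" for y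
        by (rule DERIV_chain2[OF z(1) DERIV_\<xi>[OF that]])
      have "((\<lambda>s. W H (\<xi> s) (y + 2 * k) - 2 * W H (\<xi> s) (y + k) + W H (\<xi> s) y) has_real_derivative
          z (\<xi> s) (y + 2 * k) * \<xi>' s - 2 * (z (\<xi> s) (y + k) * \<xi>' s) + z (\<xi> s) y * \<xi>' s) (at s)"
        by (intro DERIV_add DERIV_diff DERIV_cmult d)
      then show ?thesis by (simp add: diff2_def algebra_simps)
    qed
    show "((\<lambda>s. (\<lambda>p. diff2 k (z (\<xi> (fst p))) (snd p)) (s, y)) has_real_derivative
        - (\<lambda>p. diff2 k (diff2 H (w (\<xi> (fst p)))) (snd p)) (s, y)) (at s)" for s y
    proof -
      have "((\<lambda>s. z (\<xi> s) (y + 2 * k) - 2 * z (\<xi> s) (y + k) + z (\<xi> s) y) has_real_derivative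
          - diff2 H (w (\<xi> s)) (y + 2 * k) - 2 * - diff2 H (w (\<xi> s)) (y + k) + - diff2 H (w (\<xi> s)) y) (at s)"
        by (intro DERIV_add DERIV_diff DERIV_cmult z)
      then show ?thesis by (simp add: diff2_def[of k] algebra_simps)
    qed
  qed
qed

text \<open>The Liouville theorem makes the step-k second differences of \<open>W\<close> constant
  in (x, y) for each \<open>k\<close>. Two derivatives in \<open>k\<close> at 0 recover the y second
  derivative of \<open>W\<close>, which is \<open>diff2 H (w x)\<close>.\<close>

lemma diff2_w_const:
  assumes H: "H \<ge> 0"
  shows "diff2 H (w x) y = diff2 H (w 0) 0"
proof -
  obtain W1 where W1: "\<And>x y. (W H x has_real_derivative W1 x y) (at y)"
    "\<And>x y. (W1 x has_real_derivative diff2 H (w x) y) (at y)"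
    by (rule W_y_derivatives[OF H]) (rule that)
  have pos: "diff2 k (W H x) y = diff2 k (W H 0) 0" if "k > 0" for k x y
    using positive_solution_const[OF solution_diff2_W[OF H, of k], of "(\<sigma> x, y)" "(0, 0)"]
      diff2_nonneg[OF W_convex[OF H]] by simp
  have flip: "diff2 (- k) f y = diff2 k f (y - 2 * k)" for k y and f :: "real \<Rightarrow> real"
    by (simp add: diff2_def)
  \<comment> \<open>Negative \<open>k\<close> are included because the derivatives taken at
    \<open>k = 0\<close> are two-sided.\<close>
  have all: "diff2 k (W H x) y = diff2 k (W H 0) 0" for k x y
  proof (cases k "0 :: real" rule: linorder_cases)
    case less
    then have "- k > 0" by simp
    then show ?thesis
      using flip[of "- k" "W H x" y] flip[of "- k" "W H 0" 0] pos by (metis minus_minus)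
  next
    case equal
    then show ?thesis by (simp add: diff2_def)
  qed (rule pos)
  then have all_eq: "(\<lambda>k. diff2 k (W H x) y) = (\<lambda>k. diff2 k (W H 0) 0)" for x y by blast
  have shift: "((\<lambda>k. f (y + a * k)) has_real_derivative D * a) (at k)" if "(f has_real_derivative D) (at (y + a * k))"
    for f :: "real \<Rightarrow> real" and y a k D
    by (rule DERIV_chain2[where f = f and g = "\<lambda>k. y + a * k", OF that]) (auto intro!: derivative_eq_intros)
  have d1: "((\<lambda>k. W H x (y + a * k)) has_real_derivative W1 x (y + a * k) * a) (at k)" for x y a k
    by (rule shift) (rule W1)
  have d2: "((\<lambda>k. W1 x (y + a * k)) has_real_derivative diff2 H (w x) (y + a * k) * a) (at k)" for x y a k
    by (rule shift) (rule W1)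
  \<comment> \<open>The derivative of \<open>diff2 k (W H x) y\<close> in \<open>k\<close>; its own
    derivative at 0 is (4 - 2) times the y second derivative of \<open>W\<close>.\<close>
  define G where "G x y k = 2 * W1 x (y + 2 * k) - 2 * W1 x (y + 1 * k)" for x y k
  have G: "((\<lambda>k. diff2 k (W H x) y) has_real_derivative G x y k) (at k)" for x y k
  proof -
    have "((\<lambda>k. W H x (y + 2 * k) - 2 * W H x (y + 1 * k) + W H x y) has_real_derivative
        W1 x (y + 2 * k) * 2 - 2 * (W1 x (y + 1 * k) * 1) + 0) (at k)"
      by (intro DERIV_add DERIV_diff DERIV_cmult DERIV_const d1)
    then show ?thesis by (simp add: diff2_def G_def mult.commute)
  qed
  have "G x y = G 0 0"
  proof
    fix k
    have "((\<lambda>k. diff2 k (W H x) y) has_real_derivative G 0 0 k) (at k)"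
      unfolding all_eq[of x y] by (rule G)
    then show "G x y k = G 0 0 k" using DERIV_unique[OF G] by blast
  qed
  moreover have "(G x y has_real_derivative 2 * diff2 H (w x) y) (at 0)" for x y
  proof -
    have "((\<lambda>k. 2 * W1 x (y + 2 * k) - 2 * W1 x (y + 1 * k)) has_real_derivative
        2 * (diff2 H (w x) (y + 2 * 0) * 2) - 2 * (diff2 H (w x) (y + 1 * 0) * 1)) (at 0)"
      by (intro DERIV_diff DERIV_cmult d2)
    then show ?thesis by (simp add: G_def[abs_def])
  qed
  ultimately have "2 * diff2 H (w x) y = 2 * diff2 H (w 0) 0" by (metis DERIV_unique)
  then show ?thesis by simp
qed

end

subsection \<open>Conclusion\<close>

text \<open>Averaging the functional equation over \<open>H \<in> [0, 1]\<close> expresses \<open>f\<close> through an antiderivative, so \<open>f\<close> is smooth.\<close>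

lemma quadratic_of_diff2_const:
  fixes f :: "real \<Rightarrow> real"
  assumes f: "continuous_on UNIV f" and D: "\<And>H y. H \<ge> 0 \<Longrightarrow> diff2 H f y = A H"
  obtains B C where "\<And>y. f y = A 1 / 2 * y\<^sup>2 + B * y + C"
proof -
  have sym: "f (y + H) + f (y - H) - 2 * f y = f H + f (- H) - 2 * f 0" for y H
  proof (cases "H \<ge> 0")
    case True
    then show ?thesis using D[OF True, of "y - H"] D[OF True, of "- H"] by (simp add: diff2_def add.commute)
  next
    case False
    then have "- H \<ge> 0" by simp
    from D[OF this, of "y + H"] D[OF this, of H] show ?thesis by (simp add: diff2_def add.commute)
  qed
  obtain F where F: "\<And>y. (F has_real_derivative f y) (at y)" using antiderivative_UNIV[OF f] by blast
  have Fp: "((\<lambda>H. F (y + H)) has_real_derivative f (y + H)) (at H)"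
    and Fm: "((\<lambda>H. F (y - H)) has_real_derivative f (y - H) * (- 1)) (at H)" for y H
    by (rule DERIV_shift_arg, rule F)
      (rule DERIV_chain2[where f = F and g = "\<lambda>H. y - H", OF F], auto intro!: derivative_eq_intros)
  \<comment> \<open>The primitive in \<open>H\<close>, zero at 0, of the symmetric second difference
    of \<open>f\<close> at \<open>y\<close>. By \<open>sym\<close> that difference is independent of
    \<open>y\<close>, and at \<open>H = 1\<close> the formula can be solved for \<open>f y\<close>
    in terms of \<open>F\<close>.\<close>
  define \<Psi> where "\<Psi> y H = F (y + H) - F (y - H) - H * (2 * f y)" for y H
  have "\<Psi> y 1 - \<Psi> 0 1 = \<Psi> y 0 - \<Psi> 0 0" for y
  proof (rule DERIV_isconst_all[of "\<lambda>H. \<Psi> y H - \<Psi> 0 H", rule_format])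
    fix H
    have p: "((\<lambda>H. F (y + H) - F (y - H) - H * (2 * f y)) has_real_derivative
        f (y + H) - f (y - H) * (- 1) - 2 * f y) (at H)" for y
      by (intro DERIV_diff Fp Fm) (auto intro!: derivative_eq_intros)
    have "((\<lambda>H. \<Psi> y H - \<Psi> 0 H) has_real_derivative
        (f (y + H) - f (y - H) * (- 1) - 2 * f y) - (f (0 + H) - f (0 - H) * (- 1) - 2 * f 0)) (at H)"
      unfolding \<Psi>_def by (intro DERIV_diff[OF p p])
    then show "((\<lambda>H. \<Psi> y H - \<Psi> 0 H) has_real_derivative 0) (at H)" using sym[of y H] by simp
  qed
  note \<Psi>_const = this
  have "2 * f y = F (1 + y) - F (- 1 + y) - \<Psi> 0 1" for y
  proof -
    have "\<Psi> y 1 = F (1 + y) - F (- 1 + y) - 2 * f y" "\<Psi> y 0 = 0" "\<Psi> 0 0 = 0"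
      by (simp_all add: \<Psi>_def add.commute)
    then show ?thesis using \<Psi>_const[of y] by linarith
  qed
  then have "f y = (F (1 + y) - F (- 1 + y)) / 2 - \<Psi> 0 1 / 2" for y
    by (metis diff_divide_distrib nonzero_mult_div_cancel_left zero_neq_numeral)
  then have f_eq: "f = (\<lambda>y. (F (1 + y) - F (- 1 + y)) / 2 - \<Psi> 0 1 / 2)" by blast
  define f1 where "f1 y = (f (1 + y) - f (- 1 + y)) / 2" for y
  have Fs: "((\<lambda>y. F (c + y)) has_real_derivative f (c + y)) (at y)" for c y
    by (rule DERIV_shift_arg) (rule F)
  have "((\<lambda>y. (F (1 + y) - F (- 1 + y)) / 2 - \<Psi> 0 1 / 2) has_real_derivative f1 y - 0) (at y)" for y
    unfolding f1_def by (intro DERIV_diff DERIV_cdivide DERIV_const Fs)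
  then have f1: "(f has_real_derivative f1 y) (at y)" for y unfolding f_eq[symmetric] by simp
  define f2 where "f2 y = (f1 (1 + y) - f1 (- 1 + y)) / 2" for y
  have fs: "((\<lambda>y. f (c + y)) has_real_derivative f1 (c + y)) (at y)" for c y
    by (rule DERIV_shift_arg) (rule f1)
  have "((\<lambda>y. (f (1 + y) - f (- 1 + y)) / 2) has_real_derivative f2 y) (at y)" for y
    unfolding f2_def by (intro DERIV_diff DERIV_cdivide fs)
  then have f2: "(f1 has_real_derivative f2 y) (at y)" for y
    unfolding f1_def[abs_def] by simp
  have s1: "f1 (H + y) + f1 (- H + y) - 2 * f1 y = 0" for y H
  proof -
    have "((\<lambda>y. f (H + y) + f (- H + y) - 2 * f y) has_real_derivative f1 (H + y) + f1 (- H + y) - 2 * f1 y) (at y)"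
      by (intro DERIV_diff DERIV_add DERIV_cmult fs f1)
    moreover have "(\<lambda>y. f (H + y) + f (- H + y) - 2 * f y) = (\<lambda>_. f H + f (- H) - 2 * f 0)"
      using sym[of _ H] by (simp add: add.commute)
    ultimately show ?thesis using DERIV_unique DERIV_const by metis
  qed
  have f2_const: "f2 y = f2 0" for y
  proof -
    have a: "((\<lambda>H. f1 (c + H)) has_real_derivative f2 (c + H)) (at H)"
      and b: "((\<lambda>H. f1 (c - H)) has_real_derivative f2 (c - H) * (- 1)) (at H)" for c H
      by (rule DERIV_shift_arg, rule f2)
        (rule DERIV_chain2[where f = f1 and g = "\<lambda>H. c - H", OF f2], auto intro!: derivative_eq_intros)
    \<comment> \<open>Differentiating at \<open>H = y / 2\<close> about the centre
      \<open>y / 2\<close> puts the two arguments of \<open>f2\<close> at y and 0.\<close>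
    have "((\<lambda>H. f1 (y / 2 + H) + f1 (y / 2 - H) - 2 * f1 (y / 2)) has_real_derivative
        f2 (y / 2 + y / 2) + f2 (y / 2 - y / 2) * (- 1) - 0) (at (y / 2))"
      by (intro DERIV_diff DERIV_add DERIV_const a b)
    moreover have "(\<lambda>H. f1 (y / 2 + H) + f1 (y / 2 - H) - 2 * f1 (y / 2)) = (\<lambda>_. 0)"
      using s1[of _ "y / 2"] by (simp add: add.commute)
    ultimately have "f2 (y / 2 + y / 2) + f2 (y / 2 - y / 2) * (- 1) - 0 = 0"
      using DERIV_unique DERIV_const by metis
    then show ?thesis by simp
  qed
  have "f1 y - f2 0 * y = f1 0 - f2 0 * 0" for y
  proof (rule DERIV_isconst_all[of "\<lambda>y. f1 y - f2 0 * y", rule_format])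
    show "((\<lambda>y. f1 y - f2 0 * y) has_real_derivative 0) (at y)" for y
      using f2[of y] f2_const[of y] by (auto intro!: derivative_eq_intros)
  qed
  from this have f1_eq: "f1 y = f2 0 * y + f1 0" for y
    by (metis add.commute diff_add_cancel diff_zero mult_zero_right)
  have "f y - (f2 0 / 2 * y\<^sup>2 + f1 0 * y) = f 0 - (f2 0 / 2 * 0\<^sup>2 + f1 0 * 0)" for y
  proof (rule DERIV_isconst_all[of "\<lambda>y. f y - (f2 0 / 2 * y\<^sup>2 + f1 0 * y)", rule_format])
    show "((\<lambda>y. f y - (f2 0 / 2 * y\<^sup>2 + f1 0 * y)) has_real_derivative 0) (at y)" for y
      using f1[of y] f1_eq[of y] by (auto intro!: derivative_eq_intros)
  qed
  note q' = this
  have q: "f y = f2 0 / 2 * y\<^sup>2 + f1 0 * y + f 0" for y using q'[of y] by simp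
  moreover have "A 1 = f2 0"
    using D[of 1 0] q[of 2] q[of 1] q[of 0] by (simp add: diff2_def)
  ultimately show ?thesis using that by metis
qed

context weight
begin

text \<open>The power is x \<sigma>(x) times a constant, so the point 0 needs only continuity of
  \<sigma>. This second primitive of the weight is the source of the leading term of the
  solution.\<close>

lemma DERIV_second_primitive: "((\<lambda>x. \<bar>x\<bar> powr (2 + \<alpha>) / ((\<alpha> + 2) * (\<alpha> + 1))) has_real_derivative \<sigma> x) (at x)"
proof -
  have eq: "\<bar>x\<bar> powr (2 + \<alpha>) / ((\<alpha> + 2) * (\<alpha> + 1)) = x * \<sigma> x / (2 + \<alpha>)" for x
  proof -
    have "\<bar>x\<bar> powr (2 + \<alpha>) = \<bar>x\<bar> * \<bar>x\<bar> powr (1 + \<alpha>)"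
      using powr_add[of "\<bar>x\<bar>" 1 "1 + \<alpha>"] by (simp add: add.assoc[symmetric])
    also have "\<dots> = x * spow (1 + \<alpha>) x" by (simp add: spow_def abs_sgn mult_ac)
    finally show ?thesis by (simp add: \<sigma>_def mult.commute add.commute)
  qed
  have "((\<lambda>x. x * \<sigma> x) has_real_derivative (2 + \<alpha>) * \<sigma> x) (at x)"
  proof (cases "x = 0")
    case True
    have "isCont \<sigma> 0"
      using continuous_on_\<sigma>[OF continuous_on_id, of UNIV] by (simp add: continuous_on_eq_continuous_at)
    then have "(\<sigma> \<longlongrightarrow> 0) (at 0)" by (simp add: isCont_def)
    then have "((\<lambda>y. y * \<sigma> y / y) \<longlongrightarrow> 0) (at 0)"
      by (rule Lim_transform_eventually) (auto simp: eventually_at_filter)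
    then show ?thesis using True by (simp add: has_field_derivative_iff)
  next
    case False
    have "((\<lambda>x. x * \<sigma> x) has_real_derivative x * \<bar>x\<bar> powr \<alpha> + 1 * \<sigma> x) (at x)"
      by (intro DERIV_mult' DERIV_ident DERIV_\<sigma> False)
    moreover have "x * \<bar>x\<bar> powr \<alpha> = spow (1 + \<alpha>) x"
      using False by (simp add: spow_def powr_add sgn_if)
    then have "x * \<bar>x\<bar> powr \<alpha> = (1 + \<alpha>) * \<sigma> x"
      using \<alpha> by (simp add: \<sigma>_def)
    ultimately show ?thesis by (simp add: algebra_simps)
  qed
  from DERIV_cdivide[OF this, of "2 + \<alpha>"] show ?thesis
    unfolding eq using \<alpha> by simp
qed

end

section \<open>Explicit form of the transform and of the solution\<close>

context monge_ampere
begin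

lemma w_explicit:
  obtains a b0 b1 c0 c1 where "\<And>x y. w x y = a / 2 * y\<^sup>2 + (b1 * x + b0) * y
      - a * (\<bar>x\<bar> powr (2 + \<alpha>) / ((\<alpha> + 2) * (\<alpha> + 1))) + c1 * x + c0"
proof -
  define A where "A H = diff2 H (w 0) 0" for H
  define a where "a = A 1"
  have D: "H \<ge> 0 \<Longrightarrow> diff2 H (w x) y = A H" for H x y
    unfolding A_def by (rule diff2_w_const)
  have "\<exists>B C. \<forall>y. w x y = a / 2 * y\<^sup>2 + B * y + C" for x
  proof -
    have "continuous_on UNIV (w x)"
      using continuous_on_w'[OF continuous_on_const continuous_on_id] by simp
    from quadratic_of_diff2_const[of "w x" A, OF this D] show ?thesis unfolding a_def by metis
  qed
  then obtain B C where w: "\<And>x y. w x y = a / 2 * y\<^sup>2 + B x * y + C x" by metis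
  let ?Q = "\<lambda>x y. a / 24 * y ^ 4 + B x / 6 * y ^ 3 + C x / 2 * y\<^sup>2"
  let ?P = "\<lambda>x y. a / 6 * y ^ 3 + B x / 2 * y\<^sup>2 + C x * y"
  have Q: "(?Q x has_real_derivative ?P x y) (at y)" for x y
    by (auto intro!: derivative_eq_intros simp: field_simps)
  have P: "(?P x has_real_derivative w x y) (at y)" for x y
    unfolding w by (auto intro!: derivative_eq_intros simp: field_simps)
  have W: "W 1 x y = diff2 1 (?Q x) y" for x y
    unfolding W_def using average_eq_diff2(1)[OF Q P, of 1] by simp
  \<comment> \<open>The double average at -1 is symmetric about 0, so \<open>B x\<close> drops out
    and \<open>C x\<close> is isolated; at 0 its mean is 1, which then yields \<open>B x\<close>.
    Hence the x dependence of both coefficients follows from the equation for \<open>W\<close> at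
    two heights.\<close>
  have W0: "W 1 x 0 = 7 * a / 12 + B x + C x" and W1: "W 1 x (- 1) = a / 12 + C x" for x
    unfolding W diff2_def by (simp_all add: field_simps)
  obtain z where z: "\<And>x y. ((\<lambda>x. W 1 x y) has_real_derivative z x y) (at x)"
    "\<And>s y. ((\<lambda>s. z (\<xi> s) y) has_real_derivative - diff2 1 (w (\<xi> s)) y) (at s)"
    by (rule W_x_derivative[of 1]) (simp, rule that)
  have zx: "z x y = z 0 y - a * \<sigma> x" for x y
  proof -
    have "z (\<xi> s) y + a * s = z (\<xi> 0) y + a * 0" for s
    proof (rule DERIV_isconst_all[of "\<lambda>s. z (\<xi> s) y + a * s", rule_format])
      show "((\<lambda>s. z (\<xi> s) y + a * s) has_real_derivative 0) (at s)" for s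
        using z(2)[where y = y] D[of 1] by (auto intro!: derivative_eq_intros simp: a_def)
    qed
    from this[of "\<sigma> x"] show ?thesis by simp
  qed
  let ?S = "\<lambda>x. \<bar>x\<bar> powr (2 + \<alpha>) / ((\<alpha> + 2) * (\<alpha> + 1))"
  have lin: "W 1 x y + a * ?S x - z 0 y * x = W 1 0 y" for x y
  proof -
    have "W 1 x y + a * ?S x - z 0 y * x = W 1 0 y + a * ?S 0 - z 0 y * 0"
    proof (rule DERIV_isconst_all[of "\<lambda>x. W 1 x y + a * ?S x - z 0 y * x", rule_format])
      fix x
      have "((\<lambda>x. W 1 x y + a * ?S x - z 0 y * x) has_real_derivative z x y + a * \<sigma> x - z 0 y * 1) (at x)"
        by (intro DERIV_diff DERIV_add DERIV_cmult DERIV_ident z DERIV_second_primitive)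
      then show "((\<lambda>x. W 1 x y + a * ?S x - z 0 y * x) has_real_derivative 0) (at x)"
        unfolding zx[of x] by simp
    qed
    then show ?thesis by simp
  qed
  have C: "C x = C 0 + z 0 (- 1) * x - a * ?S x" for x
    using lin[of x "- 1"] unfolding W1 by linarith
  have B: "B x = B 0 + (z 0 0 - z 0 (- 1)) * x" for x
    using lin[of x 0] C[of x] unfolding W0 by (simp add: left_diff_distrib)
  show ?thesis
  proof (rule that)
    show "w x y = a / 2 * y\<^sup>2 + ((z 0 0 - z 0 (- 1)) * x + B 0) * y - a * ?S x + z 0 (- 1) * x + C 0" for x y
      unfolding w[of x y] using B[of x] C[of x] by (simp add: add.commute)
  qed
qed

text \<open>A supporting line of \<open>U x\<close> at \<open>t\<close>, with the right derivative
  as slope, makes \<open>t\<close> a maximizer for that slope; so \<open>U\<close> is recovered from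
  \<open>w\<close>.\<close>

lemma U_biconjugate:
  obtains y where "w x y = y * t - U x t"
proof -
  have "convex_on UNIV (U x)"
  proof (rule convex_onI)
    show "U x ((1 - l) *\<^sub>R t + l *\<^sub>R t') \<le> (1 - l) * U x t + l * U x t'" if "0 < l" "l < 1" for l t t'
      using U_convex[of l x x t t'] that by (simp add: algebra_simps)
  qed simp
  define y where "y = Inf ((\<lambda>v. (U x t - U x v) / (t - v)) ` {t<..})"
  have "U x t' \<ge> U x t + y * (t' - t)" for t'
    unfolding y_def using convex_le_Inf_differential[OF \<open>convex_on UNIV (U x)\<close>, of t t'] by simp
  then have "w x y = y * t - U x t" by (intro w_eqI) (simp add: algebra_simps)
  then show ?thesis by (rule that)
qed

lemma U_explicit:
  obtains a b k0 k1 k2 where "a > 0"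
    and "\<And>x t. U x t = a / ((\<alpha> + 2) * (\<alpha> + 1)) * \<bar>x\<bar> powr (2 + \<alpha>)
       + a * b\<^sup>2 / 2 * x\<^sup>2 + b * x * t + 1 / (2 * a) * t\<^sup>2 + (k0 + k1 * x + k2 * t)"
proof -
  obtain a b0 b1 c0 c1 where w: "\<And>x y. w x y = a / 2 * y\<^sup>2 + (b1 * x + b0) * y
      - a * (\<bar>x\<bar> powr (2 + \<alpha>) / ((\<alpha> + 2) * (\<alpha> + 1))) + c1 * x + c0"
    by (rule w_explicit) (rule that)
  let ?S = "\<lambda>x. \<bar>x\<bar> powr (2 + \<alpha>) / ((\<alpha> + 2) * (\<alpha> + 1))"
  have a: "a > 0"
  proof (rule ccontr)
    assume "\<not> a > 0"
    \<comment> \<open>If \<open>a\<close> were not positive, \<open>w 0 y\<close> would be at most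
      \<open>b0 * y + c0\<close> for y > 0, while testing with \<open>t = b0 + 1\<close> gives
      growth of slope at least \<open>b0 + 1\<close>; this \<open>y\<close> exceeds the
      constants.\<close>
    define y where "y = \<bar>U 0 (b0 + 1)\<bar> + \<bar>c0\<bar> + 1"
    have "a / 2 * y\<^sup>2 \<le> 0" using \<open>\<not> a > 0\<close> by (intro mult_nonpos_nonneg) auto
    moreover have "y * (b0 + 1) - w 0 y \<le> U 0 (b0 + 1)" using w_ge[of y "b0 + 1" 0] by simp
    ultimately have "y - c0 \<le> U 0 (b0 + 1)" unfolding w by (simp add: algebra_simps)
    then show False unfolding y_def by linarith
  qed
  have U: "U x t = (t - (b1 * x + b0))\<^sup>2 / (2 * a) + a * ?S x - c1 * x - c0" for x t
  proof -
    let ?\<beta> = "b1 * x + b0"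
    have e: "y * t - w x y = (t - ?\<beta>)\<^sup>2 / (2 * a) + a * ?S x - c1 * x - c0 - a / 2 * (y - (t - ?\<beta>) / a)\<^sup>2" for y
    proof -
      have "a / 2 * (y - (t - ?\<beta>) / a)\<^sup>2 = a / 2 * y\<^sup>2 - y * (t - ?\<beta>) + (t - ?\<beta>)\<^sup>2 / (2 * a)"
        using a by (simp add: power2_diff power_divide field_simps power2_eq_square)
      moreover have "y * (t - ?\<beta>) = y * t - ?\<beta> * y" by (simp add: algebra_simps)
      ultimately show ?thesis unfolding w[of x y] by linarith
    qed
    obtain y where "w x y = y * t - U x t" by (rule U_biconjugate)
    then have "U x t = y * t - w x y" by simp
    also have "\<dots> \<le> (t - ?\<beta>)\<^sup>2 / (2 * a) + a * ?S x - c1 * x - c0"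
      unfolding e using a by simp
    finally have "U x t \<le> (t - ?\<beta>)\<^sup>2 / (2 * a) + a * ?S x - c1 * x - c0" .
    moreover have "(t - ?\<beta>) / a * t - w x ((t - ?\<beta>) / a) \<le> U x t"
      using w_ge[of "(t - ?\<beta>) / a" t x] by simp
    then have "(t - ?\<beta>)\<^sup>2 / (2 * a) + a * ?S x - c1 * x - c0 \<le> U x t"
      unfolding e by simp
    ultimately show ?thesis by simp
  qed
  show ?thesis
  proof (rule that[OF a])
    fix x t
    \<comment> \<open>The parameter b of the final formula is -b1 / a: then a b^2 / 2 equals b1^2 /
      (2 a), the x^2 coefficient of the expanded square.\<close>
    have "(t - (b1 * x + b0))\<^sup>2 / (2 * a) = a * (- b1 / a)\<^sup>2 / 2 * x\<^sup>2 + (- b1 / a) * x * t + 1 / (2 * a) * t\<^sup>2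
       + (b0\<^sup>2 / (2 * a) + b0 * b1 / a * x + - b0 / a * t)"
      using a by (simp add: power2_eq_square field_simps)
    then show "U x t = a / ((\<alpha> + 2) * (\<alpha> + 1)) * \<bar>x\<bar> powr (2 + \<alpha>)
       + a * (- b1 / a)\<^sup>2 / 2 * x\<^sup>2 + (- b1 / a) * x * t + 1 / (2 * a) * t\<^sup>2
       + ((b0\<^sup>2 / (2 * a) - c0) + (b0 * b1 / a - c1) * x + - b0 / a * t)"
      unfolding U[of x t] by (simp add: algebra_simps)
  qed
qed

end

theorem theorem1p1:
  fixes \<alpha> :: real and u :: "real^2 \<Rightarrow> real"
  assumes "\<alpha> > -1"
    and "convex_on UNIV u"
    and "generalized_MA_solution UNIV (\<lambda>x. \<bar>x $ 1\<bar> powr \<alpha>) u"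
  shows "\<exists>a b l. a > 0 \<and> linear_function l \<and>
    (\<forall>x. u x = a / ((\<alpha> + 2) * (\<alpha> + 1)) * \<bar>x $ 1\<bar> powr (2 + \<alpha>)
            + a * b\<^sup>2 / 2 * (x $ 1)\<^sup>2 + b * x $ 1 * x $ 2
            + 1 / (2 * a) * (x $ 2)\<^sup>2 + l x)"
proof -
  interpret weight \<alpha> using assms(1) by unfold_locales
  interpret monge_ampere \<alpha> "\<lambda>x t. u (vec2 (x, t))"
    by (rule monge_ampere_vec2[OF assms(2,3)])
  obtain a b k0 k1 k2 where a: "a > 0" and u: "\<And>x t. u (vec2 (x, t)) = a / ((\<alpha> + 2) * (\<alpha> + 1)) * \<bar>x\<bar> powr (2 + \<alpha>)
       + a * b\<^sup>2 / 2 * x\<^sup>2 + b * x * t + 1 / (2 * a) * t\<^sup>2 + (k0 + k1 * x + k2 * t)"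
    by (rule U_explicit) (rule that)
  show ?thesis
  proof (intro exI conjI allI)
    show "a > 0" by (rule a)
    show "linear_function (\<lambda>x. k0 + k1 * x $ 1 + k2 * x $ 2)"
      unfolding linear_function_def by blast
    show "u x = a / ((\<alpha> + 2) * (\<alpha> + 1)) * \<bar>x $ 1\<bar> powr (2 + \<alpha>)
            + a * b\<^sup>2 / 2 * (x $ 1)\<^sup>2 + b * x $ 1 * x $ 2
            + 1 / (2 * a) * (x $ 2)\<^sup>2 + (k0 + k1 * x $ 1 + k2 * x $ 2)" for x
      using u[of "x $ 1" "x $ 2"] by simp
  qed
qed

end
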